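(* The numbers that are the topological entropy of a computable dynamical system $([0,1],f)$ are exactly the $\Sigma_1$-computable non-negative numbers. That is, $h\in[0,+\infty]$ equals $h(f)$ for some computable function $f:[0,1]\to[0,1]$ if and only if $h$ is $\Sigma_1$-computable.
   Context: A number is $\Sigma_1$-computable (lower-computable) if it is the supremum of a computable sequence of rationals; by convention $+\infty$ is considered a $\Sigma_1$-computable number. A function $f:[0,1]\to[0,1]$ is computable if there is an algorithm which, given rationals $q\in[0,1]$ and $r>0$, enumerates a set of pairs $(q_i,r_i)$ of rationals with $q_i\in[0,1]$, $r_i>0$ such that $f^{-1}(B(q,r))=\bigcup_i B(q_i,r_i)$, where $B(q,r)=\{z\in[0,1]:|z-q|<r\}$. Computable functions are continuous. Topological entropy of a continuous map $f$ of a compact metric space $X$: for a finite open cover $\mathcal{U}$ of $X$ let $N_n(f,\mathcal{U})$ be the minimal cardinality of a sub-cover of $\bigvee_{0\le k\le n-1}f^{-k}(\mathcal{U})$ (the collection of all intersections $\bigcap_{k=0}^{n-1}f^{-k}(U_k)$, $U_k\in\mathcal{U}$), $h(f,\mathcal{U})=\inf_{n\ge1}\frac{\log_2 N_n(f,\mathcal{U})}{n}$, and $h(f)=\sup_{\mathcal{U}}h(f,\mathcal{U})$. *)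

theory Defs
  imports "HOL-Analysis.Analysis" "HOL-Library.Nat_Bijection"
begin

text \<open>
  Kleene's partial recursive functions on tuples of natural numbers (lists). Primitive
  recursion and minimisation act on the first argument.
\<close>

datatype recf =
    Zero
  | Succ
  | Proj nat
  | Comp recf "recf list"
  | PrimRec recf recf
  | Mu recf

text \<open>\<open>recf_eval p xs y\<close>: the program \<open>p\<close> halts on input \<open>xs\<close> with output \<open>y\<close>.\<close>

inductive recf_eval :: "recf \<Rightarrow> nat list \<Rightarrow> nat \<Rightarrow> bool" where
  Zero: "recf_eval Zero xs 0"
| Succ: "recf_eval Succ (x # xs) (Suc x)"
| Proj: "i < length xs \<Longrightarrow> recf_eval (Proj i) xs (xs ! i)"
| Comp: "length ys = length gs \<Longrightarrow> \<forall>i<length gs. recf_eval (gs ! i) xs (ys ! i) \<Longrightarrow>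
    recf_eval f ys z \<Longrightarrow> recf_eval (Comp f gs) xs z"
| PrimRec_0: "recf_eval f xs y \<Longrightarrow> recf_eval (PrimRec f g) (0 # xs) y"
| PrimRec_Suc: "recf_eval (PrimRec f g) (n # xs) y \<Longrightarrow> recf_eval g (n # y # xs) z \<Longrightarrow>
    recf_eval (PrimRec f g) (Suc n # xs) z"
| Mu: "recf_eval f (n # xs) 0 \<Longrightarrow> \<forall>m<n. \<exists>y. recf_eval f (m # xs) (Suc y) \<Longrightarrow>
    recf_eval (Mu f) xs n"

lemma recf_eval_deterministic:
  "recf_eval p xs y \<Longrightarrow> recf_eval p xs z \<Longrightarrow> y = z"
proof (induction arbitrary: z rule: recf_eval.induct)
  case (Comp ys gs xs f z')
  from Comp.prems obtain ys' where ys': "length ys' = length gs"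
    "\<forall>i<length gs. recf_eval (gs ! i) xs (ys' ! i)" "recf_eval f ys' z"
    by (cases rule: recf_eval.cases) auto
  have "ys = ys'"
    using Comp.hyps(1) Comp.IH(1) ys' by (intro nth_equalityI) auto
  then show ?case using Comp.IH(2) ys' by blast
next
  case (Mu f n xs)
  from Mu.prems have z: "recf_eval f (z # xs) 0" "\<forall>m<z. \<exists>y. recf_eval f (m # xs) (Suc y)"
    by (cases rule: recf_eval.cases; auto)+
  have "\<not> z < n" using Mu.IH(2) z(1) by fastforce
  moreover have "\<not> n < z" using Mu.IH(1) z(2) by fastforce
  ultimately show ?case by simp
next
  case (PrimRec_0 f xs y g)
  from PrimRec_0.prems have "recf_eval f xs z" by (cases rule: recf_eval.cases) auto
  then show ?case by (rule PrimRec_0.IH)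
next
  case (PrimRec_Suc f g n xs y z')
  from PrimRec_Suc.prems obtain y' where "recf_eval (PrimRec f g) (n # xs) y'"
    "recf_eval g (n # y' # xs) z"
    by (cases rule: recf_eval.cases) auto
  then show ?case using PrimRec_Suc.IH by blast
next
  case (Zero xs)
  then show ?case by (cases rule: recf_eval.cases) auto
next
  case (Succ x xs)
  then show ?case by (cases rule: recf_eval.cases) auto
next
  case (Proj i xs)
  from Proj.prems show ?case by (cases rule: recf_eval.cases) auto
qed

text \<open>
  Every rational number has infinitely many codes. Algorithms receive an arbitrary code of
  their input and may produce an arbitrary code of their output.
\<close>

definition rat_of_code :: "nat \<Rightarrow> rat" where
  "rat_of_code c = (case prod_decode c of (a, b) \<Rightarrow> of_int (int_decode a) / of_nat (Suc b))"

definition rat_pair_of_code :: "nat \<Rightarrow> rat \<times> rat" where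
  "rat_pair_of_code c = map_prod rat_of_code rat_of_code (prod_decode c)"

definition computable_rat_seq :: "(nat \<Rightarrow> rat) \<Rightarrow> bool" where
  "computable_rat_seq s \<longleftrightarrow> (\<exists>p. \<forall>n. \<exists>c. recf_eval p [n] c \<and> rat_of_code c = s n)"

definition lower_computable :: "ereal \<Rightarrow> bool" where
  "lower_computable h \<longleftrightarrow>
     h = \<infinity> \<or> (\<exists>s. computable_rat_seq s \<and> h = (SUP n. ereal (of_rat (s n))))"

definition unit_ball :: "rat \<Rightarrow> rat \<Rightarrow> real set" where
  "unit_ball q r = {z \<in> {0..1}. \<bar>z - of_rat q\<bar> < of_rat r}"

text \<open>
  The set of pairs of rationals enumerated by \<open>p\<close> on input \<open>xs\<close>. As \<open>p\<close> may diverge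
  at some or all stages \<open>n\<close>, finite sets and the empty set can be enumerated too.
\<close>

definition enumerated :: "recf \<Rightarrow> nat list \<Rightarrow> (rat \<times> rat) set" where
  "enumerated p xs = {rat_pair_of_code c | n c. recf_eval p (xs @ [n]) c}"

text \<open>Only the restriction of \<open>f\<close> to the unit interval matters.\<close>

definition computable_unit_map :: "(real \<Rightarrow> real) \<Rightarrow> bool" where
  "computable_unit_map f \<longleftrightarrow>
     f \<in> {0..1} \<rightarrow> {0..1} \<and>
     (\<exists>p. \<forall>i j q r. rat_of_code i = q \<and> rat_of_code j = r \<and> 0 \<le> q \<and> q \<le> 1 \<and> 0 < r \<longrightarrow>
        (\<forall>(q', r') \<in> enumerated p [i, j]. 0 \<le> q' \<and> q' \<le> 1 \<and> 0 < r') \<and>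
        {x \<in> {0..1}. f x \<in> unit_ball q r} = (\<Union>(q', r') \<in> enumerated p [i, j]. unit_ball q' r'))"

definition finite_open_cover :: "'a::topological_space set \<Rightarrow> 'a set set \<Rightarrow> bool" where
  "finite_open_cover X \<U> \<longleftrightarrow>
     finite \<U> \<and> (\<forall>U\<in>\<U>. openin (top_of_set X) U) \<and> \<Union>\<U> = X"

definition iterated_join :: "'a set \<Rightarrow> ('a \<Rightarrow> 'a) \<Rightarrow> 'a set set \<Rightarrow> nat \<Rightarrow> 'a set set" where
  "iterated_join X f \<U> n = {{x \<in> X. \<forall>k<n. (f ^^ k) x \<in> U k} | U. \<forall>k<n. U k \<in> \<U>}"

definition min_subcover_card :: "'a set \<Rightarrow> ('a \<Rightarrow> 'a) \<Rightarrow> 'a set set \<Rightarrow> nat \<Rightarrow> nat" where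
  "min_subcover_card X f \<U> n = Inf {card \<V> | \<V>. \<V> \<subseteq> iterated_join X f \<U> n \<and> \<Union>\<V> = X}"

definition cover_entropy :: "'a set \<Rightarrow> ('a \<Rightarrow> 'a) \<Rightarrow> 'a set set \<Rightarrow> ereal" where
  "cover_entropy X f \<U> = (INF n\<in>{1..}. ereal (log 2 (real (min_subcover_card X f \<U> n)) / real n))"

definition topological_entropy :: "'a::topological_space set \<Rightarrow> ('a \<Rightarrow> 'a) \<Rightarrow> ereal" where
  "topological_entropy X f = (SUP \<U>\<in>{\<U>. finite_open_cover X \<U>}. cover_entropy X f \<U>)"

end

theory Submission
  imports Defs
begin

text \<open>
  The entropy of an interval map can be certified from below by finite data, and this is what
  makes it lower computable. Suppose that in an interval $[u,v]$ there are $s$ consecutive pairs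
  of points such that $f^N$ sends the two points of each pair to opposite sides of $[u,v]$. Then
  $f^N$ maps $s$ disjoint compact pieces of $[u,v]$ onto $[u,v]$, every word over $s$ symbols is
  the itinerary of some orbit, and $h(f) \ge (\log_2 s)/N$ (\<open>horseshoe_entropy\<close>). As the
  inequalities are strict, the points can be taken rational, and a program for $f$ confirms such
  a horseshoe after finitely many steps (\<open>semidecidable_horseshoe\<close>). It remains to see
  that horseshoes exhaust the entropy; this is Misiurewicz's theorem, \<open>horseshoe_exists\<close>.

  For its proof cut $[0,1]$ into cells that are small for the given cover, and code the orbits of
  $g = f^l$ by words of cells. The set of end points of the orbits that start in a given interval
  and follow a given word is again an interval, so its image meets a run of consecutive cells and
  contains all of them except possibly the two extreme ones. Hence among the continuations of a
  word at most two fail to fill a whole cell, and there are at most $2^n$ words of length $n$ that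
  never fill a cell. A word that fills a cell forgets its past. Splitting words at the times when
  they fill cells shows the following: if $\theta \ge 1$ and for all $n$ at most $2^{\theta n}$ words
  of length $n$ lead from any full cell back to the same full cell, then up to a polynomial factor
  there are at most $2^{\theta n}$ words in all (\<open>card_restricted\<close>). If $l$ is so large that
  the words of $g$ grow faster than $2^n$, then some full cell must have many return words, and
  these are, up to the loss of two, the branches of a horseshoe.

  For the converse, a lower computable $h \ge 0$ is the supremum of $\log_2 \lambda_j$ for a
  computable sequence of rationals $\lambda_j \ge 1$ (\<open>log_slopes_Sup\<close>). A map that is
  piecewise affine with slopes $\pm\lambda$ has entropy $\log_2 \lambda$. The upper bound holds
  because $\lambda$ is a Lipschitz constant. For the lower bound (\<open>bends_entropy\<close>), note
  that near any point $f^m$ has at most two affine branches, both of slope $\pm\lambda^m$; so in a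
  cover by small balls the Lebesgue measure of the points with a prescribed itinerary shrinks by
  the factor $2 / \lambda^m$ in every $m$ steps, and many itineraries are needed to cover the
  interval. Conjugate copies of such maps, one for each $j$, are placed on the intervals
  $[1/(j+2), 1/(j+1)]$; their end points are fixed and they accumulate at the fixed point $0$.
  The resulting map has entropy $h$ (\<open>entropy_eq\<close>). It is computable
  (\<open>computable_glued\<close>) because $\lambda_j \le j + 1$ gives explicit Lipschitz constants
  away from $0$ while every interval $[0, 1/(J+1)]$ is invariant.
\<close>

section \<open>Total recursive functions\<close>

definition total_recursive :: "nat \<Rightarrow> (nat list \<Rightarrow> nat) \<Rightarrow> bool" where
  "total_recursive k F \<longleftrightarrow> (\<exists>p. \<forall>xs. length xs = k \<longrightarrow> recf_eval p xs (F xs))"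

lemma total_recursive_cong:
  assumes "total_recursive k F" "\<And>xs. length xs = k \<Longrightarrow> F xs = G xs"
  shows "total_recursive k G"
  using assms unfolding total_recursive_def by metis

lemma total_recursive_proj: "i < k \<Longrightarrow> total_recursive k (\<lambda>xs. xs ! i)"
  unfolding total_recursive_def by (auto intro!: exI[of _ "Proj i"] recf_eval.Proj)

lemma total_recursive_comp:
  assumes "total_recursive (length Gs) H" "\<forall>G\<in>set Gs. total_recursive k G"
  shows "total_recursive k (\<lambda>xs. H (map (\<lambda>G. G xs) Gs))"
proof -
  obtain p where p: "\<And>xs. length xs = length Gs \<Longrightarrow> recf_eval p xs (H xs)"
    using assms(1) unfolding total_recursive_def by blast
  have "\<forall>G\<in>set Gs. \<exists>q. \<forall>xs. length xs = k \<longrightarrow> recf_eval q xs (G xs)"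
    using assms(2) unfolding total_recursive_def by blast
  then obtain Q where Q: "\<And>G xs. G \<in> set Gs \<Longrightarrow> length xs = k \<Longrightarrow> recf_eval (Q G) xs (G xs)"
    by metis
  have "recf_eval (Comp p (map Q Gs)) xs (H (map (\<lambda>G. G xs) Gs))" if "length xs = k" for xs
    by (rule recf_eval.Comp[where ys = "map (\<lambda>G. G xs) Gs"]) (use Q p that in auto)
  then show ?thesis unfolding total_recursive_def by blast
qed

lemma total_recursive_comp1:
  assumes "total_recursive 1 (\<lambda>xs. h (xs ! 0))" "total_recursive k F"
  shows "total_recursive k (\<lambda>xs. h (F xs))"
  using total_recursive_comp[of "[F]" "\<lambda>xs. h (xs ! 0)" k] assms by simp

lemma total_recursive_Suc: "total_recursive k F \<Longrightarrow> total_recursive k (\<lambda>xs. Suc (F xs))"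
proof (rule total_recursive_comp1[of Suc])
  have "recf_eval Succ xs (Suc (xs ! 0))" if "length xs = 1" for xs
    using that by (cases xs) (auto intro: recf_eval.Succ)
  then show "total_recursive 1 (\<lambda>xs. Suc (xs ! 0))"
    unfolding total_recursive_def by blast
qed

lemma total_recursive_const: "total_recursive k (\<lambda>xs. n)"
proof (induction n)
  case 0
  show ?case unfolding total_recursive_def by (auto intro!: exI[of _ Zero] recf_eval.Zero)
next
  case (Suc n)
  then show ?case by (rule total_recursive_Suc)
qed

lemma total_recursive_rec:
  assumes "total_recursive k F" "total_recursive (Suc (Suc k)) G" "total_recursive k N"
  shows "total_recursive k (\<lambda>xs. rec_nat (F xs) (\<lambda>m y. G (m # y # xs)) (N xs))"
proof -
  obtain f g where f: "\<And>xs. length xs = k \<Longrightarrow> recf_eval f xs (F xs)"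
    and g: "\<And>xs. length xs = Suc (Suc k) \<Longrightarrow> recf_eval g xs (G xs)"
    using assms(1,2) unfolding total_recursive_def by blast
  let ?R = "\<lambda>xs. rec_nat (F xs) (\<lambda>m y. G (m # y # xs))"
  have "recf_eval (PrimRec f g) (n # xs) (?R xs n)" if "length xs = k" for n xs
  proof (induction n)
    case 0
    then show ?case using f[OF that] by (auto intro: recf_eval.PrimRec_0)
  next
    case (Suc n)
    then show ?case using g[of "n # ?R xs n # xs"] that by (auto intro: recf_eval.PrimRec_Suc)
  qed
  then have "total_recursive (Suc k) (\<lambda>ys. ?R (tl ys) (hd ys))"
    unfolding total_recursive_def
    by (intro exI[of _ "PrimRec f g"] allI impI) (auto simp: length_Suc_conv)
  moreover have "\<forall>H\<in>set (N # map (\<lambda>i xs. xs ! i) [0..<k]). total_recursive k H"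
    using assms(3) by (auto intro: total_recursive_proj)
  ultimately have "total_recursive k (\<lambda>xs. (\<lambda>ys. ?R (tl ys) (hd ys))
      (map (\<lambda>H. H xs) (N # map (\<lambda>i xs. xs ! i) [0..<k])))"
    by (intro total_recursive_comp) auto
  then show ?thesis
    by (rule total_recursive_cong) (auto simp: comp_def map_nth)
qed

lemma total_recursive_Least:
  assumes "total_recursive (Suc k) G" "\<And>xs. length xs = k \<Longrightarrow> \<exists>n. G (n # xs) = 0"
  shows "total_recursive k (\<lambda>xs. LEAST n. G (n # xs) = 0)"
proof -
  obtain g where g: "\<And>xs. length xs = Suc k \<Longrightarrow> recf_eval g xs (G xs)"
    using assms(1) unfolding total_recursive_def by blast
  have "recf_eval (Mu g) xs (LEAST n. G (n # xs) = 0)" if "length xs = k" for xs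
  proof (rule recf_eval.Mu)
    let ?n = "LEAST n. G (n # xs) = 0"
    have "G (?n # xs) = 0" using assms(2)[OF that] by (rule LeastI_ex)
    then show "recf_eval g (?n # xs) 0" using g[of "?n # xs"] that by simp
    show "\<forall>m<?n. \<exists>y. recf_eval g (m # xs) (Suc y)"
    proof (intro allI impI)
      fix m assume "m < ?n"
      then have "G (m # xs) \<noteq> 0" by (rule not_less_Least)
      then obtain y where "G (m # xs) = Suc y" by (cases "G (m # xs)") auto
      then show "\<exists>y. recf_eval g (m # xs) (Suc y)" using g[of "m # xs"] that by auto
    qed
  qed
  then show ?thesis unfolding total_recursive_def by blast
qed

lemma total_recursive_add:
  assumes "total_recursive k F" "total_recursive k G"
  shows "total_recursive k (\<lambda>xs. F xs + G xs)"
proof (rule total_recursive_cong[OF total_recursive_rec[OF assms(1) _ assms(2)]])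
  show "total_recursive (Suc (Suc k)) (\<lambda>ys. Suc (ys ! 1))"
    by (intro total_recursive_Suc total_recursive_proj) simp
  have "rec_nat a (\<lambda>m y. Suc ((m # y # xs) ! 1)) n = a + n" for a n xs
    by (induction n) simp_all
  then show "rec_nat (F xs) (\<lambda>m y. Suc ((m # y # xs) ! 1)) (G xs) = F xs + G xs" for xs .
qed

lemma total_recursive_diff:
  assumes "total_recursive k F" "total_recursive k G"
  shows "total_recursive k (\<lambda>xs. F xs - G xs)"
proof -
  have "total_recursive 1 (\<lambda>xs. rec_nat 0 (\<lambda>m y. (m # y # xs) ! 0) (xs ! 0))"
    by (intro total_recursive_rec total_recursive_const total_recursive_proj) auto
  then have "total_recursive 1 (\<lambda>xs. xs ! 0 - 1)"
  proof (rule total_recursive_cong)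
    fix xs :: "nat list"
    show "rec_nat 0 (\<lambda>m y. (m # y # xs) ! 0) (xs ! 0) = xs ! 0 - 1"
      by (cases "xs ! 0") simp_all
  qed
  from total_recursive_comp1[OF this, of "Suc (Suc k)" "\<lambda>ys. ys ! 1"]
  have P: "total_recursive (Suc (Suc k)) (\<lambda>ys. ys ! 1 - 1)"
    by (simp add: total_recursive_proj)
  have *: "rec_nat a (\<lambda>m y. (m # y # xs) ! 1 - 1) n = a - n" for a n :: nat and xs
    by (induction n) auto
  show ?thesis
    using total_recursive_rec[OF assms(1) P assms(2)] by (rule total_recursive_cong) (simp only: *)
qed

lemma total_recursive_triangle:
  assumes "total_recursive k F"
  shows "total_recursive k (\<lambda>xs. triangle (F xs))"
proof -
  have *: "rec_nat 0 (\<lambda>m y. Suc ((m # y # xs) ! 0) + (m # y # xs) ! 1) n = triangle n" for n xs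
    by (induction n) auto
  have "total_recursive (Suc (Suc k)) (\<lambda>ys. Suc (ys ! 0) + ys ! 1)"
    by (intro total_recursive_add total_recursive_Suc total_recursive_proj) auto
  from total_recursive_rec[OF total_recursive_const[of k 0] this assms] show ?thesis
    by (rule total_recursive_cong) (simp only: *)
qed

lemma total_recursive_prod_encode:
  assumes "total_recursive k F" "total_recursive k G"
  shows "total_recursive k (\<lambda>xs. prod_encode (F xs, G xs))"
  unfolding prod_encode_def using assms
  by (auto intro!: total_recursive_add total_recursive_triangle)

text \<open>
  The pairing function runs through the diagonals of the plane. The diagonal of a code is found by
  an unbounded search, and both components are then read off from their position on it.
\<close>

lemma prod_encode_diagonal:
  "(LEAST k. Suc (prod_encode (a, b)) - triangle (Suc k) = 0) = a + b"
proof (rule Least_equality)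
  show "Suc (prod_encode (a, b)) - triangle (Suc (a + b)) = 0"
    by (simp add: prod_encode_def)
  fix k assume *: "Suc (prod_encode (a, b)) - triangle (Suc k) = 0"
  show "a + b \<le> k"
  proof (rule ccontr)
    assume "\<not> a + b \<le> k"
    then have "Suc k \<le> a + b" by simp
    then have "triangle (Suc k) \<le> triangle (a + b)"
      unfolding triangle_def by (intro div_le_mono mult_le_mono) auto
    then show False using * by (simp add: prod_encode_def)
  qed
qed

lemma total_recursive_fst_snd_prod_decode:
  assumes "total_recursive k F"
  shows "total_recursive k (\<lambda>xs. fst (prod_decode (F xs)))"
    and "total_recursive k (\<lambda>xs. snd (prod_decode (F xs)))"
proof -
  let ?D = "\<lambda>n. LEAST k. Suc n - triangle (Suc k) = 0"
  have "total_recursive 1 (\<lambda>xs. ?D ((k # xs) ! 1))" for k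
  proof (rule total_recursive_cong)
    show "total_recursive 1 (\<lambda>xs. LEAST k. Suc ((k # xs) ! 1) - triangle (Suc ((k # xs) ! 0)) = 0)"
    proof (intro total_recursive_Least total_recursive_diff total_recursive_triangle
        total_recursive_Suc total_recursive_proj; (simp; fail)?)
      fix xs :: "nat list" assume "length xs = 1"
      then obtain n where "xs = [n]" by (auto simp: length_Suc_conv)
      then show "\<exists>k. Suc ((k # xs) ! 1) - triangle (Suc ((k # xs) ! 0)) = 0"
        by (intro exI[of _ n]) simp
    qed
  qed simp
  then have "total_recursive 1 (\<lambda>xs. ?D (xs ! 0))" by simp
  from total_recursive_comp1[OF this assms]
  have D: "total_recursive k (\<lambda>xs. ?D (F xs))" .
  have dec: "fst (prod_decode n) = n - triangle (?D n)"
    "snd (prod_decode n) = ?D n - (n - triangle (?D n))" for n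
  proof -
    obtain a b where n: "n = prod_encode (a, b)" by (metis prod_decode_inverse surj_pair)
    have D: "?D n = a + b" unfolding n by (rule prod_encode_diagonal)
    show "fst (prod_decode n) = n - triangle (?D n)"
      "snd (prod_decode n) = ?D n - (n - triangle (?D n))"
      unfolding D by (simp_all add: n) (simp_all add: prod_encode_def)
  qed
  show "total_recursive k (\<lambda>xs. fst (prod_decode (F xs)))"
    "total_recursive k (\<lambda>xs. snd (prod_decode (F xs)))"
    unfolding dec by (intro total_recursive_diff total_recursive_triangle D assms)+
qed

section \<open>Computable functions on represented types\<close>

text \<open>
  An element may have many codes, as the rational numbers do. A computable function has to turn
  every code of its argument into some code of its value.
\<close>

class represented =
  fixes decode :: "nat \<Rightarrow> 'a"
  assumes decode_surj: "\<exists>n. decode n = x"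

instantiation nat :: represented begin
definition decode_nat :: "nat \<Rightarrow> nat" where [simp]: "decode_nat n = n"
instance by standard simp
end

instantiation bool :: represented begin
definition decode_bool :: "nat \<Rightarrow> bool" where [simp]: "decode_bool n \<longleftrightarrow> n \<noteq> 0"
instance
proof
  fix x :: bool
  show "\<exists>n. decode n = x" by (cases x) (auto intro: exI[of _ 0] exI[of _ 1])
qed
end

instantiation prod :: (represented, represented) represented begin
definition decode_prod :: "nat \<Rightarrow> 'a \<times> 'b" where "decode_prod n = map_prod decode decode (prod_decode n)"
instance
proof
  fix x :: "'a \<times> 'b"
  obtain m n where "decode m = fst x" "decode n = snd x" using decode_surj by metis
  then show "\<exists>n. decode n = x" by (intro exI[of _ "prod_encode (m, n)"]) (auto simp: decode_prod_def)
qed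
end

lemma decode_prod_encode [simp]: "decode (prod_encode (m, n)) = (decode m, decode n)"
  by (simp add: decode_prod_def)

instantiation rat :: represented begin
definition decode_rat :: "nat \<Rightarrow> rat" where "decode_rat = rat_of_code"
instance
proof
  fix x :: rat
  obtain a b where x: "x = Fract a b" "b > 0" by (cases x) auto
  then have "x = of_int a / of_nat (Suc (nat b - 1))" by (simp add: Fract_of_int_quotient)
  then show "\<exists>n. decode n = x"
    by (intro exI[of _ "prod_encode (int_encode a, nat b - 1)"])
      (simp add: decode_rat_def rat_of_code_def)
qed
end

definition realized_by :: "('a::represented \<Rightarrow> 'b::represented) \<Rightarrow> (nat \<Rightarrow> nat) \<Rightarrow> bool" where
  "realized_by f c \<longleftrightarrow> total_recursive 1 (\<lambda>xs. c (xs ! 0)) \<and> (\<forall>n. decode (c n) = f (decode n))"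

definition computable :: "('a::represented \<Rightarrow> 'b::represented) \<Rightarrow> bool" where
  "computable f \<longleftrightarrow> (\<exists>c. realized_by f c)"

lemma total_recursive_realized:
  "realized_by f c \<Longrightarrow> total_recursive k F \<Longrightarrow> total_recursive k (\<lambda>xs. c (F xs))"
  unfolding realized_by_def using total_recursive_comp1 by blast

lemma decode_realized: "realized_by f c \<Longrightarrow> decode (c n) = f (decode n)"
  unfolding realized_by_def by blast

lemma computableI:
  assumes "total_recursive 1 (\<lambda>xs. c (xs ! 0))" "\<And>n. decode (c n) = f (decode n)"
  shows "computable f"
  using assms unfolding computable_def realized_by_def by blast

named_theorems computable_intros

lemma computable_id [computable_intros]: "computable (\<lambda>x. x)"
  by (rule computableI[of "\<lambda>n. n"]) (auto intro: total_recursive_proj)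

lemma computable_const [computable_intros]: "computable (\<lambda>x. a)"
proof -
  obtain n where "decode n = a" using decode_surj by blast
  then show ?thesis
    by (intro computableI[of "\<lambda>_. n"]) (auto intro: total_recursive_const)
qed

lemma computable_comp:
  assumes "computable g" "computable f"
  shows "computable (\<lambda>x. g (f x))"
proof -
  obtain c where c: "realized_by g c"
    using assms(1) unfolding computable_def by blast
  obtain d where d: "realized_by f d"
    using assms(2) unfolding computable_def by blast
  show ?thesis
    by (rule computableI[of "\<lambda>n. c (d n)"]) (auto intro!: total_recursive_realized[OF c] total_recursive_realized[OF d] total_recursive_proj simp: decode_realized[OF c] decode_realized[OF d])
qed

lemma computable_decode: "computable (decode :: nat \<Rightarrow> 'a::represented)"
  by (rule computableI[of "\<lambda>n. n"]) (auto intro: total_recursive_proj)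

text \<open>
  The decoding function is realised by the identity on codes, so computability on a represented
  type can be checked on codes.
\<close>

lemma computable_via_code: "computable (\<lambda>n::nat. f (decode n)) \<longleftrightarrow> computable f"
  unfolding computable_def realized_by_def by simp

lemma computable_Pair [computable_intros]:
  assumes "computable f" "computable g"
  shows "computable (\<lambda>x. (f x, g x))"
proof -
  obtain c where c: "realized_by f c"
    using assms(1) unfolding computable_def by blast
  obtain d where d: "realized_by g d"
    using assms(2) unfolding computable_def by blast
  show ?thesis
    by (rule computableI[of "\<lambda>n. prod_encode (c n, d n)"])
      (auto intro!: total_recursive_realized[OF c] total_recursive_realized[OF d] total_recursive_proj total_recursive_prod_encode simp: decode_realized[OF c] decode_realized[OF d])
qed

lemma computable_fst [computable_intros]: "computable f \<Longrightarrow> computable (\<lambda>x. fst (f x))"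
  by (rule computable_comp[of fst], rule computableI[of "\<lambda>n. fst (prod_decode n)"])
    (auto intro!: total_recursive_fst_snd_prod_decode total_recursive_proj simp: decode_prod_def)

lemma computable_snd [computable_intros]: "computable f \<Longrightarrow> computable (\<lambda>x. snd (f x))"
  by (rule computable_comp[of snd], rule computableI[of "\<lambda>n. snd (prod_decode n)"])
    (auto intro!: total_recursive_fst_snd_prod_decode total_recursive_proj simp: decode_prod_def)

lemma computable_Suc [computable_intros]: "computable f \<Longrightarrow> computable (\<lambda>x. Suc (f x))"
  by (rule computable_comp[of Suc], rule computableI[of Suc])
    (auto intro!: total_recursive_Suc total_recursive_proj)

text \<open>
  The only code of \<open>False\<close> is zero, so primitive recursion on a code of the condition selects
  the branch.
\<close>

lemma computable_if [computable_intros]: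
  assumes "computable b" "computable f" "computable g"
  shows "computable (\<lambda>x. if b x then f x else g x)"
proof -
  obtain a where a: "realized_by b a"
    using assms(1) unfolding computable_def by blast
  obtain c where c: "realized_by f c"
    using assms(2) unfolding computable_def by blast
  obtain d where d: "realized_by g d"
    using assms(3) unfolding computable_def by blast
  show ?thesis
  proof (rule computableI)
    have "total_recursive 1 (\<lambda>xs. rec_nat (d (xs ! 0)) (\<lambda>m y. c ((m # y # xs) ! 2)) (a (xs ! 0)))"
      by (intro total_recursive_rec total_recursive_realized[OF a] total_recursive_realized[OF c] total_recursive_realized[OF d] total_recursive_proj) auto
    then show "total_recursive 1 (\<lambda>xs. (\<lambda>n. rec_nat (d n) (\<lambda>m y. c n) (a n)) (xs ! 0))"
      by simp
    have "decode (a n) = (a n \<noteq> 0)" for n by simp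
    then show "decode (rec_nat (d n) (\<lambda>m y. c n) (a n)) = (if b (decode n) then f (decode n) else g (decode n))" for n
      using decode_realized[OF a, of n] decode_realized[OF c, of n] decode_realized[OF d, of n] by (cases "a n") auto
  qed
qed

lemma computable_rec_nat [computable_intros]:
  assumes "computable f" "computable (\<lambda>z. g (fst z) (fst (snd z)) (snd (snd z)))" "computable N"
  shows "computable (\<lambda>x. rec_nat (f x) (\<lambda>m y. g m y x) (N x))"
proof -
  obtain a where a: "realized_by f a"
    using assms(1) unfolding computable_def by blast
  obtain c where c: "realized_by (\<lambda>z. g (fst z) (fst (snd z)) (snd (snd z))) c"
    using assms(2) unfolding computable_def by blast
  obtain d where d: "realized_by N d"
    using assms(3) unfolding computable_def by blast
  show ?thesis
  proof (rule computableI)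
    have "total_recursive 1 (\<lambda>xs. rec_nat (a (xs ! 0))
        (\<lambda>m y. c (prod_encode ((m # y # xs) ! 0, prod_encode ((m # y # xs) ! 1, (m # y # xs) ! 2)))) (d (xs ! 0)))"
      by (intro total_recursive_rec total_recursive_realized[OF a] total_recursive_realized[OF c] total_recursive_realized[OF d] total_recursive_proj total_recursive_prod_encode) auto
    then show "total_recursive 1 (\<lambda>xs. (\<lambda>n. rec_nat (a n) (\<lambda>m y. c (prod_encode (m, prod_encode (y, n)))) (d n)) (xs ! 0))"
      by simp
    fix n
    have *: "decode (rec_nat (a n) (\<lambda>m y. c (prod_encode (m, prod_encode (y, n)))) k)
      = rec_nat (f (decode n)) (\<lambda>m y. g m y (decode n)) k" for k
      by (induction k) (auto simp: decode_realized[OF a] decode_realized[OF c])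
    show "decode (rec_nat (a n) (\<lambda>m y. c (prod_encode (m, prod_encode (y, n)))) (d n))
      = rec_nat (f (decode n)) (\<lambda>m y. g m y (decode n)) (N (decode n))"
      using decode_realized[OF d, of n] by (simp add: *)
  qed
qed


lemma computable_prod_decode [computable_intros]:
  "computable f \<Longrightarrow> computable (\<lambda>x. prod_decode (f x))"
  by (rule computable_comp[of prod_decode], rule computableI[of "\<lambda>n. n"])
    (auto intro: total_recursive_proj simp: decode_prod_def map_prod_def split: prod.splits)

lemma computable_prod_encode [computable_intros]:
  "computable f \<Longrightarrow> computable (\<lambda>x. prod_encode (f x))"
  by (rule computable_comp[of prod_encode], rule computableI[of "\<lambda>n. n"])
    (auto intro: total_recursive_proj simp: decode_prod_def map_prod_def split: prod.splits)

lemma computable_decode_of [computable_intros]: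
  "computable f \<Longrightarrow> computable (\<lambda>x. decode (f x))"
  by (rule computable_comp[OF computable_decode])

lemma computable_add [computable_intros]:
  fixes f g :: "'a::represented \<Rightarrow> nat"
  assumes "computable f" "computable g"
  shows "computable (\<lambda>x. f x + g x)"
proof -
  have "rec_nat a (\<lambda>m y. Suc y) b = a + b" for a b by (induction b) auto
  moreover have "computable (\<lambda>x. rec_nat (f x) (\<lambda>m y. Suc y) (g x))"
    by (intro computable_intros assms)
  ultimately show ?thesis by simp
qed

lemma computable_mult [computable_intros]:
  fixes f g :: "'a::represented \<Rightarrow> nat"
  assumes "computable f" "computable g"
  shows "computable (\<lambda>x. f x * g x)"
proof -
  have "rec_nat 0 (\<lambda>m y. y + a) b = a * b" for a b :: nat by (induction b) auto
  moreover have "computable (\<lambda>x. rec_nat 0 (\<lambda>m y. y + f x) (g x))"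
    by (intro computable_intros assms computable_comp[OF assms(1)])
  ultimately show ?thesis by simp
qed

lemma computable_power [computable_intros]:
  fixes f g :: "'a::represented \<Rightarrow> nat"
  assumes "computable f" "computable g"
  shows "computable (\<lambda>x. f x ^ g x)"
proof -
  have "rec_nat 1 (\<lambda>m y. y * a) b = a ^ b" for a b :: nat by (induction b) auto
  moreover have "computable (\<lambda>x. rec_nat 1 (\<lambda>m y. y * f x) (g x))"
    by (intro computable_intros assms computable_comp[OF assms(1)])
  ultimately show ?thesis by simp
qed

lemma computable_diff [computable_intros]:
  fixes f g :: "'a::represented \<Rightarrow> nat"
  assumes "computable f" "computable g"
  shows "computable (\<lambda>x. f x - g x)"
proof -
  have "computable (\<lambda>x. rec_nat 0 (\<lambda>m y. m) x)" by (intro computable_intros)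
  moreover have "(\<lambda>x. rec_nat 0 (\<lambda>m y. m) x) = (\<lambda>x. x - 1)"
  proof
    show "rec_nat 0 (\<lambda>m y. m) x = x - 1" for x by (cases x) auto
  qed
  ultimately have P: "computable (\<lambda>x::nat. x - 1)" by simp
  have "rec_nat a (\<lambda>m y. y - 1) b = a - b" for a b :: nat by (induction b) auto
  moreover have "computable (\<lambda>x. rec_nat (f x) (\<lambda>m y. y - 1) (g x))"
    by (intro computable_rec_nat assms computable_comp[OF P] computable_intros)
  ultimately show ?thesis by simp
qed

lemma computable_not [computable_intros]: "computable P \<Longrightarrow> computable (\<lambda>x. \<not> P x)"
  by (rule back_subst[of computable, OF computable_if[of P "\<lambda>_. False" "\<lambda>_. True"]])
    (auto intro: computable_const)

lemma computable_conj [computable_intros]: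
  "computable P \<Longrightarrow> computable Q \<Longrightarrow> computable (\<lambda>x. P x \<and> Q x)"
  by (rule back_subst[of computable, OF computable_if[of P Q "\<lambda>_. False"]])
    (auto intro: computable_const)

lemma computable_disj [computable_intros]:
  "computable P \<Longrightarrow> computable Q \<Longrightarrow> computable (\<lambda>x. P x \<or> Q x)"
  by (rule back_subst[of computable, OF computable_if[of P "\<lambda>_. True" Q]])
    (auto intro: computable_const)

lemma computable_nat_le [computable_intros]:
  fixes f g :: "'a::represented \<Rightarrow> nat"
  assumes "computable f" "computable g"
  shows "computable (\<lambda>x. f x \<le> g x)"
proof -
  have "rec_nat True (\<lambda>m y. False) (a - b) \<longleftrightarrow> a \<le> b" for a b :: nat
    by (cases "a - b") auto
  moreover have "computable (\<lambda>x. rec_nat True (\<lambda>m y. False) (f x - g x))"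
    by (intro computable_intros assms)
  ultimately show ?thesis by simp
qed

lemma computable_nat_less [computable_intros]:
  fixes f g :: "'a::represented \<Rightarrow> nat"
  shows "computable f \<Longrightarrow> computable g \<Longrightarrow> computable (\<lambda>x. f x < g x)"
  unfolding Suc_le_eq[symmetric] by (intro computable_intros)

lemma computable_nat_eq [computable_intros]:
  fixes f g :: "'a::represented \<Rightarrow> nat"
  shows "computable f \<Longrightarrow> computable g \<Longrightarrow> computable (\<lambda>x. f x = g x)"
  unfolding order_eq_iff by (intro computable_intros)

lemma computable_even [computable_intros]:
  fixes f :: "'a::represented \<Rightarrow> nat"
  assumes "computable f"
  shows "computable (\<lambda>x. even (f x))"
proof -
  have "rec_nat True (\<lambda>m y. \<not> y) a \<longleftrightarrow> even a" for a by (induction a) auto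
  moreover have "computable (\<lambda>x. rec_nat True (\<lambda>m y. \<not> y) (f x))"
    by (intro computable_intros assms)
  ultimately show ?thesis by simp
qed

lemma computable_div2 [computable_intros]:
  fixes f :: "'a::represented \<Rightarrow> nat"
  assumes "computable f"
  shows "computable (\<lambda>x. f x div 2)"
proof -
  have "rec_nat 0 (\<lambda>m y. if even m then y else Suc y) a = a div 2" for a
    by (induction a) auto
  moreover have "computable (\<lambda>x. rec_nat 0 (\<lambda>m y. if even m then y else Suc y) (f x))"
    by (intro computable_intros assms)
  ultimately show ?thesis by simp
qed

lemma computable_all_less [computable_intros]:
  fixes N :: "'a::represented \<Rightarrow> nat"
  assumes "computable N" "computable (\<lambda>z. P (fst z) (snd z))"
  shows "computable (\<lambda>x. \<forall>i<N x. P i x)"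
proof -
  have "rec_nat True (\<lambda>i y. y \<and> P i x) n \<longleftrightarrow> (\<forall>i<n. P i x)" for n x
    by (induction n) (auto simp: less_Suc_eq)
  moreover have "computable (\<lambda>z. P (fst z) (snd (snd z)))"
    using computable_comp[OF assms(2), of "\<lambda>z. (fst z, snd (snd z))"] by (simp add: computable_intros)
  then have "computable (\<lambda>x. rec_nat True (\<lambda>i y. y \<and> P i x) (N x))"
    by (intro computable_intros assms(1))
  ultimately show ?thesis by simp
qed

lemma computable_ex_less [computable_intros]:
  fixes N :: "'a::represented \<Rightarrow> nat"
  assumes "computable N" "computable (\<lambda>z. P (fst z) (snd z))"
  shows "computable (\<lambda>x. \<exists>i<N x. P i x)"
  using computable_not[OF computable_all_less[OF assms(1) computable_not[OF assms(2)]]] by simp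

text \<open>
  Writing rationals as differences of two naturals over a successor turns sums, products and
  comparisons into polynomial expressions in natural numbers, without signs or normal forms.
\<close>

definition rat_frac :: "nat \<Rightarrow> nat \<Rightarrow> nat \<Rightarrow> rat" where
  "rat_frac a b c = (of_nat a - of_nat b) / of_nat (Suc c)"

lemma computable_rat_frac [computable_intros]:
  assumes "computable f" "computable g" "computable h"
  shows "computable (\<lambda>x. rat_frac (f x) (g x) (h x))"
proof -
  let ?e = "\<lambda>x. if g x \<le> f x then (f x - g x) * 2 else (g x - f x) * 2 - 1"
  have "computable (\<lambda>x. decode (prod_encode (?e x, h x)) :: rat)"
    by (intro computable_intros assms)
  moreover have "decode (prod_encode (?e x, h x)) = rat_frac (f x) (g x) (h x)" for x
  proof (cases "g x \<le> f x")
    case True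
    then show ?thesis
      by (simp add: decode_rat_def rat_of_code_def rat_frac_def int_decode_def sum_decode_def of_nat_diff)
  next
    case False
    then obtain d where d: "g x = f x + Suc d" by (metis add_Suc_right less_imp_Suc_add not_le)
    have "(g x - f x) * 2 - 1 = 2 * d + 1" by (simp add: d)
    then show ?thesis using False
      by (simp add: decode_rat_def rat_of_code_def rat_frac_def int_decode_def sum_decode_def d)
  qed
  ultimately show ?thesis by simp
qed

text \<open>
  To compute a function of a rational number it suffices to compute it from any three naturals that
  represent the number; the given code provides such naturals.
\<close>

lemma computable_from_rat:
  fixes f :: "rat \<times> 'a::represented \<Rightarrow> 'b::represented"
  assumes "computable (\<lambda>t. F (fst t) (fst (snd t)) (fst (snd (snd t))) (snd (snd (snd t))))"
    and "\<And>a b c x. f (rat_frac a b c, x) = F a b c x"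
  shows "computable f"
proof -
  let ?e = "\<lambda>z::nat. fst (prod_decode (fst (prod_decode z)))"
  let ?a = "\<lambda>z. if even (?e z) then ?e z div 2 else 0"
  let ?b = "\<lambda>z. if even (?e z) then 0 else Suc (?e z div 2)"
  let ?c = "\<lambda>z. snd (prod_decode (fst (prod_decode z)))"
  let ?x = "\<lambda>z. decode (snd (prod_decode z)) :: 'a"
  have "computable (\<lambda>z. (?a z, ?b z, ?c z, ?x z))" by (intro computable_intros)
  from computable_comp[OF assms(1) this] have "computable (\<lambda>z. F (?a z) (?b z) (?c z) (?x z))"
    by simp
  moreover have "f (decode z) = F (?a z) (?b z) (?c z) (?x z)" for z
  proof -
    have "decode (fst (prod_decode z)) = rat_frac (?a z) (?b z) (?c z)"
      by (cases "prod_decode (fst (prod_decode z))")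
        (simp add: decode_rat_def rat_of_code_def rat_frac_def int_decode_def sum_decode_def)
    moreover have "decode z = (decode (fst (prod_decode z)) :: rat, ?x z)"
      by (cases "prod_decode z") (simp add: decode_prod_def)
    ultimately show ?thesis by (simp only: assms(2))
  qed
  ultimately have "computable (\<lambda>n. f (decode n))" by (simp only:)
  then show ?thesis by (simp only: computable_via_code)
qed

lemma computable_from_rat2:
  fixes f :: "rat \<Rightarrow> rat \<Rightarrow> 'b::represented"
  assumes F: "computable (\<lambda>t. F (fst t) (fst (snd t)) (fst (snd (snd t)))
      (fst (snd (snd (snd t)))) (fst (snd (snd (snd (snd t))))) (snd (snd (snd (snd (snd t))))))"
    and eq: "\<And>a b c a' b' c'. f (rat_frac a b c) (rat_frac a' b' c') = F a b c a' b' c'"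
    and "computable u" "computable v"
  shows "computable (\<lambda>x. f (u x) (v x))"
proof -
  have "computable (\<lambda>z. f (fst z) (rat_frac (fst (snd z)) (fst (snd (snd z))) (snd (snd (snd z)))))"
    by (rule computable_from_rat[OF F]) (simp add: eq)
  from computable_comp[OF this, of "\<lambda>t. (snd (snd (snd t)), fst t, fst (snd t), fst (snd (snd t)))"]
  have G: "computable (\<lambda>t::nat \<times> nat \<times> nat \<times> rat.
      f (snd (snd (snd t))) (rat_frac (fst t) (fst (snd t)) (fst (snd (snd t)))))"
    by (simp add: computable_intros)
  have "computable (\<lambda>z::rat \<times> rat. f (snd z) (fst z))"
    by (rule computable_from_rat[OF G]) simp
  from computable_comp[OF this, of "\<lambda>x. (v x, u x)"] show ?thesis
    using assms(3,4) by (simp add: computable_intros)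
qed

lemma rat_frac_add:
  "rat_frac a b c + rat_frac a' b' c' =
   rat_frac (a * Suc c' + a' * Suc c) (b * Suc c' + b' * Suc c) (c * c' + c + c')"
  unfolding rat_frac_def by (simp add: field_simps del: of_nat_Suc) (simp add: algebra_simps)

lemma rat_frac_mult:
  "rat_frac a b c * rat_frac a' b' c' = rat_frac (a * a' + b * b') (a * b' + b * a') (c * c' + c + c')"
proof -
  have "(of_nat (Suc (c * c' + c + c')) :: rat) = of_nat (Suc c) * of_nat (Suc c')"
    by (simp add: algebra_simps)
  then show ?thesis unfolding rat_frac_def by (simp add: algebra_simps del: of_nat_Suc)
qed

lemma rat_frac_le:
  "rat_frac a b c \<le> rat_frac a' b' c' \<longleftrightarrow> a * Suc c' + b' * Suc c \<le> a' * Suc c + b * Suc c'"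
proof -
  have "rat_frac a b c \<le> rat_frac a' b' c' \<longleftrightarrow>
    (of_nat a - of_nat b) * of_nat (Suc c') \<le> (of_nat a' - of_nat b' :: rat) * of_nat (Suc c)"
    unfolding rat_frac_def by (simp add: divide_le_eq le_divide_eq mult.commute del: of_nat_Suc)
  also have "\<dots> \<longleftrightarrow> (of_nat (a * Suc c' + b' * Suc c) :: rat) \<le> of_nat (a' * Suc c + b * Suc c')"
    by (simp add: algebra_simps)
  finally show ?thesis by (simp only: of_nat_le_iff)
qed

lemma computable_rat_add [computable_intros]:
  fixes u v :: "'a::represented \<Rightarrow> rat"
  assumes "computable u" "computable v"
  shows "computable (\<lambda>x. u x + v x)"
  by (rule computable_from_rat2[where f = "(+)", OF _ rat_frac_add assms]) (intro computable_intros)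

lemma computable_rat_mult [computable_intros]:
  fixes u v :: "'a::represented \<Rightarrow> rat"
  assumes "computable u" "computable v"
  shows "computable (\<lambda>x. u x * v x)"
  by (rule computable_from_rat2[where f = "(*)", OF _ rat_frac_mult assms]) (intro computable_intros)

lemma computable_rat_le [computable_intros]:
  fixes u v :: "'a::represented \<Rightarrow> rat"
  assumes "computable u" "computable v"
  shows "computable (\<lambda>x. u x \<le> v x)"
  by (rule computable_from_rat2[where f = "(\<le>)", OF _ rat_frac_le assms]) (intro computable_intros)

lemma computable_rat_less [computable_intros]:
  fixes u v :: "'a::represented \<Rightarrow> rat"
  shows "computable u \<Longrightarrow> computable v \<Longrightarrow> computable (\<lambda>x. u x < v x)"
  unfolding not_le[symmetric] by (intro computable_intros)

lemma computable_rat_eq [computable_intros]: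
  fixes u v :: "'a::represented \<Rightarrow> rat"
  shows "computable u \<Longrightarrow> computable v \<Longrightarrow> computable (\<lambda>x. u x = v x)"
  unfolding order_eq_iff by (intro computable_intros)

lemma computable_rat_diff [computable_intros]:
  fixes u v :: "'a::represented \<Rightarrow> rat"
  assumes "computable u" "computable v"
  shows "computable (\<lambda>x. u x - v x)"
proof -
  have "computable (\<lambda>x. u x + (-1) * v x)" by (intro computable_intros assms)
  then show ?thesis by simp
qed

lemma computable_rat_abs [computable_intros]:
  fixes u :: "'a::represented \<Rightarrow> rat"
  assumes "computable u"
  shows "computable (\<lambda>x. \<bar>u x\<bar>)"
proof -
  have "computable (\<lambda>x. if 0 \<le> u x then u x else 0 - u x)" by (intro computable_intros assms)
  then show ?thesis by (rule back_subst[of computable]) auto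
qed

lemma computable_rat_min [computable_intros]:
  fixes u v :: "'a::represented \<Rightarrow> rat"
  shows "computable u \<Longrightarrow> computable v \<Longrightarrow> computable (\<lambda>x. min (u x) (v x))"
  unfolding min_def by (intro computable_intros)

lemma computable_rat_of_nat [computable_intros]:
  assumes "computable u"
  shows "computable (\<lambda>x. of_nat (u x) :: rat)"
proof -
  have "computable (\<lambda>x. rat_frac (u x) 0 0)" by (intro computable_intros assms)
  then show ?thesis by (simp add: rat_frac_def)
qed

lemma computable_rat_inverse_Suc [computable_intros]:
  assumes "computable u"
  shows "computable (\<lambda>x. 1 / of_nat (Suc (u x)) :: rat)"
proof -
  have "computable (\<lambda>x. rat_frac 1 0 (u x))" by (intro computable_intros assms)
  then show ?thesis by (simp add: rat_frac_def)
qed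

section \<open>Semidecidable predicates\<close>

text \<open>
  Witnesses are attached to codes and not to the elements coded, because a search that starts from
  a code may find different witnesses for different codes of the same element.
\<close>

definition semidecidable :: "('a::represented \<Rightarrow> bool) \<Rightarrow> bool" where
  "semidecidable P \<longleftrightarrow>
     (\<exists>D::nat \<times> nat \<Rightarrow> bool. computable D \<and> (\<forall>n. P (decode n) \<longleftrightarrow> (\<exists>t. D (n, t))))"

lemma semidecidable_via_code: "semidecidable (\<lambda>n::nat. P (decode n)) \<longleftrightarrow> semidecidable P"
  unfolding semidecidable_def by simp

lemma semidecidableI_computable:
  assumes "computable P"
  shows "semidecidable P"
proof -
  have "computable (\<lambda>z::nat \<times> nat. P (decode (fst z)))"
    by (intro computable_comp[OF assms] computable_intros)
  then show ?thesis
    unfolding semidecidable_def by (intro exI[of _ "\<lambda>z. P (decode (fst z))"]) simp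
qed

lemma semidecidable_comp:
  assumes "semidecidable P" "computable f"
  shows "semidecidable (\<lambda>x. P (f x))"
proof -
  obtain D :: "nat \<times> nat \<Rightarrow> bool" where D: "computable D" "\<And>n. P (decode n) \<longleftrightarrow> (\<exists>t. D (n, t))"
    using assms(1) unfolding semidecidable_def by blast
  obtain c where c: "realized_by f c" using assms(2) unfolding computable_def by blast
  then have "computable c" unfolding computable_def realized_by_def by auto
  then have "computable (\<lambda>z. D (c (fst z), snd z))"
    by (intro computable_comp[OF D(1)] computable_intros computable_comp[OF \<open>computable c\<close>])
  moreover have "P (f (decode n)) \<longleftrightarrow> (\<exists>t. D (c n, t))" for n
    using D(2)[of "c n"] decode_realized[OF c] by simp
  ultimately show ?thesis
    unfolding semidecidable_def by (intro exI[of _ "\<lambda>z. D (c (fst z), snd z)"]) auto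
qed

lemma semidecidable_conj:
  assumes "semidecidable P" "semidecidable Q"
  shows "semidecidable (\<lambda>x. P x \<and> Q x)"
proof -
  obtain D where D: "computable D" "\<And>n. P (decode n) \<longleftrightarrow> (\<exists>t::nat. D (n, t))"
    using assms(1) unfolding semidecidable_def by blast
  obtain E where E: "computable E" "\<And>n. Q (decode n) \<longleftrightarrow> (\<exists>t::nat. E (n, t))"
    using assms(2) unfolding semidecidable_def by blast
  let ?C = "\<lambda>z::nat \<times> nat. D (fst z, fst (prod_decode (snd z))) \<and> E (fst z, snd (prod_decode (snd z)))"
  have "computable ?C"
    by (intro computable_conj computable_comp[OF D(1)] computable_comp[OF E(1)] computable_intros)
  moreover have "(P (decode n) \<and> Q (decode n)) \<longleftrightarrow> (\<exists>t. ?C (n, t))" for n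
    unfolding D(2) E(2) by (auto intro: exI[of _ "prod_encode (_, _)"])
  ultimately show ?thesis
    unfolding semidecidable_def by blast
qed

lemma semidecidable_disj:
  assumes "semidecidable P" "semidecidable Q"
  shows "semidecidable (\<lambda>x. P x \<or> Q x)"
proof -
  obtain D where D: "computable D" "\<And>n. P (decode n) \<longleftrightarrow> (\<exists>t::nat. D (n, t))"
    using assms(1) unfolding semidecidable_def by blast
  obtain E where E: "computable E" "\<And>n. Q (decode n) \<longleftrightarrow> (\<exists>t::nat. E (n, t))"
    using assms(2) unfolding semidecidable_def by blast
  have "computable (\<lambda>z. D z \<or> E z)"
    by (intro computable_intros D(1) E(1))
  then show ?thesis
    unfolding semidecidable_def D(2) E(2) by (intro exI[of _ "\<lambda>z. D z \<or> E z"]) auto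
qed

lemma semidecidable_ex:
  fixes P :: "'a::represented \<Rightarrow> 'b::represented \<Rightarrow> bool"
  assumes "semidecidable (\<lambda>z. P (fst z) (snd z))"
  shows "semidecidable (\<lambda>x. \<exists>y. P x y)"
proof -
  obtain D where D: "computable D"
    "\<forall>n. P (fst (decode n :: 'a \<times> 'b)) (snd (decode n :: 'a \<times> 'b)) \<longleftrightarrow> (\<exists>t::nat. D (n, t))"
    using assms(1) unfolding semidecidable_def by blast
  note D = D(1) D(2)[rule_format]
  let ?C = "\<lambda>z::nat \<times> nat. D (prod_encode (fst z, fst (prod_decode (snd z))), snd (prod_decode (snd z)))"
  have "computable ?C"
    by (intro computable_comp[OF D(1)] computable_intros)
  moreover have "(\<exists>y. P (decode n) y) \<longleftrightarrow> (\<exists>t. ?C (n, t))" for n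
  proof -
    have "(\<exists>y. P (decode n) y) \<longleftrightarrow> (\<exists>m. P (decode n) (decode m))" by (metis decode_surj)
    also have "\<dots> \<longleftrightarrow> (\<exists>m t. D (prod_encode (n, m), t))"
      using D(2)[of "prod_encode (n, _)"] by simp
    also have "\<dots> \<longleftrightarrow> (\<exists>t. ?C (n, t))"
      by (metis fst_conv snd_conv prod_encode_inverse)
    finally show ?thesis .
  qed
  ultimately show ?thesis
    unfolding semidecidable_def by blast
qed

text \<open>
  Finitely many witnesses have a common bound, and it is this bound that is searched for.
\<close>

lemma semidecidable_all_less:
  fixes N :: "'a::represented \<Rightarrow> nat" and P :: "nat \<Rightarrow> 'a \<Rightarrow> bool"
  assumes "computable N" "semidecidable (\<lambda>z. P (fst z) (snd z))"
  shows "semidecidable (\<lambda>x. \<forall>i<N x. P i x)"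
proof -
  obtain D where D: "computable D"
    "\<forall>n. P (fst (decode n :: nat \<times> 'a)) (snd (decode n :: nat \<times> 'a)) \<longleftrightarrow> (\<exists>t::nat. D (n, t))"
    using assms(2) unfolding semidecidable_def by blast
  note D = D(1) D(2)[rule_format]
  let ?C = "\<lambda>z::nat \<times> nat. \<forall>i<N (decode (fst z)). \<exists>t<snd z. D (prod_encode (i, fst z), t)"
  have "computable ?C"
    by (intro computable_all_less computable_ex_less computable_comp[OF D(1)]
        computable_comp[OF assms(1)] computable_intros)
  moreover have "(\<forall>i<N (decode n). P i (decode n)) \<longleftrightarrow> (\<exists>T. ?C (n, T))" for n
  proof -
    have "(\<forall>i<k. \<exists>t. D (prod_encode (i, n), t)) \<longleftrightarrow> (\<exists>T. \<forall>i<k. \<exists>t<T. D (prod_encode (i, n), t))" for k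
    proof (induction k)
      case (Suc k)
      show ?case
      proof
        assume *: "\<forall>i<Suc k. \<exists>t. D (prod_encode (i, n), t)"
        then obtain T t where "\<forall>i<k. \<exists>t<T. D (prod_encode (i, n), t)" "D (prod_encode (k, n), t)"
          using Suc by auto
        then show "\<exists>T. \<forall>i<Suc k. \<exists>t<T. D (prod_encode (i, n), t)"
          by (intro exI[of _ "max T (Suc t)"]) (auto simp: less_Suc_eq less_max_iff_disj)
      qed blast
    qed auto
    then show ?thesis using D(2)[of "prod_encode (_, n)"] by simp
  qed
  ultimately show ?thesis
    unfolding semidecidable_def by blast
qed

text \<open>
  Repeated unpairing reads a number as an infinite sequence. Every finite sequence is the beginning
  of a sequence obtained in this way.
\<close>

definition seq_nth :: "nat \<Rightarrow> nat \<Rightarrow> nat" where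
  "seq_nth v i = fst (prod_decode (rec_nat v (\<lambda>_ y. snd (prod_decode y)) i))"

lemma computable_seq_nth [computable_intros]:
  "computable f \<Longrightarrow> computable g \<Longrightarrow> computable (\<lambda>x. seq_nth (f x) (g x))"
  unfolding seq_nth_def by (intro computable_intros)

lemma ex_seq_nth: "\<exists>v. \<forall>i<n. seq_nth v i = f i"
proof (induction n arbitrary: f)
  case (Suc n)
  obtain v where v: "\<forall>i<n. seq_nth v i = f (Suc i)"
    using Suc[of "\<lambda>i. f (Suc i)"] by (elim exE) (rule that)
  let ?w = "prod_encode (f 0, v)"
  have "rec_nat ?w (\<lambda>_ y. snd (prod_decode y)) (Suc i) = rec_nat v (\<lambda>_ y. snd (prod_decode y)) i" for i
    by (induction i) auto
  then have "seq_nth ?w (Suc i) = seq_nth v i" for i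
    unfolding seq_nth_def by (simp only:)
  moreover have "seq_nth ?w 0 = f 0" by (simp add: seq_nth_def)
  ultimately have "\<forall>i<Suc n. seq_nth ?w i = f i" using v by (simp add: All_less_Suc2)
  then show ?case by blast
qed auto

lemma ex_list_all2_Cons:
  "(\<exists>ys. list_all2 R (x # xs) ys \<and> P ys) \<longleftrightarrow> (\<exists>y ys. R x y \<and> list_all2 R xs ys \<and> P (y # ys))"
  by (auto simp: list_all2_Cons1)

inductive_cases recf_eval_ZeroE: "recf_eval Zero xs y"
inductive_cases recf_eval_SuccE: "recf_eval Succ xs y"
inductive_cases recf_eval_ProjE: "recf_eval (Proj i) xs y"
inductive_cases recf_eval_CompE: "recf_eval (Comp f gs) xs y"
inductive_cases recf_eval_PrimRecE: "recf_eval (PrimRec f g) xs y"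
inductive_cases recf_eval_MuE: "recf_eval (Mu f) xs y"

lemma recf_eval_Comp_iff:
  "recf_eval (Comp f gs) xs z \<longleftrightarrow> (\<exists>ys. list_all2 (\<lambda>g y. recf_eval g xs y) gs ys \<and> recf_eval f ys z)"
  by (auto 4 4 simp: list_all2_conv_all_nth eq_commute[of "length gs"]
      elim!: recf_eval_CompE intro: recf_eval.Comp)

text \<open>
  The witness of a computation by primitive recursion is the sequence of its intermediate results.
\<close>

lemma recf_eval_PrimRec_iff:
  "recf_eval (PrimRec f g) (n # xs) z \<longleftrightarrow>
     (\<exists>v. recf_eval f xs (seq_nth v 0) \<and>
       (\<forall>i<n. recf_eval g (i # seq_nth v i # xs) (seq_nth v (Suc i))) \<and> seq_nth v n = z)"
proof
  assume "recf_eval (PrimRec f g) (n # xs) z"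
  then have "\<exists>h. recf_eval f xs (h 0) \<and>
       (\<forall>i<n. recf_eval g (i # h i # xs) (h (Suc i))) \<and> h n = z"
  proof (induction n arbitrary: z)
    case 0
    then show ?case by (auto elim: recf_eval_PrimRecE)
  next
    case (Suc n)
    then obtain y where "recf_eval (PrimRec f g) (n # xs) y" and y: "recf_eval g (n # y # xs) z"
      by (auto elim: recf_eval_PrimRecE)
    then obtain h where "recf_eval f xs (h 0)"
       "\<forall>i<n. recf_eval g (i # h i # xs) (h (Suc i))" "h n = y" using Suc.IH by blast
    then show ?case using y
      by (intro exI[of _ "\<lambda>i. if i = Suc n then z else h i"]) (auto simp: less_Suc_eq)
  qed
  then obtain h where h: "recf_eval f xs (h 0)"
    "\<forall>i<n. recf_eval g (i # h i # xs) (h (Suc i))" "h n = z" by blast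
  obtain v where "\<forall>i<Suc n. seq_nth v i = h i" using ex_seq_nth by blast
  then show "\<exists>v. recf_eval f xs (seq_nth v 0) \<and>
       (\<forall>i<n. recf_eval g (i # seq_nth v i # xs) (seq_nth v (Suc i))) \<and> seq_nth v n = z"
    using h by (intro exI[of _ v]) auto
next
  assume "\<exists>v. recf_eval f xs (seq_nth v 0) \<and>
       (\<forall>i<n. recf_eval g (i # seq_nth v i # xs) (seq_nth v (Suc i))) \<and> seq_nth v n = z"
  then obtain v where v: "recf_eval f xs (seq_nth v 0)"
    "\<forall>i<n. recf_eval g (i # seq_nth v i # xs) (seq_nth v (Suc i))" "seq_nth v n = z" by blast
  have "i \<le> n \<Longrightarrow> recf_eval (PrimRec f g) (i # xs) (seq_nth v i)" for i
    by (induction i) (use v in \<open>auto intro: recf_eval.PrimRec_0 recf_eval.PrimRec_Suc\<close>)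
  then show "recf_eval (PrimRec f g) (n # xs) z" using v(3) by blast
qed

lemma recf_eval_Mu_iff:
  "recf_eval (Mu f) xs n \<longleftrightarrow>
     recf_eval f (n # xs) 0 \<and> (\<forall>m<n. \<exists>y. recf_eval f (m # xs) (Suc y))"
  by (auto elim: recf_eval_MuE intro: recf_eval.Mu)

text \<open>
  The inputs are computable functions of a common parameter. In this form the induction over
  programs needs no data type of lists: each existential quantifier over an intermediate result only
  enlarges the parameter.
\<close>

definition semidecidable_graph :: "recf \<Rightarrow> bool" where
  "semidecidable_graph p \<longleftrightarrow> (\<forall>As (Y::nat \<Rightarrow> nat). (\<forall>A\<in>set As. computable A) \<longrightarrow> computable Y \<longrightarrow>
     semidecidable (\<lambda>e::nat. recf_eval p (map (\<lambda>A. A e) As) (Y e)))"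

lemma semidecidable_graphD:
  fixes Y :: "'a::represented \<Rightarrow> nat"
  assumes "semidecidable_graph p" "\<forall>A\<in>set As. computable A" "computable Y"
  shows "semidecidable (\<lambda>e. recf_eval p (map (\<lambda>A. A e) As) (Y e))"
proof -
  let ?As = "map (\<lambda>A n. A (decode n :: 'a)) As"
  have "\<forall>A\<in>set ?As. computable A" using assms(2) by (auto simp: computable_via_code)
  then have "semidecidable (\<lambda>e. recf_eval p (map (\<lambda>A. A e) ?As) (Y (decode e)))"
    using assms(1,3) unfolding semidecidable_graph_def
    by (auto simp: computable_via_code simp del: set_map)
  then show ?thesis
    using semidecidable_via_code[of "\<lambda>e. recf_eval p (map (\<lambda>A. A e) As) (Y e)"]
    by (simp add: comp_def)
qed

lemma semidecidable_list_all2_ex: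
  fixes Y :: "nat \<Rightarrow> nat"
  assumes "\<forall>g\<in>set gs. semidecidable_graph g" "semidecidable_graph f"
    "\<forall>A\<in>set As. computable A" "\<forall>B\<in>set Bs. computable B" "computable Y"
  shows "semidecidable (\<lambda>e::nat. \<exists>ys. list_all2 (\<lambda>g y. recf_eval g (map (\<lambda>A. A e) As) y) gs ys
     \<and> recf_eval f (map (\<lambda>B. B e) Bs @ ys) (Y e))"
  using assms
proof (induction gs arbitrary: As Bs Y)
  case Nil
  then show ?case using semidecidable_graphD[of f Bs Y] by simp
next
  case (Cons g gs)
  let ?As = "map (\<lambda>A n. A (fst (prod_decode n))) As"
  let ?Bs = "map (\<lambda>A n. A (fst (prod_decode n))) Bs @ [\<lambda>n. snd (prod_decode n)]"
  let ?Y = "\<lambda>n. Y (fst (prod_decode n))"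
  have C: "\<forall>A\<in>set ?As. computable A" "\<forall>A\<in>set ?Bs. computable A" "computable ?Y"
    using Cons.prems(3-5) by (auto intro!: computable_intros intro: computable_comp)
  have "semidecidable (\<lambda>n. recf_eval g (map (\<lambda>A. A n) ?As) (snd (prod_decode n)) \<and>
    (\<exists>ys. list_all2 (\<lambda>g y. recf_eval g (map (\<lambda>A. A n) ?As) y) gs ys
     \<and> recf_eval f (map (\<lambda>B. B n) ?Bs @ ys) (?Y n)))"
    using Cons.prems(1,2) C
    by (intro semidecidable_conj semidecidable_graphD Cons.IH computable_intros) auto
  from semidecidable_comp[OF this computable_prod_encode[OF computable_id]]
  have "semidecidable (\<lambda>z. recf_eval g (map (\<lambda>A. A (fst z)) As) (snd z) \<and>
    (\<exists>ys. list_all2 (\<lambda>g y. recf_eval g (map (\<lambda>A. A (fst z)) As) y) gs ys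
     \<and> recf_eval f (map (\<lambda>B. B (fst z)) Bs @ snd z # ys) (Y (fst z))))"
    by (simp add: comp_def)
  then have "semidecidable (\<lambda>e. \<exists>y. recf_eval g (map (\<lambda>A. A e) As) y \<and>
    (\<exists>ys. list_all2 (\<lambda>g y. recf_eval g (map (\<lambda>A. A e) As) y) gs ys
     \<and> recf_eval f (map (\<lambda>B. B e) Bs @ y # ys) (Y e)))"
    by (rule semidecidable_ex)
  then show ?case by (simp only: ex_list_all2_Cons) (simp add: conj_ac)
qed

text \<open>
  This is the normal form theorem for a fixed program: halting with a given output amounts to the
  existence of a witness that a total program can check. No universal program is involved, since
  the witnesses are assembled by recursion over the program.
\<close>

theorem semidecidable_graph: "semidecidable_graph p"
proof (induction p)
  case Zero
  have "recf_eval Zero xs y \<longleftrightarrow> y = 0" for xs y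
    by (auto elim: recf_eval_ZeroE intro: recf_eval.Zero)
  then show ?case unfolding semidecidable_graph_def
    by (auto intro!: semidecidableI_computable computable_intros)
next
  case Succ
  have "recf_eval Succ xs y \<longleftrightarrow> xs \<noteq> [] \<and> y = Suc (hd xs)" for xs y
    by (cases xs) (auto elim: recf_eval_SuccE intro: recf_eval.Succ)
  moreover have "computable (\<lambda>e. map (\<lambda>A. A e) As \<noteq> [] \<and> Y e = Suc (hd (map (\<lambda>A. A e) As)))"
    if "\<forall>A\<in>set As. computable A" "computable Y" for As :: "(nat \<Rightarrow> nat) list" and Y
    using that by (cases As) (auto intro!: computable_intros)
  ultimately show ?case unfolding semidecidable_graph_def
    by (auto intro: semidecidableI_computable simp del: map_is_Nil_conv)
next
  case (Proj i)
  have "recf_eval (Proj i) xs y \<longleftrightarrow> i < length xs \<and> y = xs ! i" for xs y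
    by (auto elim: recf_eval_ProjE intro: recf_eval.Proj)
  then show ?case unfolding semidecidable_graph_def
  proof (simp, intro allI impI)
    fix As :: "(nat \<Rightarrow> nat) list" and Y :: "nat \<Rightarrow> nat"
    assume "\<forall>A\<in>set As. computable A" "computable Y"
    then have "computable (\<lambda>e. i < length As \<and> Y e = (if i < length As then (As ! i) e else 0))"
      by (cases "i < length As") (auto intro!: computable_intros)
    then show "semidecidable (\<lambda>e. i < length As \<and> Y e = map (\<lambda>A. A e) As ! i)"
      by (intro semidecidableI_computable, rule back_subst[of computable]) auto
  qed
next
  case (Comp f gs)
  then show ?case
    using semidecidable_list_all2_ex[of gs f _ "[]"]
    unfolding semidecidable_graph_def[of "Comp f gs"] recf_eval_Comp_iff by auto
next
  case (PrimRec f g)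
  show ?case unfolding semidecidable_graph_def
  proof (intro allI impI)
    fix As :: "(nat \<Rightarrow> nat) list" and Y :: "nat \<Rightarrow> nat"
    assume As: "\<forall>A\<in>set As. computable A" and Y: "computable Y"
    show "semidecidable (\<lambda>e. recf_eval (PrimRec f g) (map (\<lambda>A. A e) As) (Y e))"
    proof (cases As)
      case Nil
      then have "(\<lambda>e. recf_eval (PrimRec f g) (map (\<lambda>A. A e) As) (Y e)) = (\<lambda>e. False)"
        by (auto elim: recf_eval_PrimRecE)
      then show ?thesis by (auto intro!: semidecidableI_computable computable_intros)
    next
      case (Cons N Bs)
      let ?Bs = "map (\<lambda>B z. B (fst (z :: nat \<times> nat))) Bs"
      let ?Cs = "fst # (\<lambda>w. seq_nth (snd (snd w)) (fst w)) # map (\<lambda>B w. B (fst (snd (w :: nat \<times> nat \<times> nat)))) Bs"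
      have B: "\<forall>B\<in>set ?Bs. computable B" "\<forall>C\<in>set ?Cs. computable C" "computable N"
        using As Cons by (auto intro!: computable_intros intro: computable_comp)
      have "semidecidable (\<lambda>z. recf_eval f (map (\<lambda>B. B z) ?Bs) (seq_nth (snd z) 0))"
        by (intro semidecidable_graphD[OF PrimRec(1) B(1)] computable_intros)
      moreover have "semidecidable (\<lambda>w. recf_eval g (map (\<lambda>C. C w) ?Cs) (seq_nth (snd (snd w)) (Suc (fst w))))"
        by (intro semidecidable_graphD[OF PrimRec(2) B(2)] computable_intros)
      then have "semidecidable (\<lambda>z. \<forall>i<N (fst z). recf_eval g (map (\<lambda>C. C (i, z)) ?Cs) (seq_nth (snd z) (Suc i)))"
        by (intro semidecidable_all_less computable_comp[OF B(3)] computable_intros) simp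
      moreover have "semidecidable (\<lambda>z. seq_nth (snd z) (N (fst z)) = Y (fst z))"
        by (intro semidecidableI_computable computable_intros computable_comp[OF B(3)] computable_comp[OF Y])
      ultimately have "semidecidable (\<lambda>z. recf_eval f (map (\<lambda>B. B z) ?Bs) (seq_nth (snd z) 0) \<and>
          (\<forall>i<N (fst z). recf_eval g (map (\<lambda>C. C (i, z)) ?Cs) (seq_nth (snd z) (Suc i))) \<and>
          seq_nth (snd z) (N (fst z)) = Y (fst z))"
        by (intro semidecidable_conj)
      then show ?thesis unfolding Cons
        by (simp add: recf_eval_PrimRec_iff comp_def semidecidable_ex)
    qed
  qed
next
  case (Mu f)
  show ?case unfolding semidecidable_graph_def
  proof (intro allI impI)
    fix As :: "(nat \<Rightarrow> nat) list" and Y :: "nat \<Rightarrow> nat"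
    assume As: "\<forall>A\<in>set As. computable A" and Y: "computable Y"
    let ?Bs = "(\<lambda>w. fst (fst w)) # map (\<lambda>A w. A (snd (fst (w :: (nat \<times> nat) \<times> nat)))) As"
    have "\<forall>A\<in>set (Y # As). computable A" "\<forall>B\<in>set ?Bs. computable B"
      using As Y by (auto intro!: computable_intros intro: computable_comp)
    from semidecidable_graphD[OF Mu this(1), of "\<lambda>_. 0"] semidecidable_graphD[OF Mu this(2), of "\<lambda>w. Suc (snd w)"]
    show "semidecidable (\<lambda>e. recf_eval (Mu f) (map (\<lambda>A. A e) As) (Y e))"
      unfolding recf_eval_Mu_iff
      by (intro semidecidable_conj semidecidable_all_less semidecidable_ex Y)
        (simp_all add: computable_intros comp_def)
  qed
qed

lemma total_recursive_computable:
  assumes "computable (h :: 'a::represented \<Rightarrow> nat)" "total_recursive k F"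
  shows "total_recursive k (\<lambda>xs. h (decode (F xs)))"
proof -
  obtain c where c: "realized_by h c" using assms(1) unfolding computable_def by blast
  have "c n = h (decode n)" for n using decode_realized[OF c, of n] by simp
  then show ?thesis using total_recursive_realized[OF c assms(2)] by simp
qed

text \<open>
  A stage encodes a candidate together with a possible witness for it. The enumerating program
  searches for a number equal to the candidate, but finds it only if the witness is correct; so it
  diverges at the stages that contribute nothing.
\<close>

lemma semidecidable_enumeration:
  assumes "semidecidable (\<lambda>z::nat \<times> nat \<times> nat. P (fst z) (fst (snd z)) (snd (snd z)))"
  shows "\<exists>p. \<forall>i j c. (\<exists>n. recf_eval p [i, j, n] c) \<longleftrightarrow> P i j c"
proof -
  obtain D where D: "computable D"
    "\<And>i j c. P i j c \<longleftrightarrow> (\<exists>t::nat. D (prod_encode (i, prod_encode (j, c)), t))"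
    using assms unfolding semidecidable_def
    by (metis decode_nat_def decode_prod_encode fst_conv snd_conv)
  let ?h = "\<lambda>z. if fst z = fst (prod_decode (snd (snd (snd z)))) \<and>
      D (prod_encode (fst (snd z), prod_encode (fst (snd (snd z)), fst z)), snd (prod_decode (snd (snd (snd z)))))
      then 0 else Suc 0"
  have h: "computable ?h"
    by (intro computable_if computable_conj computable_comp[OF D(1)] computable_intros)
  let ?F = "\<lambda>xs::nat list. prod_encode (xs ! 0, prod_encode (xs ! 1, prod_encode (xs ! 2, xs ! 3)))"
  have "total_recursive 4 (\<lambda>xs. ?h (decode (?F xs)))"
    by (intro total_recursive_computable[OF h] total_recursive_prod_encode total_recursive_proj) auto
  then obtain g where g: "\<And>xs. length xs = 4 \<Longrightarrow> recf_eval g xs (?h (decode (?F xs)))"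
    unfolding total_recursive_def by blast
  have val: "recf_eval g [m, i, j, n] (?h (m, i, j, n))" for m i j n
    using g[of "[m, i, j, n]"] by simp
  have g': "recf_eval g [m, i, j, n] y \<longleftrightarrow> y = ?h (m, i, j, n)" for m i j n y
  proof
    assume "recf_eval g [m, i, j, n] y"
    then show "y = ?h (m, i, j, n)" using val by (rule recf_eval_deterministic)
  next
    assume "y = ?h (m, i, j, n)"
    then show "recf_eval g [m, i, j, n] y" using val[of m i j n] by (simp only:)
  qed
  have "(\<exists>n. recf_eval (Mu g) [i, j, n] c) \<longleftrightarrow> P i j c" for i j c
  proof
    assume "\<exists>n. recf_eval (Mu g) [i, j, n] c"
    then show "P i j c" unfolding recf_eval_Mu_iff g' by (auto simp: D(2) split: if_splits)
  next
    assume "P i j c"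
    then obtain t where "D (prod_encode (i, prod_encode (j, c)), t)" using D(2) by blast
    then have "recf_eval (Mu g) [i, j, prod_encode (c, t)] c"
      unfolding recf_eval_Mu_iff g' by auto
    then show "\<exists>n. recf_eval (Mu g) [i, j, n] c" by blast
  qed
  then show ?thesis by blast
qed

lemma computable_rat_seq_iff: "computable_rat_seq s \<longleftrightarrow> computable s"
proof
  assume "computable_rat_seq s"
  then obtain p c where c: "\<And>n. recf_eval p [n] (c n)" "\<And>n. rat_of_code (c n) = s n"
    unfolding computable_rat_seq_def by metis
  have "recf_eval p xs (c (xs ! 0))" if "length xs = 1" for xs
    using c(1) that by (auto simp: length_Suc_conv)
  then show "computable s"
    by (intro computableI[of c]) (auto simp: total_recursive_def c(2) decode_rat_def)
next
  assume "computable s"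
  then obtain c where c: "total_recursive 1 (\<lambda>xs. c (xs ! 0))" "\<And>n. decode (c n) = s (decode n)"
    unfolding computable_def realized_by_def by blast
  obtain p where "\<And>xs. length xs = 1 \<Longrightarrow> recf_eval p xs (c (xs ! 0))"
    using c(1) unfolding total_recursive_def by blast
  from this[of "[n]" for n] have "recf_eval p [n] (c n)" for n by simp
  then show "computable_rat_seq s"
    unfolding computable_rat_seq_def using c(2) by (auto simp: decode_rat_def)
qed

text \<open>
  The known element \<open>a\<close> is the output at the stages whose witness fails, which makes the sequence
  total.
\<close>

lemma lower_computable_Sup:
  fixes Q :: "rat \<Rightarrow> bool"
  assumes "semidecidable Q" "Q a"
  shows "lower_computable (SUP q\<in>Collect Q. ereal (of_rat q))"
proof -
  obtain D where D: "computable D" "\<And>n. Q (decode n) \<longleftrightarrow> (\<exists>t::nat. D (n, t))"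
    using assms(1) unfolding semidecidable_def by blast
  let ?s = "\<lambda>n. if D (prod_decode n) then decode (fst (prod_decode n)) else a"
  have "computable ?s"
    by (intro computable_if computable_comp[OF D(1)] computable_intros)
  moreover have "Collect Q = range ?s"
  proof safe
    fix q assume "Q q"
    then obtain n t where "decode n = q" "D (n, t)" by (metis D(2) decode_surj)
    then show "q \<in> range ?s" by (intro image_eqI[of _ _ "prod_encode (n, t)"]) auto
  next
    fix n show "Q (?s n)" using D(2)[of "fst (prod_decode n)"] assms(2)
      by (auto intro: exI[of _ "snd (prod_decode n)"])
  qed
  then have "(SUP q\<in>Collect Q. ereal (of_rat q)) = (SUP n. ereal (of_rat (?s n)))"
    by (simp only: image_image)
  ultimately show ?thesis
    unfolding lower_computable_def computable_rat_seq_iff by blast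
qed

section \<open>Covers and entropy\<close>

lemma iterated_join_subset: "V \<in> iterated_join X f \<U> n \<Longrightarrow> V \<subseteq> X"
  unfolding iterated_join_def by auto

lemma finite_iterated_join:
  assumes "finite \<U>"
  shows "finite (iterated_join X f \<U> n)"
proof (rule finite_subset)
  show "iterated_join X f \<U> n \<subseteq>
    (\<lambda>U. {x \<in> X. \<forall>k<n. (f ^^ k) x \<in> U k}) ` ({..<n} \<rightarrow>\<^sub>E \<U>)"
  proof
    fix V assume "V \<in> iterated_join X f \<U> n"
    then obtain U where U: "V = {x \<in> X. \<forall>k<n. (f ^^ k) x \<in> U k}" "\<forall>k<n. U k \<in> \<U>"
      unfolding iterated_join_def by blast
    then show "V \<in> (\<lambda>U. {x \<in> X. \<forall>k<n. (f ^^ k) x \<in> U k}) ` ({..<n} \<rightarrow>\<^sub>E \<U>)"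
      by (intro image_eqI[of _ _ "restrict U {..<n}"]) auto
  qed
  show "finite ((\<lambda>U. {x \<in> X. \<forall>k<n. (f ^^ k) x \<in> U k}) ` ({..<n} \<rightarrow>\<^sub>E \<U>))"
    using assms by (intro finite_imageI finite_PiE) auto
qed

lemma funpow_in: "f \<in> X \<rightarrow> X \<Longrightarrow> x \<in> X \<Longrightarrow> (f ^^ n) x \<in> X"
  by (induction n) auto

lemma continuous_on_funpow:
  assumes "continuous_on X f" "f \<in> X \<rightarrow> X"
  shows "continuous_on X (f ^^ n)"
proof (induction n)
  case (Suc n)
  have "continuous_on X (f \<circ> (f ^^ n))"
    using Suc assms funpow_in[OF assms(2)]
    by (intro continuous_on_compose continuous_on_subset[OF assms(1)]) auto
  then show ?case by (simp add: comp_def)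
qed (simp add: id_def)

lemma Union_iterated_join:
  assumes "f \<in> X \<rightarrow> X" "\<Union>\<U> = X"
  shows "\<Union>(iterated_join X f \<U> n) = X"
proof
  show "X \<subseteq> \<Union>(iterated_join X f \<U> n)"
  proof
    fix x assume x: "x \<in> X"
    have "\<forall>k. \<exists>U\<in>\<U>. (f ^^ k) x \<in> U" using funpow_in[OF assms(1) x] assms(2) by auto
    then obtain U where "\<forall>k. U k \<in> \<U> \<and> (f ^^ k) x \<in> U k" by metis
    then have "{x \<in> X. \<forall>k<n. (f ^^ k) x \<in> U k} \<in> iterated_join X f \<U> n"
      and "x \<in> {x \<in> X. \<forall>k<n. (f ^^ k) x \<in> U k}"
      using x unfolding iterated_join_def by auto
    then show "x \<in> \<Union>(iterated_join X f \<U> n)" by blast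
  qed
qed (auto dest: iterated_join_subset)

lemma openin_iterated_join:
  assumes "continuous_on X f" "f \<in> X \<rightarrow> X" "finite_open_cover X \<U>" "V \<in> iterated_join X f \<U> n"
  shows "openin (top_of_set X) V"
proof -
  obtain U where U: "V = {x \<in> X. \<forall>k<n. (f ^^ k) x \<in> U k}" "\<forall>k<n. U k \<in> \<U>"
    using assms(4) unfolding iterated_join_def by blast
  have "openin (top_of_set X) (X \<inter> (f ^^ k) -` U k)" if "k < n" for k
  proof (rule continuous_openin_preimage[where T = X])
    show "continuous_on X (f ^^ k)" using assms(1,2) by (rule continuous_on_funpow)
    show "(f ^^ k) \<in> X \<rightarrow> X" using funpow_in[OF assms(2)] by auto
    show "openin (top_of_set X) (U k)" using U(2) assms(3) that unfolding finite_open_cover_def by auto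
  qed
  then have "openin (top_of_set X) (X \<inter> (\<Inter>k\<in>{..<n}. X \<inter> (f ^^ k) -` U k))"
  proof (cases "n = 0")
    case False
    then have "openin (top_of_set X) (\<Inter>k\<in>{..<n}. X \<inter> (f ^^ k) -` U k)"
      using \<open>\<And>k. k < n \<Longrightarrow> _\<close> by (intro openin_Inter) auto
    then show ?thesis by (intro openin_Int) auto
  qed auto
  also have "X \<inter> (\<Inter>k\<in>{..<n}. X \<inter> (f ^^ k) -` U k) = V" unfolding U(1) by auto
  finally show ?thesis .
qed

lemma finite_open_cover_iterated_join:
  assumes "continuous_on X f" "f \<in> X \<rightarrow> X" "finite_open_cover X \<U>"
  shows "finite_open_cover X (iterated_join X f \<U> n)"
proof -
  have "finite \<U>" "\<Union>\<U> = X" using assms(3) unfolding finite_open_cover_def by auto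
  then show ?thesis
    using openin_iterated_join[OF assms] finite_iterated_join[of \<U> X f n] Union_iterated_join[OF assms(2)]
    unfolding finite_open_cover_def by auto
qed

lemma finite_open_cover_Lebesgue:
  fixes X :: "'a::metric_space set"
  assumes "compact X" "X \<noteq> {}" "finite_open_cover X \<U>"
  obtains \<delta> where "\<delta> > 0" "\<And>T. T \<subseteq> X \<Longrightarrow> diameter T < \<delta> \<Longrightarrow> \<exists>U\<in>\<U>. T \<subseteq> U"
proof -
  define \<C> where "\<C> = {T. open T \<and> X \<inter> T \<in> \<U>}"
  have "X \<subseteq> \<Union>\<C>"
  proof
    fix x assume "x \<in> X"
    then obtain U where U: "U \<in> \<U>" "x \<in> U" using assms(3) unfolding finite_open_cover_def by blast
    then obtain T where "open T" "U = X \<inter> T"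
      using assms(3) unfolding finite_open_cover_def openin_open by blast
    then show "x \<in> \<Union>\<C>" using U unfolding \<C>_def by auto
  qed
  moreover from this have "\<C> \<noteq> {}" using assms(2) by auto
  moreover have "open B" if "B \<in> \<C>" for B using that unfolding \<C>_def by simp
  ultimately obtain \<delta> where \<delta>: "\<delta> > 0" "\<And>T. T \<subseteq> X \<Longrightarrow> diameter T < \<delta> \<Longrightarrow> \<exists>B\<in>\<C>. T \<subseteq> B"
    using Lebesgue_number_lemma[OF assms(1)] by metis
  have "\<exists>U\<in>\<U>. T \<subseteq> U" if T: "T \<subseteq> X" "diameter T < \<delta>" for T
  proof -
    obtain B where "B \<in> \<C>" "T \<subseteq> B" using \<delta>(2)[OF T] by blast
    then show ?thesis using T(1) unfolding \<C>_def by (intro bexI[of _ "X \<inter> B"]) auto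
  qed
  then show ?thesis using that \<delta>(1) by blast
qed

lemma min_subcover_card_le:
  assumes "finite I" "X \<subseteq> (\<Union>i\<in>I. P i)"
    and "\<And>i. i \<in> I \<Longrightarrow> \<exists>V\<in>iterated_join X f \<U> n. P i \<subseteq> V"
  shows "min_subcover_card X f \<U> n \<le> card I"
proof -
  obtain V where V: "\<And>i. i \<in> I \<Longrightarrow> V i \<in> iterated_join X f \<U> n \<and> P i \<subseteq> V i"
    using assms(3) by metis
  have "(\<Union>i\<in>I. P i) \<subseteq> (\<Union>i\<in>I. V i)" using V by blast
  with assms(2) have "X \<subseteq> \<Union>(V ` I)" by (rule order_trans)
  moreover have "\<Union>(V ` I) \<subseteq> X"
  proof (rule UN_least)
    fix i assume "i \<in> I"
    from V[OF this] show "V i \<subseteq> X" by (intro iterated_join_subset) (rule conjunct1)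
  qed
  ultimately have "\<Union>(V ` I) = X" by (intro equalityI)
  moreover have "V ` I \<subseteq> iterated_join X f \<U> n" using V by blast
  ultimately have "min_subcover_card X f \<U> n \<le> card (V ` I)"
    unfolding min_subcover_card_def by (intro cInf_lower) auto
  also have "\<dots> \<le> card I" using assms(1) by (rule card_image_le)
  finally show ?thesis .
qed

text \<open>
  The finiteness of the optimal family has to be part of the conclusion, because the cardinality of
  an infinite family is zero by convention; it holds since the join itself is finite.
\<close>

lemma min_subcover_attained:
  assumes "f \<in> X \<rightarrow> X" "finite_open_cover X \<U>"
  obtains \<V> where "finite \<V>" "\<V> \<subseteq> iterated_join X f \<U> n" "\<Union>\<V> = X"
    "card \<V> = min_subcover_card X f \<U> n"
proof -
  let ?S = "{card \<V> | \<V>. \<V> \<subseteq> iterated_join X f \<U> n \<and> \<Union>\<V> = X}"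
  have "\<Union>(iterated_join X f \<U> n) = X"
    using assms by (intro Union_iterated_join) (auto simp: finite_open_cover_def)
  then have "card (iterated_join X f \<U> n) \<in> ?S" by (intro CollectI exI conjI) auto
  then have "?S \<noteq> {}" by blast
  then have "Inf ?S \<in> ?S" by (rule Inf_nat_def1)
  then obtain \<V> where "\<V> \<subseteq> iterated_join X f \<U> n" "\<Union>\<V> = X"
    "card \<V> = min_subcover_card X f \<U> n"
    unfolding min_subcover_card_def by (elim CollectE exE conjE) auto
  moreover have "finite (iterated_join X f \<U> n)"
    using finite_iterated_join assms(2) unfolding finite_open_cover_def by blast
  ultimately show ?thesis by (intro that) (auto intro: finite_subset)
qed

lemma min_subcover_card_pos:
  assumes "f \<in> X \<rightarrow> X" "finite_open_cover X \<U>" "X \<noteq> {}"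
  shows "min_subcover_card X f \<U> n \<ge> 1"
proof -
  obtain \<V> where "finite \<V>" "\<Union>\<V> = X" "card \<V> = min_subcover_card X f \<U> n"
    using min_subcover_attained[OF assms(1,2)] by metis
  then show ?thesis using assms(3)
    by (metis One_nat_def Suc_leI Union_empty card_gt_0_iff)
qed

text \<open>
  The constant factor disappears in the infimum, after division by \<open>n\<close>.
\<close>

lemma cover_entropy_le:
  assumes f: "f \<in> X \<rightarrow> X" "finite_open_cover X \<U>" "X \<noteq> {}"
    and le: "\<And>n. n \<ge> 1 \<Longrightarrow> real (min_subcover_card X f \<U> n) \<le> C * 2 powr (h * real n)"
  shows "cover_entropy X f \<U> \<le> ereal h"
proof (rule ereal_le_epsilon2)
  fix e :: real assume e: "0 < e"
  obtain n where n: "n \<ge> 1" "log 2 C / e \<le> real n"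
    by (metis le_max_iff_disj max.cobounded2 of_nat_le_iff order_trans real_arch_simple)
  let ?N = "real (min_subcover_card X f \<U> n)"
  have N: "?N \<ge> 1" using min_subcover_card_pos[OF f, of n] by simp
  then have C: "C > 0"
    by (smt (verit) le n(1) powr_gt_zero zero_less_mult_iff)
  have "log 2 ?N \<le> log 2 (C * 2 powr (h * real n))"
    using N le[OF n(1)] by simp
  also have "\<dots> = log 2 C + h * real n" using C by (simp add: log_mult)
  finally have "log 2 ?N / real n \<le> log 2 C / real n + h" using n(1) by (simp add: field_simps)
  also have "log 2 C / real n \<le> e" using n e by (simp add: field_simps)
  finally have "ereal (log 2 ?N / real n) \<le> ereal h + ereal e" by simp
  then show "cover_entropy X f \<U> \<le> ereal h + ereal e"
    unfolding cover_entropy_def using n(1) by (intro INF_lower2[of n]) auto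
qed

lemma cover_entropy_ge:
  assumes "\<And>n. n \<ge> 1 \<Longrightarrow> 2 powr (h * real n) \<le> real (min_subcover_card X f \<U> n)"
  shows "ereal h \<le> cover_entropy X f \<U>"
  unfolding cover_entropy_def
proof (rule INF_greatest)
  fix n :: nat assume "n \<in> {1..}"
  then have n: "n \<ge> 1" by simp
  have "h * real n = log 2 (2 powr (h * real n))" by simp
  also have "\<dots> \<le> log 2 (real (min_subcover_card X f \<U> n))"
    using assms[OF n] by (smt (verit) log_le_cancel_iff powr_gt_zero)
  finally show "ereal h \<le> ereal (log 2 (real (min_subcover_card X f \<U> n)) / real n)"
    using n by (simp add: field_simps)
qed

lemma cover_entropy_le_topological:
  "finite_open_cover X \<U> \<Longrightarrow> cover_entropy X f \<U> \<le> topological_entropy X f"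
  unfolding topological_entropy_def by (rule SUP_upper) auto

lemma topological_entropy_nonneg:
  assumes "f \<in> X \<rightarrow> X" "X \<noteq> {}"
  shows "0 \<le> topological_entropy X f"
proof -
  have c: "finite_open_cover X {X}" by (simp add: finite_open_cover_def)
  have "ereal 0 \<le> cover_entropy X f {X}"
    using min_subcover_card_pos[OF assms(1) c assms(2)] by (intro cover_entropy_ge) simp
  with cover_entropy_le_topological[OF c] show ?thesis
    by (metis order_trans zero_ereal_def)
qed

section \<open>Horseshoes bound the entropy from below\<close>

text \<open>
  An orbit segment of length \<open>n\<close> contains \<open>k \<ge> n / N\<close> points of an orbit of the \<open>N\<close>-th iterate.
\<close>

lemma sampling_times:
  assumes "N \<ge> 1" "n \<ge> (1::nat)"
  obtains k where "\<And>j. j < k \<Longrightarrow> j * N < n" "real n / real N \<le> real k"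
proof -
  define k where "k = (n - 1) div N + 1"
  have "j * N < n" if "j < k" for j
  proof -
    have "j * N \<le> (n - 1) div N * N" using that unfolding k_def by (intro mult_le_mono1) simp
    also have "\<dots> \<le> n - 1" by simp
    finally show ?thesis using assms by simp
  qed
  moreover have "real n / real N \<le> real k"
  proof -
    have "n - 1 < k * N" using assms(1) unfolding k_def
      by (metis add.commute dividend_less_times_div mult.commute mult_Suc plus_1_eq_Suc less_le_trans zero_less_one)
    then have "n \<le> k * N" using assms by simp
    then have "real n \<le> real k * real N" by (metis of_nat_le_iff of_nat_mult)
    then show ?thesis using assms by (simp add: field_simps)
  qed
  ultimately show ?thesis using that by blast
qed

text \<open>
  The points \<open>z (2 * i)\<close> and \<open>z (2 * i + 1)\<close> are the end points of the \<open>i\<close>-th of \<open>s\<close> disjoint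
  subintervals of \<open>[u, v]\<close>, and the image of each of them under the \<open>N\<close>-th iterate reaches beyond
  \<open>[u, v]\<close> on both sides. The data are rational and the conditions on the iterate are strict, so
  that finite computations can confirm them.
\<close>

definition horseshoe :: "(real \<Rightarrow> real) \<Rightarrow> nat \<Rightarrow> nat \<Rightarrow> bool" where
  "horseshoe f N s \<longleftrightarrow> (\<exists>(u::rat) (v::rat) z.
     (\<forall>i<2 * s. 0 \<le> z i \<and> z i \<le> 1 \<and> u \<le> z i \<and> z i \<le> v) \<and>
     (\<forall>i<2 * s - 1. z i < z (Suc i)) \<and>
     (\<forall>i<s. (f ^^ N) (of_rat (z (2 * i))) < of_rat u \<and> of_rat v < (f ^^ N) (of_rat (z (2 * i + 1))) \<or>
            of_rat v < (f ^^ N) (of_rat (z (2 * i))) \<and> (f ^^ N) (of_rat (z (2 * i + 1))) < of_rat u))"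

lemma strict_increasing_below:
  fixes z :: "nat \<Rightarrow> 'a::order"
  assumes "\<forall>i<n - 1. z i < z (Suc i)" "i < j" "j < n"
  shows "z i < z j"
  using assms(2,3)
proof (induction j)
  case (Suc j)
  then have "z j < z (Suc j)" using assms(1) by simp
  then show ?case using Suc by (cases "i = j") (auto intro: less_trans)
qed simp

text \<open>
  Let \<open>D i\<close> be the part of the \<open>i\<close>-th interval that the \<open>N\<close>-th iterate maps into \<open>[u, v]\<close>. These
  compact sets are disjoint and each is mapped onto \<open>[u, v]\<close>, so every word is followed by an orbit.
  The complements of all but one of them form an open cover in which orbits with different words lie
  in different elements of the join.
\<close>

lemma horseshoe_entropy:
  fixes f :: "real \<Rightarrow> real"
  assumes cont: "continuous_on {0..1} f" and maps: "f \<in> {0..1} \<rightarrow> {0..1}"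
    and "N \<ge> 1" "s \<ge> 1" "horseshoe f N s"
  shows "ereal (log 2 (real s) / real N) \<le> topological_entropy {0..1} f"
proof -
  let ?X = "{0..1::real}"
  define G where "G = f ^^ N"
  obtain u v :: rat and z where
    z: "\<And>i. i < 2 * s \<Longrightarrow> 0 \<le> z i \<and> z i \<le> 1 \<and> u \<le> z i \<and> z i \<le> v"
    and inc: "\<forall>i<2 * s - 1. z i < z (Suc i)"
    and cross: "\<And>i. i < s \<Longrightarrow>
       G (of_rat (z (2 * i))) < of_rat u \<and> of_rat v < G (of_rat (z (2 * i + 1))) \<or>
       of_rat v < G (of_rat (z (2 * i))) \<and> G (of_rat (z (2 * i + 1))) < of_rat u"
    using assms(5) unfolding horseshoe_def G_def by blast
  define a b where "a i = (of_rat (z (2 * i)) :: real)" and "b i = (of_rat (z (2 * i + 1)) :: real)" for i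
  have ab: "0 \<le> a i" "a i < b i" "b i \<le> 1" "of_rat u \<le> a i" "b i \<le> of_rat v" if "i < s" for i
    using z[of "2 * i"] z[of "2 * i + 1"] inc[rule_format, of "2 * i"] that
    by (auto simp: a_def b_def of_rat_less of_rat_less_eq)
  have sep: "b i < a j" if "i < j" "j < s" for i j
    using strict_increasing_below[OF inc, of "2 * i + 1" "2 * j"] that
    by (auto simp: a_def b_def of_rat_less)
  define D where "D i = {x \<in> {a i..b i}. of_rat u \<le> G x \<and> G x \<le> of_rat v}" for i
  have contG: "continuous_on ?X G" unfolding G_def using cont maps by (rule continuous_on_funpow)
  have D_closed: "closed (D i)" if "i < s" for i
  proof -
    have "continuous_on {a i..b i} G" using contG ab[OF that] by (auto intro: continuous_on_subset)
    then have "closed ({a i..b i} \<inter> G -` {of_rat u..of_rat v})"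
      by (intro continuous_closed_preimage) auto
    also have "{a i..b i} \<inter> G -` {of_rat u..of_rat v} = D i" unfolding D_def by auto
    finally show ?thesis .
  qed
  have D_sub: "D i \<subseteq> ?X" "D i \<subseteq> {of_rat u..of_rat v}" if "i < s" for i
    using ab[OF that] unfolding D_def by auto
  have D_disj: "i = j" if "x \<in> D i" "x \<in> D j" "i < s" "j < s" for i j x
    using sep[of i j] sep[of j i] that unfolding D_def by (cases i j rule: linorder_cases) auto
  have D_onto: "\<exists>x\<in>D i. G x = y" if "i < s" "y \<in> {of_rat u..of_rat v}" for i y
  proof -
    have c: "continuous_on {a i..b i} G" using contG ab[OF that(1)] by (auto intro: continuous_on_subset)
    have "\<exists>x\<ge>a i. x \<le> b i \<and> G x = y"
      using cross[OF that(1)]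
    proof
      assume "G (of_rat (z (2 * i))) < of_rat u \<and> of_rat v < G (of_rat (z (2 * i + 1)))"
      then show ?thesis using that(2) ab[OF that(1)] c by (intro IVT') (auto simp: a_def b_def)
    next
      assume "of_rat v < G (of_rat (z (2 * i))) \<and> G (of_rat (z (2 * i + 1))) < of_rat u"
      then show ?thesis using that(2) ab[OF that(1)] c by (intro IVT2') (auto simp: a_def b_def)
    qed
    then show ?thesis using that(2) unfolding D_def by auto
  qed
  have word: "\<exists>x\<in>?X. x \<in> {of_rat u..of_rat v} \<and> (\<forall>j<length w. (G ^^ j) x \<in> D (w ! j))"
    if "set w \<subseteq> {..<s}" for w
    using that
  proof (induction w)
    case Nil
    show ?case using ab[of 0] assms(4) by (intro bexI[of _ "a 0"]) auto
  next
    case (Cons i w)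
    then obtain y where y: "y \<in> {of_rat u..of_rat v}" "\<forall>j<length w. (G ^^ j) y \<in> D (w ! j)" by auto
    obtain x where x: "x \<in> D i" "G x = y" using D_onto[OF _ y(1), of i] Cons.prems by auto
    have "(G ^^ j) x \<in> D ((i # w) ! j)" if "j < length (i # w)" for j
      using that x y(2) by (cases j) (auto simp: funpow_swap1)
    moreover have "x \<in> ?X" "x \<in> {of_rat u..of_rat v}" using x(1) D_sub[of i] Cons.prems by auto
    ultimately show ?case by blast
  qed
  define U where "U i = ?X - (\<Union>j\<in>{..<s} - {i}. D j)" for i
  have cover: "finite_open_cover ?X (U ` {..<s})"
    unfolding finite_open_cover_def
  proof (intro conjI ballI)
    fix V assume "V \<in> U ` {..<s}"
    then obtain i where i: "V = U i" by auto
    have "closed (\<Union>j\<in>{..<s} - {i}. D j)" by (intro closed_UN) (auto intro: D_closed)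
    then have "openin (top_of_set ?X) (?X \<inter> - (\<Union>j\<in>{..<s} - {i}. D j))"
      by (intro openin_open_Int open_Compl)
    then show "openin (top_of_set ?X) V" unfolding i U_def by (simp add: Diff_eq)
  next
    show "\<Union>(U ` {..<s}) = ?X"
    proof
      show "?X \<subseteq> \<Union>(U ` {..<s})"
      proof
        fix x assume x: "x \<in> ?X"
        show "x \<in> \<Union>(U ` {..<s})"
        proof (cases "\<exists>i<s. x \<in> D i")
          case True
          then obtain i where "i < s" "x \<in> D i" by blast
          then have "x \<in> U i" unfolding U_def using x D_disj by auto
          then show ?thesis using \<open>i < s\<close> by auto
        next
          case False
          then have "x \<in> U 0" unfolding U_def using x by auto
          then show ?thesis using assms(4) by force
        qed
      qed
    qed (auto simp: U_def)
  qed simp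
  have "2 powr ((log 2 (real s) / real N) * real n) \<le> real (min_subcover_card ?X f (U ` {..<s}) n)"
    if n: "n \<ge> 1" for n
  proof -
    obtain k where kN: "\<And>j. j < k \<Longrightarrow> j * N < n" and nk: "real n / real N \<le> real k"
      using sampling_times[OF assms(3) n] by blast
    obtain \<V> where \<V>: "finite \<V>" "\<V> \<subseteq> iterated_join ?X f (U ` {..<s}) n" "\<Union>\<V> = ?X"
      "card \<V> = min_subcover_card ?X f (U ` {..<s}) n"
      using min_subcover_attained[OF maps cover] by metis
    define W where "W = {w. set w \<subseteq> {..<s} \<and> length w = k}"
    have "\<forall>w\<in>W. \<exists>V\<in>\<V>. \<exists>x\<in>V. \<forall>j<k. (G ^^ j) x \<in> D (w ! j)"
    proof
      fix w assume "w \<in> W"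
      then obtain x where "x \<in> ?X" "\<forall>j<k. (G ^^ j) x \<in> D (w ! j)"
        using word[of w] unfolding W_def by auto
      then show "\<exists>V\<in>\<V>. \<exists>x\<in>V. \<forall>j<k. (G ^^ j) x \<in> D (w ! j)"
        using \<V>(3) by (metis Union_iff)
    qed
    then obtain V where V: "\<And>w. w \<in> W \<Longrightarrow> V w \<in> \<V> \<and> (\<exists>x\<in>V w. \<forall>j<k. (G ^^ j) x \<in> D (w ! j))"
      by metis
    have "inj_on V W"
    proof (rule inj_onI)
      fix w w' assume ww: "w \<in> W" "w' \<in> W" "V w = V w'"
      obtain x x' where x: "x \<in> V w" "\<forall>j<k. (G ^^ j) x \<in> D (w ! j)"
        "x' \<in> V w" "\<forall>j<k. (G ^^ j) x' \<in> D (w' ! j)"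
        using V[OF ww(1)] V[OF ww(2)] ww(3) by auto
      have "V w \<in> iterated_join ?X f (U ` {..<s}) n" using V[OF ww(1)] \<V>(2) by auto
      then obtain T where T: "V w = {x \<in> ?X. \<forall>k<n. (f ^^ k) x \<in> T k}" "\<forall>k<n. T k \<in> U ` {..<s}"
        unfolding iterated_join_def by blast
      show "w = w'"
      proof (rule nth_equalityI)
        show "length w = length w'" using ww unfolding W_def by auto
        fix j assume "j < length w"
        then have j: "j < k" using ww unfolding W_def by auto
        obtain i where i: "T (j * N) = U i" "i < s" using T(2) kN[OF j] by auto
        have G: "(G ^^ j) = (f ^^ (j * N))" unfolding G_def by (simp add: funpow_mult mult.commute)
        have lt: "w ! j < s" "w' ! j < s" 
        proof -
          have "w ! j \<in> set w" "w' ! j \<in> set w'" using ww j unfolding W_def by (auto intro!: nth_mem)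
          then show "w ! j < s" "w' ! j < s" using ww unfolding W_def by blast+
        qed
        have "(G ^^ j) x \<in> U i" "(G ^^ j) x' \<in> U i"
          using x T(1) kN[OF j] i G by auto
        moreover have "(G ^^ j) x \<in> D (w ! j)" "(G ^^ j) x' \<in> D (w' ! j)" using x(2,4) j by auto
        ultimately have "w ! j = i" "w' ! j = i" using lt unfolding U_def by blast+
        then show "w ! j = w' ! j" by simp
      qed
    qed
    moreover have "V ` W \<subseteq> \<V>" using V by auto
    ultimately have "card W \<le> card \<V>" using \<V>(1) by (metis card_inj_on_le)
    then have "s ^ k \<le> min_subcover_card ?X f (U ` {..<s}) n"
      using \<V>(4) unfolding W_def by (simp add: card_lists_length_eq)
    then have "real s ^ k \<le> real (min_subcover_card ?X f (U ` {..<s}) n)"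
      by (metis of_nat_le_iff of_nat_power)
    moreover have "2 powr ((log 2 (real s) / real N) * real n) \<le> real s ^ k"
    proof -
      have "(log 2 (real s) / real N) * real n = log 2 (real s) * (real n / real N)" by simp
      also have "\<dots> \<le> log 2 (real s) * real k" using assms(4) nk by (intro mult_left_mono) auto
      finally have "2 powr ((log 2 (real s) / real N) * real n) \<le> 2 powr (log 2 (real s) * real k)" by simp
      also have "\<dots> = (2 powr (log 2 (real s))) powr real k" by (simp add: powr_powr)
      also have "\<dots> = real s ^ k" using assms(4) by (simp add: powr_realpow)
      finally show ?thesis .
    qed
    ultimately show ?thesis by (rule order_trans[rotated])
  qed
  then have "ereal (log 2 (real s) / real N) \<le> cover_entropy ?X f (U ` {..<s})"
    by (rule cover_entropy_ge)
  also have "\<dots> \<le> topological_entropy ?X f" using cover by (rule cover_entropy_le_topological)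
  finally show ?thesis .
qed

section \<open>Misiurewicz's theorem\<close>

text \<open>
  Take the first visit to \<open>\<beta>\<close>, and then the last visit to \<open>\<alpha>\<close> before it.
\<close>

lemma minimal_crossing:
  fixes h :: "real \<Rightarrow> real"
  assumes cont: "continuous_on {x..y} h" and "x \<le> y" and h: "h x = \<alpha>" "h y = \<beta>" "\<alpha> \<noteq> \<beta>"
  obtains p q where "x \<le> p" "p < q" "q \<le> y" "h p = \<alpha>" "h q = \<beta>"
    "\<And>t. p < t \<Longrightarrow> t < q \<Longrightarrow> h t \<noteq> \<alpha> \<and> h t \<noteq> \<beta>"
proof -
  define Q where "Q = {x..y} \<inter> h -` {\<beta>}"
  have "closed Q" unfolding Q_def using cont by (intro continuous_closed_preimage) auto
  moreover have "y \<in> Q" "bdd_below Q" using assms unfolding Q_def by auto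
  ultimately have q: "Inf Q \<in> Q" by (intro closed_contains_Inf) auto
  define q where "q = Inf Q"
  have q_min: "q \<le> t" if "t \<in> Q" for t unfolding q_def using \<open>bdd_below Q\<close> that by (rule cInf_lower[rotated])
  have q': "x \<le> q" "q \<le> y" "h q = \<beta>" 
    using q[folded q_def] unfolding Q_def by auto
  define P where "P = {x..q} \<inter> h -` {\<alpha>}"
  have "continuous_on {x..q} h" using cont q' by (auto intro: continuous_on_subset)
  then have "closed P" unfolding P_def by (intro continuous_closed_preimage) auto
  moreover have "x \<in> P" "bdd_above P" using q' h unfolding P_def by auto
  ultimately have p: "Sup P \<in> P" by (intro closed_contains_Sup) auto
  define p where "p = Sup P"
  have p_max: "t \<le> p" if "t \<in> P" for t unfolding p_def using \<open>bdd_above P\<close> that by (rule cSup_upper[rotated])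
  have p': "x \<le> p" "p \<le> q" "h p = \<alpha>" 
    using p[folded p_def] unfolding P_def by auto
  have "p \<noteq> q" using p'(3) q'(3) h(3) by auto
  moreover have "h t \<noteq> \<alpha> \<and> h t \<noteq> \<beta>" if "p < t" "t < q" for t
    using p_max[of t] q_min[of t] that p' q' unfolding P_def Q_def by auto
  ultimately show ?thesis using that[of p q] p' q' by auto
qed

lemma image_crossing:
  fixes h :: "real \<Rightarrow> real"
  assumes "continuous_on {p..q} h" "h p \<noteq> h q"
    and "\<And>t. p < t \<Longrightarrow> t < q \<Longrightarrow> h t \<noteq> h p \<and> h t \<noteq> h q" and t: "t \<in> {p..q}"
  shows "h t \<in> closed_segment (h p) (h q)"
proof -
  have increasing: "h p \<le> h t \<and> h t \<le> h q"
    if cont: "continuous_on {p..q} h" and less: "h p < h q"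
    and avoid: "\<And>t. p < t \<Longrightarrow> t < q \<Longrightarrow> h t \<noteq> h p \<and> h t \<noteq> h q" for h :: "real \<Rightarrow> real"
  proof (rule ccontr)
    assume "\<not> (h p \<le> h t \<and> h t \<le> h q)"
    then consider "h t < h p" | "h q < h t" by linarith
    then show False
    proof cases
      case 1
      have "continuous_on {t..q} h" using cont t by (auto intro: continuous_on_subset)
      then obtain t' where t': "t \<le> t'" "t' \<le> q" "h t' = h p"
        using IVT'[of h t "h p" q] 1 less t by auto
      then have "t' \<noteq> t" "t' \<noteq> q" using 1 less by auto
      then show False using avoid[of t'] t' t by auto
    next
      case 2
      have "continuous_on {p..t} h" using cont t by (auto intro: continuous_on_subset)
      then obtain t' where t': "p \<le> t'" "t' \<le> t" "h t' = h q"
        using IVT'[of h p "h q" t] 2 less t by auto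
      then have "t' \<noteq> t" "t' \<noteq> p" using 2 less by auto
      then show False using avoid[of t'] t' t by auto
    qed
  qed
  show ?thesis
  proof (cases "h p < h q")
    case True
    then show ?thesis using increasing[OF assms(1) True assms(3)] by (auto simp: closed_segment_eq_real_ivl)
  next
    case False
    then have "- h p \<le> - h t \<and> - h t \<le> - h q"
      using assms by (intro increasing) (auto intro: continuous_on_minus)
    then show ?thesis by (auto simp: closed_segment_eq_real_ivl)
  qed
qed

text \<open>
  A segment in the image of an interval is covered exactly, by a segment that joins preimages of its
  end points: a minimal crossing does not leave the target.
\<close>

lemma pull_back_segment:
  fixes g :: "real \<Rightarrow> real"
  assumes cont: "continuous_on J g" and J: "convex J" "x \<in> J" "y \<in> J"
  obtains p q where "closed_segment p q \<subseteq> J" "g p = g x" "g q = g y"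
    "g ` closed_segment p q \<subseteq> closed_segment (g x) (g y)"
proof (cases "g x = g y")
  case True
  then show ?thesis using that[of x x] J by auto
next
  case ne: False
  have ex: "\<exists>p q. closed_segment p q \<subseteq> J \<and> g p = g x \<and> g q = g y \<and>
      g ` closed_segment p q \<subseteq> closed_segment (g x) (g y)"
    if "x \<le> y" "x \<in> J" "y \<in> J" "g x \<noteq> g y" for x y
  proof -
    have sub: "{x..y} \<subseteq> J" using J(1) that closed_segment_subset[of x J y]
      by (auto simp: closed_segment_eq_real_ivl)
    have c: "continuous_on {x..y} g" using cont sub by (rule continuous_on_subset)
    obtain p q where pq: "x \<le> p" "p < q" "q \<le> y" "g p = g x" "g q = g y"
      "\<And>t. p < t \<Longrightarrow> t < q \<Longrightarrow> g t \<noteq> g x \<and> g t \<noteq> g y"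
      using minimal_crossing[OF c \<open>x \<le> y\<close> refl refl \<open>g x \<noteq> g y\<close>] by metis
    have seg: "closed_segment p q = {p..q}" using pq by (simp add: closed_segment_eq_real_ivl)
    have "continuous_on {p..q} g" using c pq by (auto intro: continuous_on_subset)
    then have "g t \<in> closed_segment (g x) (g y)" if "t \<in> {p..q}" for t
      using image_crossing[of p q g t] pq(4-6) that \<open>g x \<noteq> g y\<close> by auto
    then show ?thesis
      using pq sub by (intro exI[of _ p] exI[of _ q]) (auto simp: seg)
  qed
  show ?thesis
  proof (cases "x \<le> y")
    case True
    then show ?thesis using ex[of x y] J ne that by blast
  next
    case False
    then obtain p q where "closed_segment p q \<subseteq> J" "g p = g y" "g q = g x"
      "g ` closed_segment p q \<subseteq> closed_segment (g y) (g x)"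
      using ex[of y x] J ne by (auto simp: eq_commute)
    then show ?thesis using that[of q p] by (simp add: closed_segment_commute)
  qed
qed

lemma continuous_on_near:
  fixes h :: "real \<Rightarrow> real"
  assumes "continuous_on I h" "x \<in> I" "open S" "h x \<in> S"
  obtains e where "e > 0" "\<And>y. y \<in> I \<Longrightarrow> \<bar>y - x\<bar> < e \<Longrightarrow> h y \<in> S"
proof -
  obtain d where d: "d > 0" "\<And>z. dist z (h x) < d \<Longrightarrow> z \<in> S"
    using assms(3,4) unfolding open_dist by blast
  obtain e where "e > 0" "\<And>y. y \<in> I \<Longrightarrow> dist y x < e \<Longrightarrow> dist (h y) (h x) < d"
    using assms(1,2) d(1) unfolding continuous_on_iff by blast
  then show ?thesis using that d(2) by (auto simp: dist_real_def)
qed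

text \<open>
  Orbits of \<open>g\<close> are coded by the cells of a partition of the unit interval into \<open>M\<close> intervals of
  equal length. Neighbouring cells share an end point, so a point may have several codes.
\<close>

locale interval_coding =
  fixes g :: "real \<Rightarrow> real" and M :: nat
  assumes M_pos: "M > 0"
    and cont: "continuous_on {0..1} g"
    and maps: "g \<in> {0..1} \<rightarrow> {0..1}"
begin

definition cell :: "nat \<Rightarrow> real set" where
  "cell b = {real b / real M..(real b + 1) / real M}"

text \<open>
  The end points of the orbits that start in \<open>J\<close> and then follow the word. The set of the
  corresponding starting points need not be connected, but the set of end points is an interval.
\<close>

primrec reach :: "real set \<Rightarrow> nat list \<Rightarrow> real set" where
  "reach J [] = J"
| "reach J (b # w) = reach (g ` J \<inter> cell b) w"

definition segment :: "real set \<Rightarrow> bool" where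
  "segment J \<longleftrightarrow> (\<exists>x y. 0 \<le> x \<and> x \<le> y \<and> y \<le> 1 \<and> J = {x..y})"

definition admissible :: "real set \<Rightarrow> nat \<Rightarrow> nat list set" where
  "admissible J n = {w. length w = n \<and> set w \<subseteq> {..<M} \<and> reach J w \<noteq> {}}"

text \<open>
  The words that fill no cells other than those with label in \<open>S\<close>; they are counted by induction on
  \<open>S\<close>.
\<close>

definition restricted :: "nat set \<Rightarrow> real set \<Rightarrow> nat \<Rightarrow> nat list set" where
  "restricted S J n = {w \<in> admissible J n. \<forall>i v. 1 \<le> i \<longrightarrow> i \<le> n \<longrightarrow> v < M \<longrightarrow>
     reach J (take i w) = cell v \<longrightarrow> v \<in> S}"

definition return_words :: "nat \<Rightarrow> nat \<Rightarrow> nat list set" where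
  "return_words v n = {w. length w = n \<and> set w \<subseteq> {..<M} \<and> reach (cell v) w = cell v}"

lemma reach_append: "reach J (u @ w) = reach (reach J u) w"
  by (induction u arbitrary: J) auto

lemma reach_empty [simp]: "reach {} w = {}"
  by (induction w) auto

lemma segment_cell: "v < M \<Longrightarrow> segment (cell v)"
  unfolding segment_def cell_def
  by (intro exI[of _ "real v / real M"] exI[of _ "(real v + 1) / real M"])
    (auto simp: divide_simps)

lemma segment_image:
  assumes "segment J"
  shows "segment (g ` J)"
proof -
  obtain x y where J: "0 \<le> x" "x \<le> y" "y \<le> 1" "J = {x..y}" using assms unfolding segment_def by blast
  then have "continuous_on {x..y} g" using cont by (auto intro: continuous_on_subset)
  then obtain c d where cd: "g ` {x..y} = {c..d}" "c \<le> d"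
    using continuous_image_closed_interval[OF J(2)] by blast
  have "{c..d} \<subseteq> {0..1}" unfolding cd(1)[symmetric] using J maps by auto
  then show ?thesis unfolding segment_def using cd J(4) by auto
qed

lemma segment_step:
  assumes "segment J" "b < M" "g ` J \<inter> cell b \<noteq> {}"
  shows "segment (g ` J \<inter> cell b)"
proof -
  obtain x y where J: "0 \<le> x" "x \<le> y" "y \<le> 1" "g ` J = {x..y}"
    using segment_image[OF assms(1)] unfolding segment_def by blast
  obtain x' y' where C: "0 \<le> x'" "x' \<le> y'" "y' \<le> 1" "cell b = {x'..y'}"
    using segment_cell[OF assms(2)] unfolding segment_def by blast
  have "g ` J \<inter> cell b = {max x x'..min y y'}" unfolding J(4) C(4) by auto
  moreover have "max x x' \<le> min y y'" using assms(3) calculation by auto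
  ultimately show ?thesis unfolding segment_def using J C by (metis le_max_iff_disj min_le_iff_disj)
qed

lemma finite_words: "finite {w::nat list. length w = n \<and> set w \<subseteq> {..<M}}"
  using finite_lists_length_eq[of "{..<M}" n] by (simp add: conj_commute)

lemma finite_admissible: "finite (admissible J n)"
  by (rule finite_subset[OF _ finite_words[of n]]) (auto simp: admissible_def)

lemma finite_restricted: "finite (restricted S J n)"
  by (rule finite_subset[OF _ finite_admissible[of J n]]) (auto simp: restricted_def)

lemma finite_return_words: "finite (return_words v n)"
  by (rule finite_subset[OF _ finite_words[of n]]) (auto simp: return_words_def)

text \<open>
  The image of \<open>J\<close> is an interval, and an interval can meet a cell without containing it only at
  one of its two ends.
\<close>

lemma partial_children:
  assumes "segment J"
  shows "card {b. b < M \<and> g ` J \<inter> cell b \<noteq> {} \<and> g ` J \<inter> cell b \<noteq> cell b} \<le> 2"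
    (is "card ?B \<le> 2")
proof -
  obtain x y where J: "0 \<le> x" "x \<le> y" "y \<le> 1" "g ` J = {x..y}"
    using segment_image[OF assms(1)] unfolding segment_def by blast
  have "?B \<subseteq> {nat (\<lceil>x * real M\<rceil> - 1), nat \<lfloor>y * real M\<rfloor>}"
  proof
    fix b assume "b \<in> ?B"
    then have b: "g ` J \<inter> cell b \<noteq> {}" "\<not> cell b \<subseteq> g ` J" by auto
    then obtain t where "t \<in> {x..y}" "t \<in> {real b / real M..(real b + 1) / real M}"
      unfolding J(4) cell_def by blast
    then have "x \<le> t" "t \<le> y" "real b / real M \<le> t" "t \<le> (real b + 1) / real M" by auto
    then have t: "x \<le> (real b + 1) / real M" "real b / real M \<le> y" by linarith+
    have "real b / real M < x \<or> y < (real b + 1) / real M" using b(2) unfolding J(4) cell_def by auto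
    then show "b \<in> {nat (\<lceil>x * real M\<rceil> - 1), nat \<lfloor>y * real M\<rfloor>}"
    proof
      assume "real b / real M < x"
      then have "real b < x * real M" "x * real M \<le> real b + 1" using t M_pos by (auto simp: field_simps)
      then have "\<lceil>x * real M\<rceil> = int b + 1" by (intro ceiling_unique) auto
      then show ?thesis by simp
    next
      assume "y < (real b + 1) / real M"
      then have "y * real M < real b + 1" "real b \<le> y * real M" using t M_pos by (auto simp: field_simps)
      then have "\<lfloor>y * real M\<rfloor> = int b" by (intro floor_unique) auto
      then show ?thesis by simp
    qed
  qed
  then have "card ?B \<le> card {nat (\<lceil>x * real M\<rceil> - 1), nat \<lfloor>y * real M\<rfloor>}" by (intro card_mono) auto
  also have "\<dots> \<le> 2" by (simp add: card_insert_if)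
  finally show ?thesis .
qed

text \<open>
  As long as no cell is filled, each word has at most two continuations.
\<close>

lemma card_never_full:
  assumes "segment J"
  shows "card (restricted {} J n) \<le> 2 ^ n"
  using assms
proof (induction n arbitrary: J)
  case 0
  have "restricted {} J 0 \<subseteq> {[]}" unfolding restricted_def admissible_def by auto
  then have "card (restricted {} J 0) \<le> card {[]::nat list}" by (intro card_mono) auto
  then show ?case by simp
next
  case (Suc n)
  let ?B = "{b. b < M \<and> g ` J \<inter> cell b \<noteq> {} \<and> g ` J \<inter> cell b \<noteq> cell b}"
  have "restricted {} J (Suc n) \<subseteq> (\<Union>b\<in>?B. (#) b ` restricted {} (g ` J \<inter> cell b) n)"
  proof
    fix w assume w: "w \<in> restricted {} J (Suc n)"
    then obtain b w' where bw: "w = b # w'" "length w' = n"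
      unfolding restricted_def admissible_def by (auto simp: length_Suc_conv)
    have b: "b < M" "g ` J \<inter> cell b \<noteq> {}"
      using w unfolding restricted_def admissible_def bw by auto
    have no: "reach J (take i w) \<noteq> cell v" if "1 \<le> i" "i \<le> Suc n" "v < M" for i v
      using w that unfolding restricted_def by blast
    have "g ` J \<inter> cell b \<noteq> cell b" using no[of 1 b] b bw by simp
    moreover have "reach (g ` J \<inter> cell b) (take i w') \<noteq> cell v" if "1 \<le> i" "i \<le> n" "v < M" for i v
      using no[of "Suc i" v] that bw by simp
    then have "w' \<in> restricted {} (g ` J \<inter> cell b) n"
      using w bw unfolding restricted_def admissible_def by auto
    ultimately show "w \<in> (\<Union>b\<in>?B. (#) b ` restricted {} (g ` J \<inter> cell b) n)"
      using b bw by blast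
  qed
  then have "card (restricted {} J (Suc n)) \<le> card (\<Union>b\<in>?B. (#) b ` restricted {} (g ` J \<inter> cell b) n)"
    by (intro card_mono finite_UN_I finite_imageI finite_restricted) auto
  also have "\<dots> \<le> (\<Sum>b\<in>?B. card ((#) b ` restricted {} (g ` J \<inter> cell b) n))"
    by (intro card_UN_le) auto
  also have "\<dots> \<le> (\<Sum>b\<in>?B. 2 ^ n)"
  proof (rule sum_mono)
    fix b assume "b \<in> ?B"
    then have "segment (g ` J \<inter> cell b)" using segment_step[OF Suc.prems, of b] by auto
    then have "card (restricted {} (g ` J \<inter> cell b) n) \<le> 2 ^ n" by (rule Suc.IH)
    then show "card ((#) b ` restricted {} (g ` J \<inter> cell b) n) \<le> 2 ^ n"
      using card_image_le[OF finite_restricted] order_trans by blast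
  qed
  also have "\<dots> \<le> 2 * 2 ^ n" using partial_children[OF Suc.prems] by simp
  finally show ?case by simp
qed


text \<open>
  Split a word at the first and at the last time at which it fills the cell \<open>v\<close>. What lies between
  leads from \<open>v\<close> back to \<open>v\<close>, and the two outer parts never fill \<open>v\<close>; the letter read at the
  first of these times is kept separately.
\<close>

lemma restricted_insert:
  assumes "v < M"
  shows "restricted (insert v S) J n \<subseteq> restricted S J n \<union> (\<Union>i\<in>{1..n}. \<Union>k\<in>{i..n}.
     (\<lambda>(x, b, y, z). x @ [b] @ y @ z) `
       (restricted S J (i - 1) \<times> {..<M} \<times> return_words v (k - i) \<times> restricted S (cell v) (n - k)))"
proof
  fix w assume w: "w \<in> restricted (insert v S) J n"
  have len: "length w = n" and set: "set w \<subseteq> {..<M}" and ne: "reach J w \<noteq> {}"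
    using w unfolding restricted_def admissible_def by auto
  have lab: "u = v \<or> u \<in> S" if "1 \<le> i" "i \<le> n" "u < M" "reach J (take i w) = cell u" for i u
    using w that unfolding restricted_def by blast
  define I where "I = {i \<in> {1..n}. reach J (take i w) = cell v}"
  show "w \<in> restricted S J n \<union> (\<Union>i\<in>{1..n}. \<Union>k\<in>{i..n}.
     (\<lambda>(x, b, y, z). x @ [b] @ y @ z) `
       (restricted S J (i - 1) \<times> {..<M} \<times> return_words v (k - i) \<times> restricted S (cell v) (n - k)))"
  proof (cases "I = {}")
    case True
    then have "u \<in> S" if "1 \<le> i" "i \<le> n" "u < M" "reach J (take i w) = cell u" for i u
      using lab[OF that] that unfolding I_def by auto
    then have "w \<in> restricted S J n" using w unfolding restricted_def by auto
    then show ?thesis by blast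
  next
    case False
    have fin: "finite I" unfolding I_def by auto
    define i where "i = Min I"
    define k where "k = Max I"
    have "i \<in> I" "k \<in> I" unfolding i_def k_def using fin False by auto
    then have i: "1 \<le> i" "i \<le> n" "reach J (take i w) = cell v"
      and k: "1 \<le> k" "k \<le> n" "reach J (take k w) = cell v" unfolding I_def by auto
    have "i \<le> k" using fin \<open>k \<in> I\<close> unfolding i_def by auto
    have before: "u \<in> S" if "1 \<le> j" "j < i" "u < M" "reach J (take j w) = cell u" for j u
    proof -
      have "j \<notin> I" using that(2) fin unfolding i_def by (metis Min_le not_le)
      then show ?thesis using lab[of j u] that i unfolding I_def by auto
    qed
    have after: "u \<in> S" if "k < j" "j \<le> n" "u < M" "reach J (take j w) = cell u" for j u
    proof -
      have "j \<notin> I" using that(1) fin unfolding k_def by (metis Max_ge not_le)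
      then show ?thesis using lab[of j u] that i unfolding I_def by auto
    qed
    define x where "x = take (i - 1) w"
    define b where "b = w ! (i - 1)"
    define y where "y = drop i (take k w)"
    define z where "z = drop k w"
    have dec: "w = x @ [b] @ y @ z"
    proof -
      have "take i w = x @ [b]" unfolding x_def b_def using i len
        by (metis One_nat_def Suc_le_eq Suc_pred' less_le_trans take_Suc_conv_app_nth zero_less_one diff_less)
      moreover have "take k w = take i w @ y"
        unfolding y_def by (metis \<open>i \<le> k\<close> append_take_drop_id min.absorb1 take_take)
      ultimately show ?thesis unfolding z_def by (metis append.assoc append_take_drop_id)
    qed
    have "x \<in> restricted S J (i - 1)"
      unfolding restricted_def admissible_def
    proof (intro CollectI conjI allI impI)
      show "length x = i - 1" unfolding x_def using i len by simp
      show "set x \<subseteq> {..<M}" unfolding x_def using set set_take_subset by fastforce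
      have "w = x @ drop (i - 1) w" unfolding x_def by simp
      then have "reach J w = reach (reach J x) (drop (i - 1) w)" by (metis reach_append)
      then show "reach J x \<noteq> {}" using ne by auto
      fix j u assume j: "1 \<le> j" "j \<le> i - 1" "u < M" "reach J (take j x) = cell u"
      then have "take j x = take j w" unfolding x_def by (simp add: min_absorb1)
      then show "u \<in> S" using before[of j u] j by simp
    qed
    moreover have "w ! (i - 1) \<in> set w" using i len by (intro nth_mem) auto
    then have "b \<in> {..<M}" using set unfolding b_def by blast
    moreover have "y \<in> return_words v (k - i)"
      unfolding return_words_def
    proof (intro CollectI conjI)
      show "length y = k - i" unfolding y_def using k len by simp
      show "set y \<subseteq> {..<M}" using set unfolding dec by auto
      have "take k w = take i w @ y" unfolding y_def by (metis \<open>i \<le> k\<close> append_take_drop_id min.absorb1 take_take)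
      then have "reach J (take k w) = reach (reach J (take i w)) y" by (simp add: reach_append)
      then show "reach (cell v) y = cell v" using i k by simp
    qed
    moreover have "z \<in> restricted S (cell v) (n - k)"
      unfolding restricted_def admissible_def
    proof (intro CollectI conjI allI impI)
      show "length z = n - k" unfolding z_def using len by simp
      show "set z \<subseteq> {..<M}" using set unfolding dec by auto
      have "reach J w = reach (reach J (take k w)) z" unfolding z_def by (metis append_take_drop_id reach_append)
      then show "reach (cell v) z \<noteq> {}" using ne k by simp
      fix j u assume j: "1 \<le> j" "j \<le> n - k" "u < M" "reach (cell v) (take j z) = cell u"
      have "take (k + j) w = take k w @ take j z" unfolding z_def by (simp add: take_add)
      then have "reach J (take (k + j) w) = cell u" using j k by (simp add: reach_append)
      then show "u \<in> S" using after[of "k + j" u] j k by simp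
    qed
    ultimately have "w \<in> (\<lambda>(x, b, y, z). x @ [b] @ y @ z) `
       (restricted S J (i - 1) \<times> {..<M} \<times> return_words v (k - i) \<times> restricted S (cell v) (n - k))"
      using dec by (intro image_eqI[of _ _ "(x, b, y, z)"]) auto
    moreover have "i \<in> {1..n}" "k \<in> {i..n}" using i k \<open>i \<le> k\<close> by auto
    ultimately show ?thesis by blast
  qed
qed

text \<open>
  Adding a label to \<open>S\<close> costs a sum over two splitting times and a product of two earlier bounds,
  hence only a larger polynomial factor. The assumption \<open>\<theta> \<ge> 1\<close> absorbs the words that never fill a
  cell.
\<close>

lemma card_restricted:
  fixes \<theta> :: real
  assumes "finite S" "\<theta> \<ge> 1"
    and ret: "\<And>v n. v < M \<Longrightarrow> real (card (return_words v n)) \<le> 2 powr (\<theta> * real n)"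
  shows "\<exists>C p. C \<ge> 0 \<and> (\<forall>J n. segment J \<longrightarrow>
    real (card (restricted S J n)) \<le> C * (real n + 1) ^ p * 2 powr (\<theta> * real n))"
  using assms(1)
proof (induction S)
  case empty
  have "real (card (restricted {} J n)) \<le> 1 * (real n + 1) ^ 0 * 2 powr (\<theta> * real n)" if "segment J" for J n
  proof -
    have "real (card (restricted {} J n)) \<le> 2 ^ n"
      using card_never_full[OF that, of n] by (metis of_nat_le_iff of_nat_numeral of_nat_power)
    also have "\<dots> = 2 powr real n" by (simp add: powr_realpow)
    also have "\<dots> \<le> 2 powr (\<theta> * real n)" using assms(2) by (intro powr_mono) (auto simp: mult_le_cancel_right1)
    finally show ?thesis by simp
  qed
  then show ?case by (intro exI[of _ 1] exI[of _ 0]) simp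
next
  case (insert v S)
  then obtain C p where C: "C \<ge> 0" and bound: "\<And>J n. segment J \<Longrightarrow>
    real (card (restricted S J n)) \<le> C * (real n + 1) ^ p * 2 powr (\<theta> * real n)" by blast
  show ?case
  proof (cases "v < M")
    case False
    then have "restricted (insert v S) J n = restricted S J n" for J n
      unfolding restricted_def by auto
    then show ?thesis using C bound by (intro exI[of _ C] exI[of _ p]) auto
  next
    case v: True
    have "real (card (restricted (insert v S) J n)) \<le>
        (C + C * C * real M) * (real n + 1) ^ (2 * p + 2) * 2 powr (\<theta> * real n)" if J: "segment J" for J n
    proof -
      let ?P = "\<lambda>i k. restricted S J (i - 1) \<times> {..<M} \<times> return_words v (k - i) \<times> restricted S (cell v) (n - k)"
      let ?f = "\<lambda>(x, b, y, z). x @ [b] @ y @ z"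
      let ?E = "(real n + 1) ^ p"
      have pow: "(real n + 1) ^ (2 * p + 2) = (?E * ?E) * ((real n + 1) * (real n + 1))"
        by (simp add: power_add power2_eq_square mult_2)
      have finP: "finite (?P i k)" for i k
        by (intro finite_cartesian_product finite_restricted finite_return_words) auto
      have part: "real (card (?f ` ?P i k)) \<le> C * C * real M * (?E * ?E) * 2 powr (\<theta> * real n)"
        if ik: "i \<in> {1..n}" "k \<in> {i..n}" for i k
      proof -
        have "real (card (?f ` ?P i k)) \<le> real (card (?P i k))"
          using card_image_le[OF finP] by (simp only: of_nat_le_iff)
        also have "\<dots> = real (card (restricted S J (i - 1))) * real M * real (card (return_words v (k - i)))
            * real (card (restricted S (cell v) (n - k)))"
          by (simp add: card_cartesian_product)
        also have "\<dots> \<le> (C * ?E * 2 powr (\<theta> * real (i - 1))) * real M * 2 powr (\<theta> * real (k - i))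
            * (C * ?E * 2 powr (\<theta> * real (n - k)))"
        proof (intro mult_mono mult_right_mono)
          have "real (card (restricted S J (i - 1))) \<le> C * (real (i - 1) + 1) ^ p * 2 powr (\<theta> * real (i - 1))"
            by (rule bound[OF J])
          also have "\<dots> \<le> C * ?E * 2 powr (\<theta> * real (i - 1))"
            using ik C by (intro mult_right_mono mult_left_mono power_mono) auto
          finally show "real (card (restricted S J (i - 1))) \<le> C * ?E * 2 powr (\<theta> * real (i - 1))" .
          have "real (card (restricted S (cell v) (n - k))) \<le> C * (real (n - k) + 1) ^ p * 2 powr (\<theta> * real (n - k))"
            by (rule bound[OF segment_cell[OF v]])
          also have "\<dots> \<le> C * ?E * 2 powr (\<theta> * real (n - k))"
            using ik C by (intro mult_right_mono mult_left_mono power_mono) auto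
          finally show "real (card (restricted S (cell v) (n - k))) \<le> C * ?E * 2 powr (\<theta> * real (n - k))" .
          show "real (card (return_words v (k - i))) \<le> 2 powr (\<theta> * real (k - i))" by (rule ret[OF v])
        qed (use C in auto)
        also have "\<dots> = C * C * real M * (?E * ?E) *
            (2 powr (\<theta> * real (i - 1)) * 2 powr (\<theta> * real (k - i)) * 2 powr (\<theta> * real (n - k)))"
          by (simp add: algebra_simps)
        also have "2 powr (\<theta> * real (i - 1)) * 2 powr (\<theta> * real (k - i)) * 2 powr (\<theta> * real (n - k))
            = 2 powr (\<theta> * real (n - 1))"
          using ik by (simp add: powr_add[symmetric] distrib_left[symmetric] of_nat_diff)
        also have "C * C * real M * (?E * ?E) * 2 powr (\<theta> * real (n - 1)) \<le> C * C * real M * (?E * ?E) * 2 powr (\<theta> * real n)"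
          using C assms(2) by (intro mult_left_mono powr_mono mult_left_mono) auto
        finally show ?thesis .
      qed
      have "card (restricted (insert v S) J n) \<le>
        card (restricted S J n \<union> (\<Union>i\<in>{1..n}. \<Union>k\<in>{i..n}. ?f ` ?P i k))"
        by (intro card_mono restricted_insert[OF v] finite_UnI finite_UN_I finite_restricted finite_imageI finP) auto
      also have "\<dots> \<le> card (restricted S J n) + card (\<Union>i\<in>{1..n}. \<Union>k\<in>{i..n}. ?f ` ?P i k)"
        by (rule card_Un_le)
      also have "card (\<Union>i\<in>{1..n}. \<Union>k\<in>{i..n}. ?f ` ?P i k) \<le> (\<Sum>i\<in>{1..n}. card (\<Union>k\<in>{i..n}. ?f ` ?P i k))"
        by (intro card_UN_le) auto
      also have "\<dots> \<le> (\<Sum>i\<in>{1..n}. \<Sum>k\<in>{i..n}. card (?f ` ?P i k))"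
        by (intro sum_mono card_UN_le) auto
      finally have "real (card (restricted (insert v S) J n)) \<le>
          real (card (restricted S J n)) + (\<Sum>i\<in>{1..n}. \<Sum>k\<in>{i..n}. real (card (?f ` ?P i k)))"
        unfolding of_nat_sum[symmetric] of_nat_add[symmetric] by (simp only: of_nat_le_iff)
      also have "(\<Sum>i\<in>{1..n}. \<Sum>k\<in>{i..n}. real (card (?f ` ?P i k))) \<le>
          (\<Sum>i\<in>{1..n}. \<Sum>k\<in>{i..n}. C * C * real M * (?E * ?E) * 2 powr (\<theta> * real n))"
        by (intro sum_mono part)
      also have "\<dots> \<le> (\<Sum>i\<in>{1..n}. (real n + 1) * (C * C * real M * (?E * ?E) * 2 powr (\<theta> * real n)))"
        using C by (intro sum_mono) (auto intro!: mult_right_mono)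
      also have "\<dots> \<le> (real n + 1) * ((real n + 1) * (C * C * real M * (?E * ?E) * 2 powr (\<theta> * real n)))"
        using C by (auto intro!: mult_right_mono)
      also have "\<dots> = C * C * real M * (real n + 1) ^ (2 * p + 2) * 2 powr (\<theta> * real n)"
        unfolding pow by (simp only: mult_ac)
      also have "real (card (restricted S J n)) \<le> C * (real n + 1) ^ p * 2 powr (\<theta> * real n)"
        by (rule bound[OF J])
      also have "\<dots> \<le> C * (real n + 1) ^ (2 * p + 2) * 2 powr (\<theta> * real n)"
        using C by (intro mult_right_mono mult_left_mono power_increasing) auto
      finally show ?thesis by (simp only: distrib_right add_mono add.commute)
    qed
    moreover have "C + C * C * real M \<ge> 0" using C by simp
    ultimately show ?thesis by blast
  qed
qed

lemma card_admissible:
  fixes \<theta> :: real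
  assumes "\<theta> \<ge> 1" "\<And>v n. v < M \<Longrightarrow> real (card (return_words v n)) \<le> 2 powr (\<theta> * real n)"
  obtains C p where "C \<ge> 0" "\<And>J n. segment J \<Longrightarrow>
    real (card (admissible J n)) \<le> C * (real n + 1) ^ p * 2 powr (\<theta> * real n)"
proof -
  have "restricted {..<M} J n = admissible J n" for J n unfolding restricted_def by auto
  then show ?thesis using that card_restricted[OF finite_lessThan[of M] assms] by metis
qed

lemma return_words_power: "card (return_words v n) ^ k \<le> card (return_words v (n * k))"
proof (induction k)
  case 0
  have "return_words v 0 = {[]}" unfolding return_words_def by auto
  then show ?case by simp
next
  case (Suc k)
  let ?f = "\<lambda>(x, y). x @ y"
  have "inj_on ?f (return_words v n \<times> return_words v (n * k))"
    by (auto simp: inj_on_def return_words_def)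
  moreover have "?f ` (return_words v n \<times> return_words v (n * k)) \<subseteq> return_words v (n * Suc k)"
    by (auto simp: return_words_def reach_append)
  ultimately have "card (return_words v n \<times> return_words v (n * k)) \<le> card (return_words v (n * Suc k))"
    using finite_return_words card_inj_on_le by blast
  moreover have "card (return_words v n) ^ Suc k \<le> card (return_words v n) * card (return_words v (n * k))"
    using Suc by simp
  ultimately show ?case unfolding card_cartesian_product by (rule order_trans[rotated])
qed

lemma reach_itinerary:
  assumes "x \<in> J" "\<And>k. k < length w \<Longrightarrow> (g ^^ Suc k) x \<in> cell (w ! k)"
  shows "(g ^^ length w) x \<in> reach J w"
  using assms
proof (induction w arbitrary: x J)
  case (Cons b w)
  have "g x \<in> g ` J \<inter> cell b" using Cons.prems(1) Cons.prems(2)[of 0] by auto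
  moreover have "(g ^^ Suc k) (g x) \<in> cell (w ! k)" if "k < length w" for k
    using Cons.prems(2)[of "Suc k"] that by (simp add: funpow_swap1)
  ultimately have "(g ^^ length w) (g x) \<in> reach (g ` J \<inter> cell b) w" by (rule Cons.IH)
  then show ?case by (simp add: funpow_swap1)
qed auto

text \<open>
  Pulling back the segments from the last letter to the first shows that any two end points are the
  values at the two ends of a single segment, all of whose points follow the word.
\<close>

lemma reach_segment_lift:
  assumes "segment J" "set w \<subseteq> {..<M}" "y \<in> reach J w" "z \<in> reach J w"
  shows "\<exists>p q. closed_segment p q \<subseteq> J \<and> (g ^^ length w) p = y \<and> (g ^^ length w) q = z \<and>
    (\<forall>x\<in>closed_segment p q. \<forall>k<length w. (g ^^ Suc k) x \<in> cell (w ! k))"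
  using assms
proof (induction w arbitrary: J y z)
  case Nil
  then have "convex J" unfolding segment_def by auto
  then show ?case using Nil by (intro exI[of _ y] exI[of _ z]) (auto simp: closed_segment_subset)
next
  case (Cons b w)
  let ?J = "g ` J \<inter> cell b"
  have "?J \<noteq> {}" using Cons.prems by auto
  then have "segment ?J" using Cons.prems segment_step[of J b] by auto
  then obtain p q where pq: "closed_segment p q \<subseteq> ?J" "(g ^^ length w) p = y" "(g ^^ length w) q = z"
    "\<forall>x\<in>closed_segment p q. \<forall>k<length w. (g ^^ Suc k) x \<in> cell (w ! k)"
    using Cons.IH[of ?J y z] Cons.prems by auto
  then have "p \<in> g ` J" "q \<in> g ` J" by auto
  then obtain p' q' where pq': "p' \<in> J" "q' \<in> J" "p = g p'" "q = g q'" by auto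
  have J: "J \<subseteq> {0..1}" "convex J" using Cons.prems(1) unfolding segment_def by auto
  then have "continuous_on J g" using cont by (auto intro: continuous_on_subset)
  then obtain a c where ac: "closed_segment a c \<subseteq> J" "g a = p" "g c = q"
    "g ` closed_segment a c \<subseteq> closed_segment p q"
    using pull_back_segment[OF _ J(2) pq'(1,2)] pq' by metis
  have "(g ^^ Suc k) x \<in> cell ((b # w) ! k)" if x: "x \<in> closed_segment a c" and "k < length (b # w)" for x k
  proof (cases k)
    case 0
    have "g x \<in> ?J" using x ac(4) pq(1) by blast
    then show ?thesis using 0 by simp
  next
    case (Suc j)
    have "g x \<in> closed_segment p q" using x ac(4) by blast
    then have "(g ^^ Suc j) (g x) \<in> cell (w ! j)" using pq(4) that Suc by auto
    then show ?thesis using Suc by (simp add: funpow_swap1)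
  qed
  then show ?case using ac pq by (intro exI[of _ a] exI[of _ c]) (auto simp: funpow_swap1)
qed

lemma cell_Int: "b \<noteq> c \<Longrightarrow> x \<in> cell b \<inter> cell c \<Longrightarrow> x = real (max b c) / real M"
  unfolding cell_def using M_pos
  by (cases b c rule: linorder_cases) (auto simp: field_simps)

text \<open>
  The minimal intervals in the cell \<open>v\<close> that the \<open>n\<close>-th iterate stretches over the whole cell. By
  minimality two of them are equal or have disjoint interiors, since the end points are the only
  points of such an interval that are mapped to end points of the cell.
\<close>

definition crossings :: "nat \<Rightarrow> nat \<Rightarrow> (real \<times> real) set" where
  "crossings v n = {(p, q). p < q \<and> p \<in> cell v \<and> q \<in> cell v \<and>
     {(g ^^ n) p, (g ^^ n) q} = {real v / real M, (real v + 1) / real M} \<and>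
     (\<forall>t. p < t \<longrightarrow> t < q \<longrightarrow> (g ^^ n) t \<notin> {real v / real M, (real v + 1) / real M})}"

lemma crossings_disjoint:
  assumes "(p, q) \<in> crossings v n" "(p', q') \<in> crossings v n" "(p, q) \<noteq> (p', q')"
  shows "q \<le> p' \<or> q' \<le> p"
proof (rule ccontr)
  assume "\<not> (q \<le> p' \<or> q' \<le> p)"
  then have *: "p' < q" "p < q'" by auto
  have ends: "(g ^^ n) t \<in> {real v / real M, (real v + 1) / real M}" if "t \<in> {p, q, p', q'}" for t
    using assms(1,2) that unfolding crossings_def by auto
  have inner: "\<forall>t. p < t \<longrightarrow> t < q \<longrightarrow> (g ^^ n) t \<notin> {real v / real M, (real v + 1) / real M}"
    "\<forall>t. p' < t \<longrightarrow> t < q' \<longrightarrow> (g ^^ n) t \<notin> {real v / real M, (real v + 1) / real M}"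
    and "p < q" "p' < q'"
    using assms(1,2) unfolding crossings_def mem_Collect_eq prod.case by - (elim conjE, assumption)+
  have "\<not> (p < t \<and> t < q)" "\<not> (p' < t \<and> t < q')" if "t \<in> {p, q, p', q'}" for t
    using inner ends[OF that] by blast+
  from this[of p] this[of q] this[of p'] this[of q'] show False
    using * \<open>p < q\<close> \<open>p' < q'\<close> assms(3) by auto
qed

lemma return_word_crossing:
  assumes "v < M" "w \<in> return_words v n"
  shows "\<exists>p q. (p, q) \<in> crossings v n \<and> (\<forall>x\<in>{p..q}. \<forall>k<n. (g ^^ Suc k) x \<in> cell (w ! k))"
proof -
  let ?\<alpha> = "real v / real M" and ?\<beta> = "(real v + 1) / real M"
  let ?G = "g ^^ n"
  have lt: "?\<alpha> < ?\<beta>" 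
    using M_pos by (intro divide_strict_right_mono) auto
  have w: "length w = n" "set w \<subseteq> {..<M}" "reach (cell v) w = cell v"
    using assms(2) unfolding return_words_def by auto
  have ends: "?\<alpha> \<in> cell v" "?\<beta> \<in> cell v" unfolding cell_def using lt by auto
  obtain p q where pq: "closed_segment p q \<subseteq> cell v" "?G p = ?\<alpha>" "?G q = ?\<beta>"
    "\<forall>x\<in>closed_segment p q. \<forall>k<n. (g ^^ Suc k) x \<in> cell (w ! k)"
    using reach_segment_lift[OF segment_cell[OF assms(1)] w(2), of ?\<alpha> ?\<beta>] w ends by auto
  define x y where "x = min p q" and "y = max p q"
  have xy: "closed_segment p q = {x..y}" "x \<le> y" "?G x \<noteq> ?G y" "{?G x, ?G y} = {?\<alpha>, ?\<beta>}"
    using pq(2,3) lt M_pos unfolding x_def y_def by (auto simp: closed_segment_eq_real_ivl min_def max_def)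
  have "{x..y} \<subseteq> {0..1}"
    using pq(1) segment_cell[OF assms(1)] unfolding xy(1) segment_def by auto
  then have "continuous_on {x..y} ?G"
    using continuous_on_funpow[OF cont maps] by (rule continuous_on_subset[rotated])
  then obtain p' q' where pq': "x \<le> p'" "p' < q'" "q' \<le> y" "?G p' = ?G x" "?G q' = ?G y"
    "\<And>t. p' < t \<Longrightarrow> t < q' \<Longrightarrow> ?G t \<noteq> ?G x \<and> ?G t \<noteq> ?G y"
    using minimal_crossing[OF _ xy(2) refl refl xy(3)] by metis
  have "?G t \<notin> {?\<alpha>, ?\<beta>}" if "p' < t" "t < q'" for t
    using pq'(6)[OF that] unfolding xy(4)[symmetric] by auto
  moreover have "p' \<in> cell v" "q' \<in> cell v" using pq(1) pq' unfolding xy(1) by auto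
  ultimately have "(p', q') \<in> crossings v n"
    using pq' xy(4) unfolding crossings_def by auto
  moreover have "\<forall>x\<in>{p'..q'}. \<forall>k<n. (g ^^ Suc k) x \<in> cell (w ! k)"
    using pq(4) pq' unfolding xy(1) by auto
  ultimately show ?thesis by blast
qed

text \<open>
  Two different words prescribe, at some time, two different cells, which have at most one point in
  common. An interval that follows both words would therefore be mapped to a single point from that
  time on, and could not be a crossing.
\<close>

lemma crossings_of_return_words:
  assumes "v < M"
  obtains K where "finite K" "K \<subseteq> crossings v n" "card K = card (return_words v n)"
proof -
  have "\<forall>w\<in>return_words v n. \<exists>P. P \<in> crossings v n \<and>
      (\<forall>x\<in>{fst P..snd P}. \<forall>k<n. (g ^^ Suc k) x \<in> cell (w ! k))"
    using return_word_crossing[OF assms] by fastforce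
  then obtain P where P: "\<And>w. w \<in> return_words v n \<Longrightarrow> P w \<in> crossings v n \<and>
      (\<forall>x\<in>{fst (P w)..snd (P w)}. \<forall>k<n. (g ^^ Suc k) x \<in> cell (w ! k))"
    by (elim bchoice[THEN exE]) blast
  have "inj_on P (return_words v n)"
  proof (rule inj_onI, rule ccontr)
    fix w w' assume w: "w \<in> return_words v n" "w' \<in> return_words v n" "P w = P w'" "w \<noteq> w'"
    obtain p q where pq: "P w = (p, q)" by fastforce
    have cr: "(p, q) \<in> crossings v n" using P[OF w(1)] pq by simp
    have "length w = n" "length w' = n" using w unfolding return_words_def by auto
    then obtain k where k: "k < n" "w ! k \<noteq> w' ! k" using w(4) nth_equalityI by metis
    have "\<forall>x\<in>{p..q}. (g ^^ Suc k) x \<in> cell (w ! k)" "\<forall>x\<in>{p..q}. (g ^^ Suc k) x \<in> cell (w' ! k)"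
      using P[OF w(1)] P[OF w(2)] k(1) unfolding w(3)[symmetric] pq fst_conv snd_conv by blast+
    then have "(g ^^ Suc k) x = real (max (w ! k) (w' ! k)) / real M" if "x \<in> {p..q}" for x
      using k(2) that by (intro cell_Int) auto
    then have "(g ^^ Suc k) p = (g ^^ Suc k) q" using cr unfolding crossings_def by auto
    then have "(g ^^ (n - Suc k)) ((g ^^ Suc k) p) = (g ^^ (n - Suc k)) ((g ^^ Suc k) q)" by simp
    moreover have "(g ^^ (n - Suc k)) ((g ^^ Suc k) x) = (g ^^ n) x" for x
      using k by (metis Suc_leI comp_apply funpow_add le_add_diff_inverse2)
    ultimately have "(g ^^ n) p = (g ^^ n) q" by simp
    moreover have "real v / real M \<noteq> (real v + 1) / real M" using M_pos by simp
    ultimately show False using cr unfolding crossings_def by (auto simp: doubleton_eq_iff)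
  qed
  then show ?thesis
    using that[of "P ` return_words v n"] P finite_return_words by (auto simp: card_image)
qed


text \<open>
  A crossing may begin at an end point of the cell, where there is no room for strict inequalities.
  The first and the last crossing are therefore given up: \<open>u\<close> and \<open>v'\<close> are chosen inside them, and
  the end points of the other crossings are moved inwards to nearby rationals.
\<close>

lemma horseshoe_of_crossings:
  assumes "v < M" "finite K" "K \<subseteq> crossings v n" "card K = s + 2" "s \<ge> 1"
  shows "horseshoe g n s"
proof -
  let ?\<alpha> = "real v / real M" and ?\<beta> = "(real v + 1) / real M"
  define G where "G = g ^^ n"
  have cr: "p < q" "?\<alpha> \<le> p" "q \<le> ?\<beta>" "{G p, G q} = {?\<alpha>, ?\<beta>}" if "(p, q) \<in> K" for p q
    using that assms(3) unfolding crossings_def cell_def G_def by auto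
  have disj: "q \<le> p' \<or> q' \<le> p" if "(p, q) \<in> K" "(p', q') \<in> K" "(p, q) \<noteq> (p', q')" for p q p' q'
    using crossings_disjoint[of p q v n p' q'] that assms(3) by auto
  have inj: "inj_on fst K"
  proof (rule inj_onI)
    fix x y assume xy: "x \<in> K" "y \<in> K" "fst x = fst y"
    obtain p q p' q' where "x = (p, q)" "y = (p', q')" by fastforce
    then show "x = y" using xy disj[of p q p' q'] cr(1)[of p q] cr(1)[of p' q'] by auto
  qed
  define L where "L = sorted_list_of_set (fst ` K)"
  have L: "length L = s + 2" "set L = fst ` K" "sorted_wrt (<) L"
    unfolding L_def using assms(2,4) inj by (auto simp: card_image)
  have "\<forall>i<s + 2. \<exists>q. (L ! i, q) \<in> K"
  proof (intro allI impI)
    fix i assume "i < s + 2"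
    then have "L ! i \<in> fst ` K" using L by (metis nth_mem)
    then show "\<exists>q. (L ! i, q) \<in> K" by auto
  qed
  then obtain Q where Q: "\<And>i. i < s + 2 \<Longrightarrow> (L ! i, Q i) \<in> K" by metis
  define P where "P i = L ! i" for i
  have PQ: "P i < Q i" "?\<alpha> \<le> P i" "Q i \<le> ?\<beta>" "{G (P i), G (Q i)} = {?\<alpha>, ?\<beta>}" if "i < s + 2" for i
    using cr[OF Q[OF that]] unfolding P_def by auto
  have sep: "Q i \<le> P j" if "i < j" "j < s + 2" for i j
  proof -
    have "P i < P j" unfolding P_def using L(1,3) that by (auto simp: sorted_wrt_iff_nth_less)
    then show ?thesis using disj[OF Q Q, of i j] that PQ(1)[of j] PQ(1)[of i] unfolding P_def by auto
  qed
  obtain u where u: "?\<alpha> < of_rat u" "of_rat u < Q 0"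
    using of_rat_dense[of ?\<alpha> "Q 0"] PQ(1,2)[of 0] by auto
  obtain v' where v': "P (s + 1) < of_rat v'" "of_rat v' < ?\<beta>"
    using of_rat_dense[of "P (s + 1)" ?\<beta>] PQ(1,3)[of "s + 1"] by auto
  have cell01: "0 \<le> ?\<alpha>" "?\<beta> \<le> 1" using assms(1) by (auto simp: divide_simps)
  have uv: "of_rat u \<le> P (Suc i)" "Q (Suc i) \<le> of_rat v'" if "i < s" for i
    using sep[of 0 "Suc i"] sep[of "Suc i" "s + 1"] u(2) v'(1) that by auto
  have "\<exists>a b. P (Suc i) < of_rat a \<and> a < b \<and> of_rat b < Q (Suc i) \<and>
      (G (of_rat a) < of_rat u \<and> of_rat v' < G (of_rat b) \<or> of_rat v' < G (of_rat a) \<and> G (of_rat b) < of_rat u)"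
    if i: "i < s" for i
  proof -
    let ?p = "P (Suc i)" and ?q = "Q (Suc i)"
    have pq: "?p < ?q" "?\<alpha> \<le> ?p" "?q \<le> ?\<beta>" "{G ?p, G ?q} = {?\<alpha>, ?\<beta>}" using PQ[of "Suc i"] i by auto
    have p01: "0 \<le> ?p" "?q \<le> 1" using pq(2,3) cell01 by linarith+
    have "continuous_on {0..1} G" unfolding G_def using cont maps by (rule continuous_on_funpow)
    then have contG: "continuous_on {?p..?q} G"
      by (rule continuous_on_subset) (use p01 in auto)
    \<comment> \<open>Staying in different halves of the crossing keeps the two new end points in order.\<close>
    have near: "\<exists>r::rat. ?p < of_rat r \<and> of_rat r < (?p + ?q) / 2 \<and> G (of_rat r) \<in> S"
      "\<exists>r::rat. (?p + ?q) / 2 < of_rat r \<and> of_rat r < ?q \<and> G (of_rat r) \<in> T"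
      if ST: "open S" "open T" "G ?p \<in> S" "G ?q \<in> T" for S T
    proof -
      obtain e where e: "e > 0" "\<And>x. x \<in> {?p..?q} \<Longrightarrow> \<bar>x - ?p\<bar> < e \<Longrightarrow> G x \<in> S"
        using continuous_on_near[OF contG _ ST(1,3)] pq(1) by auto
      obtain r :: rat where "?p < of_rat r" "of_rat r < min ((?p + ?q) / 2) (?p + e)"
        using of_rat_dense[of ?p "min ((?p + ?q) / 2) (?p + e)"] e(1) pq(1) by auto
      then show "\<exists>r::rat. ?p < of_rat r \<and> of_rat r < (?p + ?q) / 2 \<and> G (of_rat r) \<in> S"
        using e(2)[of "of_rat r"] pq(1) by (intro exI[of _ r]) auto
      obtain d where d: "d > 0" "\<And>x. x \<in> {?p..?q} \<Longrightarrow> \<bar>x - ?q\<bar> < d \<Longrightarrow> G x \<in> T"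
        using continuous_on_near[OF contG _ ST(2,4)] pq(1) by auto
      obtain r :: rat where "max ((?p + ?q) / 2) (?q - d) < of_rat r" "of_rat r < ?q"
        using of_rat_dense[of "max ((?p + ?q) / 2) (?q - d)" ?q] d(1) pq(1) by auto
      then show "\<exists>r::rat. (?p + ?q) / 2 < of_rat r \<and> of_rat r < ?q \<and> G (of_rat r) \<in> T"
        using d(2)[of "of_rat r"] pq(1) by (intro exI[of _ r]) auto
    qed
    have "G ?p = ?\<alpha> \<and> G ?q = ?\<beta> \<or> G ?p = ?\<beta> \<and> G ?q = ?\<alpha>" using pq(4) by (auto simp: doubleton_eq_iff)
    then show ?thesis
    proof
      assume "G ?p = ?\<alpha> \<and> G ?q = ?\<beta>"
      then obtain a b :: rat where "?p < of_rat a" "of_rat a < (?p + ?q) / 2" "G (of_rat a) < of_rat u"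
        "(?p + ?q) / 2 < of_rat b" "of_rat b < ?q" "of_rat v' < G (of_rat b)"
        using near[of "{..<of_rat u}" "{of_rat v'<..}"] u v' by auto
      moreover then have "a < b" by (metis less_trans of_rat_less)
      ultimately show ?thesis by blast
    next
      assume "G ?p = ?\<beta> \<and> G ?q = ?\<alpha>"
      then obtain a b :: rat where "?p < of_rat a" "of_rat a < (?p + ?q) / 2" "of_rat v' < G (of_rat a)"
        "(?p + ?q) / 2 < of_rat b" "of_rat b < ?q" "G (of_rat b) < of_rat u"
        using near[of "{of_rat v'<..}" "{..<of_rat u}"] u v' by auto
      moreover then have "a < b" by (metis less_trans of_rat_less)
      ultimately show ?thesis by blast
    qed
  qed
  then obtain a b :: "nat \<Rightarrow> rat" where ab: "\<And>i. i < s \<Longrightarrow>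
     P (Suc i) < of_rat (a i) \<and> a i < b i \<and> of_rat (b i) < Q (Suc i) \<and>
      (G (of_rat (a i)) < of_rat u \<and> of_rat v' < G (of_rat (b i)) \<or>
       of_rat v' < G (of_rat (a i)) \<and> G (of_rat (b i)) < of_rat u)"
    by metis
  have bounds: "0 \<le> a i" "u \<le> a i" "b i \<le> v'" "b i \<le> 1" if "i < s" for i
  proof -
    have "(0::real) \<le> of_rat (a i)" "of_rat u \<le> (of_rat (a i) :: real)"
      "(of_rat (b i) :: real) \<le> of_rat v'" "(of_rat (b i) :: real) \<le> 1"
      using ab[OF that] uv[OF that] PQ(2,3)[of "Suc i"] cell01 that by linarith+
    then show "0 \<le> a i" "u \<le> a i" "b i \<le> v'" "b i \<le> 1"
      by (auto simp: of_rat_less_eq)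
  qed
  define z where "z i = (if even i then a (i div 2) else b (i div 2))" for i
  have "0 \<le> z i \<and> z i \<le> 1 \<and> u \<le> z i \<and> z i \<le> v'" if "i < 2 * s" for i
  proof -
    have j: "i div 2 < s" using that by simp
    have "a (i div 2) < b (i div 2)" using ab[OF j] by blast
    then show ?thesis using bounds[OF j] unfolding z_def by auto
  qed
  moreover have "z i < z (Suc i)" if i: "i < 2 * s - 1" for i
  proof (cases "even i")
    case True
    then have "z i = a (i div 2)" "z (Suc i) = b (i div 2)" unfolding z_def by auto
    then show ?thesis using ab[of "i div 2"] i by auto
  next
    case False
    then obtain j where j: "i = 2 * j + 1" by (elim oddE)
    then have "z i = b j" "z (Suc i) = a (Suc j)" unfolding z_def by auto
    moreover have "of_rat (b j) < (of_rat (a (Suc j)) :: real)"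
    proof -
      have js: "j < s" "Suc j < s" using i j by auto
      then have "Q (Suc j) \<le> P (Suc (Suc j))" by (intro sep) auto
      then show ?thesis using ab[OF js(1)] ab[OF js(2)] by linarith
    qed
    ultimately show ?thesis by (simp add: of_rat_less)
  qed
  moreover have "G (of_rat (z (2 * i))) < of_rat u \<and> of_rat v' < G (of_rat (z (2 * i + 1))) \<or>
      of_rat v' < G (of_rat (z (2 * i))) \<and> G (of_rat (z (2 * i + 1))) < of_rat u" if "i < s" for i
    using ab[OF that] unfolding z_def by auto
  ultimately show ?thesis unfolding horseshoe_def G_def by blast
qed

lemma in_some_cell: "y \<in> {0..1} \<Longrightarrow> \<exists>b<M. y \<in> cell b"
proof (cases "y = 1")
  case True
  then show ?thesis using M_pos unfolding cell_def by (intro exI[of _ "M - 1"]) (auto simp: of_nat_diff field_simps)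
next
  case False
  assume "y \<in> {0..1}"
  with False have y: "0 \<le> y" "y < 1" by auto
  have "y * real M < real M" using y M_pos by simp
  then have "nat \<lfloor>y * real M\<rfloor> < M" using y by (simp add: nat_less_iff floor_less_iff)
  moreover have "y \<in> cell (nat \<lfloor>y * real M\<rfloor>)"
    unfolding cell_def using y M_pos by (auto simp: field_simps) linarith+
  ultimately show ?thesis by blast
qed

text \<open>
  Each cell determines elements of the cover for the \<open>l\<close> steps of one application of \<open>g\<close>, so a word
  of cells determines an element of the join.
\<close>

lemma min_subcover_card_words:
  assumes g: "g = f ^^ l" and l: "l \<ge> 1" and f: "f \<in> {0..1} \<rightarrow> {0..1}"
    and fine: "\<And>b. b < M \<Longrightarrow> \<exists>V\<in>iterated_join {0..1} f \<U> l. cell b \<subseteq> V"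
  shows "min_subcover_card {0..1} f \<U> (Suc n * l) \<le> (\<Sum>a<M. card (admissible (cell a) n))"
proof -
  have "\<exists>U. (\<forall>m<l. U m \<in> \<U>) \<and> (\<forall>x\<in>cell b. \<forall>m<l. (f ^^ m) x \<in> U m)" if "b < M" for b
    using fine[OF that] unfolding iterated_join_def by fastforce
  then obtain U where U: "\<And>b m. b < M \<Longrightarrow> m < l \<Longrightarrow> U b m \<in> \<U>"
    "\<And>b m x. b < M \<Longrightarrow> m < l \<Longrightarrow> x \<in> cell b \<Longrightarrow> (f ^^ m) x \<in> U b m" by metis
  obtain lab where lab: "\<And>y. y \<in> {0..1} \<Longrightarrow> lab y < M \<and> y \<in> cell (lab y)"
    using in_some_cell by metis
  define I where "I = (SIGMA a:{..<M}. admissible (cell a) n)"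
  define P where "P = (\<lambda>(a, w). {x \<in> {0..1}. \<forall>k\<le>n. (g ^^ k) x \<in> cell ((a # w) ! k)})"
  have "min_subcover_card {0..1} f \<U> (Suc n * l) \<le> card I"
  proof (rule min_subcover_card_le[where P = P])
    show "finite I" unfolding I_def by (intro finite_SigmaI finite_admissible) auto
    show "{0..1} \<subseteq> (\<Union>i\<in>I. P i)"
    proof
      fix x :: real assume x: "x \<in> {0..1}"
      have gx: "(g ^^ k) x \<in> {0..1}" for k using maps x by (rule funpow_in)
      define w where "w = map (\<lambda>k. lab ((g ^^ Suc k) x)) [0..<n]"
      have w: "length w = n" "set w \<subseteq> {..<M}" "\<And>k. k < n \<Longrightarrow> (g ^^ Suc k) x \<in> cell (w ! k)"
        unfolding w_def using lab[OF gx[of "Suc _"]] by auto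
      have a: "lab x < M" "x \<in> cell (lab x)" using lab[OF x] by auto
      have "(g ^^ length w) x \<in> reach (cell (lab x)) w" using a w by (intro reach_itinerary) auto
      then have "(lab x, w) \<in> I" using a w unfolding I_def admissible_def by auto
      moreover have "x \<in> P (lab x, w)"
        unfolding P_def using x a w(3) by (auto simp: less_Suc_eq_0_disj nth_Cons split: nat.split)
      ultimately show "x \<in> (\<Union>i\<in>I. P i)" by blast
    qed
    fix i assume "i \<in> I"
    then obtain a w where aw: "i = (a, w)" "a < M" "length w = n" "set w \<subseteq> {..<M}"
      unfolding I_def admissible_def by auto
    let ?U = "\<lambda>m. U ((a # w) ! (m div l)) (m mod l)"
    have lt: "(a # w) ! (m div l) < M" "m div l \<le> n" "m mod l < l" if "m < Suc n * l" for m
    proof -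
      have "m div l < Suc n" using that l by (simp add: less_mult_imp_div_less)
      then show "m div l \<le> n" by simp
      have "(a # w) ! (m div l) \<in> set (a # w)" using \<open>m div l < Suc n\<close> aw by (intro nth_mem) auto
      then show "(a # w) ! (m div l) < M" using aw by auto
      show "m mod l < l" using l by simp
    qed
    have "{x \<in> {0..1}. \<forall>m<Suc n * l. (f ^^ m) x \<in> ?U m} \<in> iterated_join {0..1} f \<U> (Suc n * l)"
      unfolding iterated_join_def
    proof (intro CollectI exI[of _ ?U] conjI refl)
      show "\<forall>m<Suc n * l. ?U m \<in> \<U>" using lt U(1) by auto
    qed
    moreover have "P i \<subseteq> {x \<in> {0..1}. \<forall>m<Suc n * l. (f ^^ m) x \<in> ?U m}"
    proof
      fix x assume x: "x \<in> P i"
      have "(f ^^ m) x \<in> ?U m" if m: "m < Suc n * l" for m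
      proof -
        have "(f ^^ m) x = (f ^^ (m mod l)) ((g ^^ (m div l)) x)"
          unfolding g funpow_mult by (metis comp_apply funpow_add mod_mult_div_eq)
        moreover have "(g ^^ (m div l)) x \<in> cell ((a # w) ! (m div l))"
          using x lt[OF m] unfolding P_def aw by auto
        ultimately show ?thesis using U(2) lt[OF m] by metis
      qed
      then show "x \<in> {x \<in> {0..1}. \<forall>m<Suc n * l. (f ^^ m) x \<in> ?U m}"
        using x unfolding P_def aw by auto
    qed
    ultimately show "\<exists>V\<in>iterated_join {0..1} f \<U> (Suc n * l). P i \<subseteq> V" by blast
  qed
  also have "card I = (\<Sum>a<M. card (admissible (cell a) n))"
    unfolding I_def by (intro card_SigmaI) (auto intro: finite_admissible)
  finally show ?thesis .
qed

end


lemma exponential_beats_power: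
  fixes d K :: real
  assumes "d > 0"
  shows "\<exists>n. K * (real n + 1) ^ p < 2 powr (d * real n)"
proof (cases "K > 0")
  case False
  then have "K * (real 0 + 1) ^ p < 2 powr (d * real 0)" by simp
  then show ?thesis by blast
next
  case K: True
  define a where "a = d * ln 2"
  have a: "a > 0" unfolding a_def using assms by simp
  define \<epsilon> where "\<epsilon> = a ^ p / (K * exp a)"
  have "\<epsilon> > 0" unfolding \<epsilon>_def using a K by simp
  moreover have "((\<lambda>x::real. x ^ p / exp x) \<longlongrightarrow> 0) at_top" by (rule tendsto_power_div_exp_0)
  ultimately have "eventually (\<lambda>x::real. x ^ p / exp x < \<epsilon>) at_top"
    by (intro order_tendstoD) auto
  then obtain x0 where x0: "\<And>x. x \<ge> x0 \<Longrightarrow> x ^ p / exp x < \<epsilon>"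
    unfolding eventually_at_top_linorder by blast
  obtain n :: nat where "real n \<ge> x0 / a" using real_arch_simple by blast
  then have "a * (real n + 1) \<ge> x0" using a by (simp add: field_simps)
  then have "(a * (real n + 1)) ^ p / exp (a * (real n + 1)) < \<epsilon>" by (rule x0)
  then have "(a * (real n + 1)) ^ p < \<epsilon> * exp (a * (real n + 1))"
    by (simp add: divide_less_eq)
  also have "\<epsilon> * exp (a * (real n + 1)) = a ^ p / K * exp (a * real n)"
    unfolding \<epsilon>_def by (simp add: distrib_left exp_add)
  also have "exp (a * real n) = 2 powr (d * real n)"
    unfolding a_def powr_def by (simp add: mult_ac)
  finally have "a ^ p * (real n + 1) ^ p < a ^ p / K * 2 powr (d * real n)"
    by (simp add: power_mult_distrib)
  then have "a ^ p * (K * (real n + 1) ^ p) < a ^ p * 2 powr (d * real n)"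
    using K by (simp add: field_simps)
  then have "K * (real n + 1) ^ p < 2 powr (d * real n)"
    using a by (simp add: mult_less_cancel_left_pos)
  then show ?thesis by blast
qed

text \<open>
  Passing to high powers compensates the loss of two branches in \<open>horseshoe_of_crossings\<close>.
\<close>

lemma power_gap:
  fixes s r :: real
  assumes "1 \<le> r" "r < s"
  shows "\<exists>k\<ge>1. r ^ k + 2 \<le> s ^ k"
proof -
  have step: "r ^ k + real k * (s - r) \<le> s ^ k" for k
  proof (induction k)
    case (Suc k)
    have "r ^ Suc k + real (Suc k) * (s - r) \<le> r * r ^ k + (s - r) * r ^ k + real k * (s - r)"
    proof -
      have "(s - r) * 1 \<le> (s - r) * r ^ k"
        using assms one_le_power[OF assms(1), of k] by (intro mult_left_mono) auto
      then show ?thesis by (simp add: distrib_right)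
    qed
    also have "\<dots> \<le> s * r ^ k + s * (real k * (s - r))"
    proof -
      have "1 * (real k * (s - r)) \<le> s * (real k * (s - r))" using assms by (intro mult_right_mono) auto
      then show ?thesis by (simp add: algebra_simps)
    qed
    also have "\<dots> = s * (r ^ k + real k * (s - r))" by (simp add: algebra_simps)
    also have "\<dots> \<le> s * s ^ k" using Suc assms by (intro mult_left_mono) auto
    finally show ?case by simp
  qed simp
  obtain k :: nat where k: "real k \<ge> 2 / (s - r)" using real_arch_simple by blast
  have "2 / (s - r) > 0" using assms by simp
  then have "k \<ge> 1" using k by (cases k) auto
  moreover have "2 \<le> real k * (s - r)" using k assms by (simp add: field_simps)
  ultimately show ?thesis using step[of k] by (intro exI[of _ k]) auto
qed

theorem horseshoe_exists:
  fixes f :: "real \<Rightarrow> real"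
  assumes cont: "continuous_on {0..1} f" and maps: "f \<in> {0..1} \<rightarrow> {0..1}"
    and cover: "finite_open_cover {0..1} \<U>" and c: "0 \<le> c" "ereal c < cover_entropy {0..1} f \<U>"
  obtains N s where "N \<ge> 1" "s \<ge> 1" "horseshoe f N s" "2 powr (c * real N) \<le> real s"
proof -
  let ?X = "{0..1::real}"
  obtain h where h: "c < h" "ereal h < cover_entropy ?X f \<U>"
    using ereal_dense2[OF c(2)] by auto
  have lower: "2 powr (h * real n) \<le> real (min_subcover_card ?X f \<U> n)" if n: "n \<ge> 1" for n
  proof -
    have "min_subcover_card ?X f \<U> n \<ge> 1" by (intro min_subcover_card_pos maps cover) auto
    moreover have "cover_entropy ?X f \<U> \<le> ereal (log 2 (real (min_subcover_card ?X f \<U> n)) / real n)"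
      unfolding cover_entropy_def using n by (intro INF_lower) auto
    then have "ereal h \<le> ereal (log 2 (real (min_subcover_card ?X f \<U> n)) / real n)"
      using h(2) by (meson less_imp_le order_trans)
    then have "h * real n \<le> log 2 (real (min_subcover_card ?X f \<U> n))" using n by (simp add: field_simps)
    ultimately show ?thesis by (simp add: le_log_iff)
  qed
  \<comment> \<open>With this choice the words of $f^l$ grow faster than $2^n$, the bound for words that never fill a cell.\<close>
  obtain l0 :: nat where "1 < real l0 * h" using c h ex_less_of_nat_mult[of h 1] by auto
  moreover from this have "l0 \<ge> 1" by (cases l0) auto
  ultimately obtain l :: nat where l: "l \<ge> 1" "1 < real l * h" by blast
  define \<theta> where "\<theta> = max 1 (real l * c)"
  have \<theta>: "\<theta> \<ge> 1" "\<theta> < real l * h" "real l * c \<le> \<theta>" unfolding \<theta>_def using l h by auto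
  define g where "g = f ^^ l"
  have g: "continuous_on ?X g" "g \<in> ?X \<rightarrow> ?X"
    unfolding g_def using continuous_on_funpow[OF cont maps] funpow_in[OF maps] by auto
  have "?X \<noteq> {}" "finite_open_cover ?X (iterated_join ?X f \<U> l)"
    using finite_open_cover_iterated_join[OF cont maps cover] by auto
  then obtain \<delta> where \<delta>: "\<delta> > 0"
    "\<And>T. T \<subseteq> ?X \<Longrightarrow> diameter T < \<delta> \<Longrightarrow> \<exists>V\<in>iterated_join ?X f \<U> l. T \<subseteq> V"
    by (rule finite_open_cover_Lebesgue[OF compact_Icc]) (rule that)
  obtain M0 :: nat where M0: "1 / \<delta> < real M0" using reals_Archimedean2 by blast
  define M where "M = Suc M0"
  have M: "M > 0" "1 / real M < \<delta>"
    unfolding M_def using M0 \<delta>(1) by (auto simp: field_simps)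
  interpret interval_coding g M using M g by unfold_locales auto
  have fine: "\<exists>V\<in>iterated_join ?X f \<U> l. cell b \<subseteq> V" if b: "b < M" for b
  proof -
    have sub: "cell b \<subseteq> ?X" using segment_cell[OF b] unfolding segment_def by auto
    have "diameter (cell b) = 1 / real M"
      unfolding cell_def using M(1) by (subst diameter_closed_interval) (auto simp: field_simps)
    then have "diameter (cell b) < \<delta>" using M(2) by simp
    then show ?thesis by (rule \<delta>(2)[OF sub])
  qed
  have "\<exists>v n. v < M \<and> 2 powr (\<theta> * real n) < real (card (return_words v n))"
  proof (rule ccontr)
    assume "\<not> ?thesis"
    then have "real (card (return_words v n)) \<le> 2 powr (\<theta> * real n)" if "v < M" for v n
      using that by (meson not_le)
    then obtain C p where C: "C \<ge> 0" "\<And>J n. segment J \<Longrightarrow>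
        real (card (admissible J n)) \<le> C * (real n + 1) ^ p * 2 powr (\<theta> * real n)"
      using card_admissible[OF \<theta>(1)] by metis
    obtain n where n: "real M * C * (real n + 1) ^ p < 2 powr ((real l * h - \<theta>) * real n)"
      using exponential_beats_power[of "real l * h - \<theta>" "real M * C" p] \<theta>(2) by auto
    have "2 powr (real l * h * real n) \<le> 2 powr (h * real (Suc n * l))"
      using c(1) h(1) by (simp add: algebra_simps)
    also have "\<dots> \<le> real (min_subcover_card ?X f \<U> (Suc n * l))" using l by (intro lower) auto
    also have "\<dots> \<le> real (\<Sum>a<M. card (admissible (cell a) n))"
      using min_subcover_card_words[OF g_def l(1) assms(2) fine] by (simp only: of_nat_le_iff)
    also have "\<dots> = (\<Sum>a<M. real (card (admissible (cell a) n)))" by simp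
    also have "\<dots> \<le> (\<Sum>a<M. C * (real n + 1) ^ p * 2 powr (\<theta> * real n))"
      by (intro sum_mono C segment_cell) auto
    also have "\<dots> = (real M * C * (real n + 1) ^ p) * 2 powr (\<theta> * real n)" by simp
    also have "\<dots> < 2 powr ((real l * h - \<theta>) * real n) * 2 powr (\<theta> * real n)"
      using n by (intro mult_strict_right_mono) auto
    also have "\<dots> = 2 powr (real l * h * real n)" by (simp add: powr_add[symmetric] algebra_simps)
    finally show False by simp
  qed
  then obtain v n where v: "v < M" and n: "2 powr (\<theta> * real n) < real (card (return_words v n))" by blast
  have "n \<noteq> 0"
  proof
    assume "n = 0"
    moreover have "return_words v 0 = {[]}" unfolding return_words_def by auto
    ultimately show False using n by simp
  qed
  define r where "r = 2 powr (real l * c * real n)"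
  have r: "1 \<le> r" "r < real (card (return_words v n))"
  proof -
    show "1 \<le> r" unfolding r_def using c(1) by (intro ge_one_powr_ge_zero) auto
    have "r \<le> 2 powr (\<theta> * real n)" unfolding r_def using \<theta>(3) by (intro powr_mono mult_right_mono) auto
    then show "r < real (card (return_words v n))" using n by simp
  qed
  obtain k where k: "k \<ge> 1" "r ^ k + 2 \<le> real (card (return_words v n)) ^ k"
    using power_gap[OF r] by blast
  have "real (card (return_words v n)) ^ k \<le> real (card (return_words v (n * k)))"
    using return_words_power[of v n k] by (metis of_nat_le_iff of_nat_power)
  with k(2) have rk: "r ^ k + 2 \<le> real (card (return_words v (n * k)))" by (rule order_trans)
  moreover have "1 \<le> r ^ k" using r(1) by simp
  ultimately have big: "3 \<le> card (return_words v (n * k))" by linarith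
  define s where "s = card (return_words v (n * k)) - 2"
  have s: "s \<ge> 1" "r ^ k \<le> real s" "card (return_words v (n * k)) = s + 2"
    using big rk unfolding s_def by (auto simp: of_nat_diff)
  obtain K where K: "finite K" "K \<subseteq> crossings v (n * k)" "card K = card (return_words v (n * k))"
    using crossings_of_return_words[OF v] by metis
  have "horseshoe g (n * k) s"
    using horseshoe_of_crossings[OF v K(1,2)] K(3) s by simp
  moreover have "g ^^ (n * k) = f ^^ (l * (n * k))" unfolding g_def by (rule funpow_mult)
  ultimately have "horseshoe f (l * (n * k)) s" unfolding horseshoe_def by simp
  moreover have "l * (n * k) \<ge> 1" using l k \<open>n \<noteq> 0\<close> by simp
  moreover have "2 powr (c * real (l * (n * k))) \<le> real s"
  proof -
    have "2 powr (c * real (l * (n * k))) = (2 powr (real l * c * real n)) powr real k"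
      by (simp add: powr_powr mult_ac)
    also have "\<dots> = r ^ k" unfolding r_def by (simp add: powr_realpow)
    finally show ?thesis using s(2) by simp
  qed
  ultimately show ?thesis using that s(1) by blast
qed

section \<open>The entropy of a computable map is lower computable\<close>

lemma rational_ball_around:
  fixes y e :: real
  assumes "0 \<le> y" "y \<le> 1" "0 < e"
  obtains q r :: rat where "0 \<le> q" "q \<le> 1" "0 < r" "\<bar>y - of_rat q\<bar> < of_rat r" "of_rat r < e"
proof -
  obtain r :: rat where r: "0 < (of_rat r :: real)" "of_rat r < e"
    using of_rat_dense[OF assms(3)] by blast
  have "\<exists>q::rat. 0 \<le> (of_rat q :: real) \<and> of_rat q \<le> y \<and> y - of_rat r < of_rat q"
  proof (cases "y = 0")
    case True
    then show ?thesis using r(1) by (intro exI[of _ 0]) auto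
  next
    case False
    then have "max (y - of_rat r) 0 < y" using assms(1) r(1) by simp
    from of_rat_dense[OF this] show ?thesis by (auto intro: less_imp_le)
  qed
  then obtain q :: rat where q: "0 \<le> (of_rat q :: real)" "of_rat q \<le> y" "y - of_rat r < of_rat q" by blast
  then have "(of_rat q :: real) \<le> 1" using assms(2) by linarith
  then show ?thesis using that[of q r] q r by auto
qed

text \<open>
  Preimages of rational balls are unions of enumerated balls, hence open.
\<close>

lemma computable_unit_map_continuous:
  assumes "computable_unit_map f"
  shows "f \<in> {0..1} \<rightarrow> {0..1}" "continuous_on {0..1} f"
proof -
  show maps: "f \<in> {0..1} \<rightarrow> {0..1}" using assms unfolding computable_unit_map_def by blast
  obtain p where p: "\<forall>i j q r. rat_of_code i = q \<and> rat_of_code j = r \<and> 0 \<le> q \<and> q \<le> 1 \<and> 0 < r \<longrightarrow>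
        (\<forall>(q', r') \<in> enumerated p [i, j]. 0 \<le> q' \<and> q' \<le> 1 \<and> 0 < r') \<and>
        {x \<in> {0..1}. f x \<in> unit_ball q r} = (\<Union>(q', r') \<in> enumerated p [i, j]. unit_ball q' r')"
    using assms unfolding computable_unit_map_def by blast
  have ball_open: "openin (top_of_set {0..1}) (unit_ball q r)" for q r
  proof -
    have "unit_ball q r = {0..1} \<inter> ball (of_rat q) (of_rat r)"
      unfolding unit_ball_def by (auto simp: dist_real_def)
    then show ?thesis by (simp add: openin_open_Int)
  qed
  have pre_open: "openin (top_of_set {0..1}) {x \<in> {0..1}. f x \<in> unit_ball q r}"
    if "0 \<le> q" "q \<le> 1" "0 < r" for q r
  proof -
    obtain i j where "rat_of_code i = q" "rat_of_code j = r"
      using decode_surj[where 'a = rat] unfolding decode_rat_def by metis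
    then have "{x \<in> {0..1}. f x \<in> unit_ball q r} = (\<Union>(q', r') \<in> enumerated p [i, j]. unit_ball q' r')"
      using p that by blast
    then show ?thesis using ball_open by (auto intro!: openin_Union simp: split_beta)
  qed
  show "continuous_on {0..1} f"
    unfolding continuous_on_iff
  proof (intro ballI allI impI)
    fix x e :: real assume x: "x \<in> {0..1}" and e: "0 < e"
    have "f x \<in> {0..1}" using maps x by auto
    then have fx: "0 \<le> f x" "f x \<le> 1" by auto
    obtain q r where q: "0 \<le> q" "q \<le> 1" "0 < r" "\<bar>f x - of_rat q\<bar> < of_rat r" "of_rat r < e / 2"
      using rational_ball_around[OF fx, of "e / 2"] e by auto
    have "x \<in> {x \<in> {0..1}. f x \<in> unit_ball q r}"
      using x fx q unfolding unit_ball_def by auto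
    then obtain d where d: "d > 0" "\<And>y. y \<in> {0..1} \<Longrightarrow> dist y x < d \<Longrightarrow> f y \<in> unit_ball q r"
      using pre_open[OF q(1-3)] unfolding openin_euclidean_subtopology_iff by blast
    have "dist (f y) (f x) < e" if "y \<in> {0..1}" "dist y x < d" for y
    proof -
      have "\<bar>f y - of_rat q\<bar> < of_rat r" using d(2)[OF that] unfolding unit_ball_def by auto
      then show ?thesis using q(4,5) unfolding dist_real_def by linarith
    qed
    then show "\<exists>d>0. \<forall>x'\<in>{0..1}. dist x' x < d \<longrightarrow> dist (f x') (f x) < e" using d(1) by blast
  qed
qed

text \<open>
  A map together with a program that enumerates the preimages of rational balls. A code of a pair of
  rationals serves as a code of the ball with this centre and radius.
\<close>

locale computable_interval_map =
  fixes f :: "real \<Rightarrow> real" and p :: recf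
  assumes maps: "f \<in> {0..1} \<rightarrow> {0..1}"
    and valid: "\<And>i j q r. rat_of_code i = q \<Longrightarrow> rat_of_code j = r \<Longrightarrow> 0 \<le> q \<Longrightarrow> q \<le> 1 \<Longrightarrow> 0 < r \<Longrightarrow>
        (\<forall>(q', r') \<in> enumerated p [i, j]. 0 \<le> q' \<and> q' \<le> 1 \<and> 0 < r')"
    and preimage: "\<And>i j q r. rat_of_code i = q \<Longrightarrow> rat_of_code j = r \<Longrightarrow> 0 \<le> q \<Longrightarrow> q \<le> 1 \<Longrightarrow> 0 < r \<Longrightarrow>
        {x \<in> {0..1}. f x \<in> unit_ball q r} = (\<Union>(q', r') \<in> enumerated p [i, j]. unit_ball q' r')"
begin

definition code_ball :: "nat \<Rightarrow> real set" where
  "code_ball c = (case decode c of (q, r) \<Rightarrow> unit_ball q r)"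

definition ball_code :: "nat \<Rightarrow> bool" where
  "ball_code c \<longleftrightarrow> (case decode c :: rat \<times> rat of (q, r) \<Rightarrow> 0 \<le> q \<and> q \<le> 1 \<and> 0 < r)"

definition maps_into :: "nat \<Rightarrow> nat \<Rightarrow> bool" where
  "maps_into c' c \<longleftrightarrow> (\<exists>n. recf_eval p [fst (prod_decode c), snd (prod_decode c), n] c')"

lemma decode_pair: "decode c = (rat_of_code (fst (prod_decode c)), rat_of_code (snd (prod_decode c)))"
  by (cases "prod_decode c") (simp add: decode_prod_def decode_rat_def)

lemma maps_into:
  assumes "ball_code c"
  shows "maps_into c' c \<Longrightarrow> ball_code c'"
    and "x \<in> {0..1} \<Longrightarrow> f x \<in> code_ball c \<longleftrightarrow> (\<exists>c'. maps_into c' c \<and> x \<in> code_ball c')"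
proof -
  let ?i = "fst (prod_decode c)" and ?j = "snd (prod_decode c)"
  have c: "0 \<le> rat_of_code ?i" "rat_of_code ?i \<le> 1" "0 < rat_of_code ?j"
    using assms unfolding ball_code_def decode_pair by auto
  have enum: "enumerated p [?i, ?j] = decode ` {c'. maps_into c' c}"
    unfolding enumerated_def maps_into_def
    by (auto simp: rat_pair_of_code_def decode_prod_def decode_rat_def)
  show "ball_code c'" if "maps_into c' c"
  proof -
    have "decode c' \<in> enumerated p [?i, ?j]" unfolding enum using that by blast
    from bspec[OF valid[OF refl refl c] this] show ?thesis unfolding ball_code_def .
  qed
  show "f x \<in> code_ball c \<longleftrightarrow> (\<exists>c'. maps_into c' c \<and> x \<in> code_ball c')" if x: "x \<in> {0..1}"
  proof -
    have "f x \<in> code_ball c \<longleftrightarrow> x \<in> {x \<in> {0..1}. f x \<in> unit_ball (rat_of_code ?i) (rat_of_code ?j)}"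
      using x unfolding code_ball_def decode_pair by simp
    also have "\<dots> \<longleftrightarrow> x \<in> (\<Union>c'\<in>{c'. maps_into c' c}. code_ball c')"
      unfolding preimage[OF refl refl c] enum code_ball_def image_image ..
    also have "\<dots> \<longleftrightarrow> (\<exists>c'. maps_into c' c \<and> x \<in> code_ball c')" by simp
    finally show ?thesis .
  qed
qed

text \<open>
  The enumeration is applied \<open>N\<close> times: a chain of balls, each enumerated for the preceding one,
  leads from the ball \<open>c\<close> back to a ball that contains \<open>x\<close>.
\<close>

lemma ball_chain:
  assumes "ball_code c" "x \<in> {0..1}"
  shows "(f ^^ N) x \<in> code_ball c \<longleftrightarrow>
    (\<exists>v. seq_nth v 0 = c \<and> (\<forall>k<N. maps_into (seq_nth v (Suc k)) (seq_nth v k)) \<and> x \<in> code_ball (seq_nth v N))"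
proof -
  have "(f ^^ N) x \<in> code_ball c \<longleftrightarrow>
    (\<exists>h. h 0 = c \<and> (\<forall>k<N. maps_into (h (Suc k)) (h k)) \<and> x \<in> code_ball (h N))"
    using assms
  proof (induction N arbitrary: c)
    case 0
    show ?case by (auto intro: exI[of _ "\<lambda>_. c"])
  next
    case (Suc N)
    have "(f ^^ N) x \<in> {0..1}" using maps Suc.prems(2) by (rule funpow_in)
    then have "(f ^^ Suc N) x \<in> code_ball c \<longleftrightarrow> (\<exists>c'. maps_into c' c \<and> (f ^^ N) x \<in> code_ball c')"
      using maps_into(2)[OF Suc.prems(1)] by simp
    also have "\<dots> \<longleftrightarrow> (\<exists>c'. maps_into c' c \<and>
        (\<exists>h. h 0 = c' \<and> (\<forall>k<N. maps_into (h (Suc k)) (h k)) \<and> x \<in> code_ball (h N)))"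
      using Suc.IH[OF maps_into(1)[OF Suc.prems(1)] Suc.prems(2)] by blast
    also have "\<dots> \<longleftrightarrow> (\<exists>h. h 0 = c \<and> (\<forall>k<Suc N. maps_into (h (Suc k)) (h k)) \<and> x \<in> code_ball (h (Suc N)))"
      (is "?L \<longleftrightarrow> ?R")
    proof
      assume ?L
      then obtain h where h: "maps_into (h 0) c" "\<forall>k<N. maps_into (h (Suc k)) (h k)" "x \<in> code_ball (h N)" by blast
      show ?R
        by (rule exI[of _ "case_nat c h"]) (use h in \<open>auto simp: All_less_Suc2\<close>)
    next
      assume ?R
      then obtain h where h: "h 0 = c" "\<forall>k<Suc N. maps_into (h (Suc k)) (h k)" "x \<in> code_ball (h (Suc N))" by blast
      then show ?L by (intro exI[of _ "h 1"] conjI exI[of _ "\<lambda>k. h (Suc k)"]) auto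
    qed
    finally show ?case .
  qed
  also have "\<dots> \<longleftrightarrow> (\<exists>v. seq_nth v 0 = c \<and> (\<forall>k<N. maps_into (seq_nth v (Suc k)) (seq_nth v k)) \<and> x \<in> code_ball (seq_nth v N))"
    (is "?L \<longleftrightarrow> ?R")
  proof
    assume ?L
    then obtain h where h: "h 0 = c" "\<forall>k<N. maps_into (h (Suc k)) (h k)" "x \<in> code_ball (h N)" by blast
    obtain v where "\<forall>i<Suc N. seq_nth v i = h i" using ex_seq_nth by blast
    then show ?R using h by (intro exI[of _ v]) auto
  qed blast
  finally show ?thesis .
qed

lemma semidecidable_maps_into:
  assumes "computable u" "computable v"
  shows "semidecidable (\<lambda>e. maps_into (u e) (v e))"
proof -
  have "semidecidable (\<lambda>z. recf_eval p (map (\<lambda>A. A z)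
      [\<lambda>z. fst (prod_decode (v (fst z))), \<lambda>z. snd (prod_decode (v (fst z))), \<lambda>z::'a \<times> nat. snd z]) (u (fst z)))"
    using computable_comp[OF assms(1) computable_fst[OF computable_id]]
      computable_comp[OF assms(2) computable_fst[OF computable_id]]
    by (intro semidecidable_graphD[OF semidecidable_graph]) (auto intro!: computable_intros)
  then show ?thesis unfolding maps_into_def by (intro semidecidable_ex) simp
qed

lemma code_ball_iff:
  "of_rat z \<in> code_ball c \<longleftrightarrow> 0 \<le> z \<and> z \<le> 1 \<and>
     \<bar>z - fst (decode c :: rat \<times> rat)\<bar> < snd (decode c :: rat \<times> rat)"
proof -
  have "\<bar>of_rat z - of_rat q\<bar> < (of_rat r :: real) \<longleftrightarrow> \<bar>z - q\<bar> < r" for q r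
    by (metis abs_of_rat of_rat_diff of_rat_less)
  then show ?thesis
    unfolding code_ball_def unit_ball_def by (auto split: prod.splits)
qed

definition iterate_in :: "nat \<Rightarrow> rat \<Rightarrow> nat \<Rightarrow> bool" where
  "iterate_in N z c \<longleftrightarrow> ball_code c \<and> 0 \<le> z \<and> z \<le> 1 \<and> (f ^^ N) (of_rat z) \<in> code_ball c"

lemma semidecidable_iterate_in:
  fixes N c :: "'a::represented \<Rightarrow> nat"
  assumes "computable N" "computable z" "computable c"
  shows "semidecidable (\<lambda>e. iterate_in (N e) (z e) (c e))"
proof -
  let ?ok = "\<lambda>c. 0 \<le> fst (decode c :: rat \<times> rat) \<and> fst (decode c :: rat \<times> rat) \<le> 1 \<and> 0 < snd (decode c :: rat \<times> rat)"
  let ?b = "\<lambda>c z. 0 \<le> z \<and> z \<le> 1 \<and> \<bar>z - fst (decode c :: rat \<times> rat)\<bar> < snd (decode c :: rat \<times> rat)"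
  have eq: "iterate_in N z c \<longleftrightarrow> (?ok c \<and> 0 \<le> z \<and> z \<le> 1) \<and> (\<exists>v. seq_nth v 0 = c \<and>
      (\<forall>k<N. maps_into (seq_nth v (Suc k)) (seq_nth v k)) \<and> ?b (seq_nth v N) z)" for N z c
  proof (cases "?ok c \<and> 0 \<le> z \<and> z \<le> 1")
    case True
    then have "ball_code c" "(of_rat z :: real) \<in> {0..1}" unfolding ball_code_def by (auto split: prod.splits)
    from ball_chain[OF this, of N] show ?thesis
      using True \<open>ball_code c\<close> unfolding iterate_in_def code_ball_iff by auto
  next
    case False
    then show ?thesis unfolding iterate_in_def ball_code_def by (auto split: prod.splits)
  qed
  have proj: "computable (\<lambda>z. h (fst z))" if "computable h" for h :: "'a \<Rightarrow> 'b::represented"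
    using computable_comp[OF that computable_fst[OF computable_id]] .
  have N: "computable (\<lambda>z. N (fst z))" and z': "computable (\<lambda>y. z (fst y))" and c: "computable (\<lambda>z. c (fst z))"
    using proj assms by blast+
  have "semidecidable (\<lambda>e. \<exists>v. seq_nth v 0 = c e \<and>
      (\<forall>k<N e. maps_into (seq_nth v (Suc k)) (seq_nth v k)) \<and> ?b (seq_nth v (N e)) (z e))"
    by (intro semidecidable_ex semidecidable_conj semidecidable_all_less semidecidable_maps_into N
        computable_seq_nth computable_intros) 
      (intro semidecidableI_computable computable_intros N z' c)+
  moreover have "semidecidable (\<lambda>e. ?ok (c e) \<and> 0 \<le> z e \<and> z e \<le> 1)"
    by (intro semidecidableI_computable computable_intros assms)
  ultimately show ?thesis unfolding eq by (rule semidecidable_conj[rotated])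
qed


text \<open>
  A strict upper bound is confirmed by a rational ball that contains the value and lies below the
  bound. The centre has to lie in the unit interval, because only such balls are valid inputs of the
  program.
\<close>

lemma iterate_less_iff:
  assumes "0 \<le> z" "z \<le> 1"
  shows "(f ^^ N) (of_rat z) < of_rat u \<longleftrightarrow>
    (\<exists>c. iterate_in N z c \<and> fst (decode c :: rat \<times> rat) + snd (decode c :: rat \<times> rat) \<le> u)"
proof
  define y where "y = (f ^^ N) (of_rat z)"
  have "(of_rat z :: real) \<in> {0..1}" using assms by auto
  then have y01: "0 \<le> y" "y \<le> 1" using funpow_in[OF maps, of "of_rat z" N] unfolding y_def by auto
  assume "(f ^^ N) (of_rat z) < of_rat u"
  then have y: "y < of_rat u" unfolding y_def .
  obtain q r where q: "0 \<le> q" "q \<le> 1" "0 < r" "\<bar>y - of_rat q\<bar> < of_rat r" "of_rat r < (of_rat u - y) / 2"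
    using rational_ball_around[OF y01, of "(of_rat u - y) / 2"] y by auto
  have "of_rat q < y + (of_rat r :: real)" using q(4) by linarith
  then have "of_rat (q + r) \<le> (of_rat u :: real)" using q(5) unfolding of_rat_add by argo
  then have "q + r \<le> u" by (simp only: of_rat_less_eq)
  moreover obtain c where c: "decode c = (q, r)" using decode_surj by blast
  have "iterate_in N z c"
    using assms q y01 unfolding iterate_in_def ball_code_def code_ball_def unit_ball_def c y_def by auto
  ultimately show "\<exists>c. iterate_in N z c \<and> fst (decode c :: rat \<times> rat) + snd (decode c :: rat \<times> rat) \<le> u"
    using c by (intro exI[of _ c]) auto
next
  assume "\<exists>c. iterate_in N z c \<and> fst (decode c :: rat \<times> rat) + snd (decode c :: rat \<times> rat) \<le> u"
  then obtain c q r where c: "iterate_in N z c" "decode c = (q :: rat, r :: rat)" "q + r \<le> u"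
    by (metis prod.collapse)
  then have "\<bar>(f ^^ N) (of_rat z) - of_rat q\<bar> < of_rat r"
    unfolding iterate_in_def code_ball_def unit_ball_def by auto
  moreover have "(of_rat q + of_rat r :: real) \<le> of_rat u"
    using c(3) by (metis of_rat_add of_rat_less_eq)
  ultimately show "(f ^^ N) (of_rat z) < of_rat u" by linarith
qed

lemma iterate_greater_iff:
  assumes "0 \<le> z" "z \<le> 1"
  shows "of_rat v < (f ^^ N) (of_rat z) \<longleftrightarrow>
    (\<exists>c. iterate_in N z c \<and> v \<le> fst (decode c :: rat \<times> rat) - snd (decode c :: rat \<times> rat))"
proof
  define y where "y = (f ^^ N) (of_rat z)"
  have "(of_rat z :: real) \<in> {0..1}" using assms by auto
  then have y01: "0 \<le> y" "y \<le> 1" using funpow_in[OF maps, of "of_rat z" N] unfolding y_def by auto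
  assume "of_rat v < (f ^^ N) (of_rat z)"
  then have y: "of_rat v < y" unfolding y_def .
  obtain q r where q: "0 \<le> q" "q \<le> 1" "0 < r" "\<bar>y - of_rat q\<bar> < of_rat r" "of_rat r < (y - of_rat v) / 2"
    using rational_ball_around[OF y01, of "(y - of_rat v) / 2"] y by auto
  have "y - of_rat r < (of_rat q :: real)" using q(4) by linarith
  then have "of_rat v \<le> (of_rat (q - r) :: real)" using q(5) unfolding of_rat_diff by argo
  then have "v \<le> q - r" by (simp only: of_rat_less_eq)
  moreover obtain c where c: "decode c = (q, r)" using decode_surj by blast
  have "iterate_in N z c"
    using assms q y01 unfolding iterate_in_def ball_code_def code_ball_def unit_ball_def c y_def by auto
  ultimately show "\<exists>c. iterate_in N z c \<and> v \<le> fst (decode c :: rat \<times> rat) - snd (decode c :: rat \<times> rat)"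
    using c by (intro exI[of _ c]) auto
next
  assume "\<exists>c. iterate_in N z c \<and> v \<le> fst (decode c :: rat \<times> rat) - snd (decode c :: rat \<times> rat)"
  then obtain c q r where c: "iterate_in N z c" "decode c = (q :: rat, r :: rat)" "v \<le> q - r"
    by (metis prod.collapse)
  then have "\<bar>(f ^^ N) (of_rat z) - of_rat q\<bar> < of_rat r"
    unfolding iterate_in_def code_ball_def unit_ball_def by auto
  moreover have "(of_rat v :: real) \<le> of_rat q - of_rat r"
    using c(3) by (metis of_rat_diff of_rat_less_eq)
  ultimately show "of_rat v < (f ^^ N) (of_rat z)" by linarith
qed

lemma semidecidable_iterate_less:
  fixes N :: "'a::represented \<Rightarrow> nat"
  assumes "computable N" "computable z" "computable u"
  shows "semidecidable (\<lambda>e. 0 \<le> z e \<and> z e \<le> 1 \<and> (f ^^ N e) (of_rat (z e)) < of_rat (u e))"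
proof -
  have proj: "computable (\<lambda>z. h (fst z))" if "computable h" for h :: "'a \<Rightarrow> 'b::represented"
    using computable_comp[OF that computable_fst[OF computable_id]] .
  have "semidecidable (\<lambda>e. \<exists>c. iterate_in (N e) (z e) c \<and> fst (decode c :: rat \<times> rat) + snd (decode c :: rat \<times> rat) \<le> u e)"
    by (intro semidecidable_ex semidecidable_conj semidecidable_iterate_in proj assms computable_snd computable_id)
      (intro semidecidableI_computable computable_intros proj assms)
  moreover have "semidecidable (\<lambda>e. 0 \<le> z e \<and> z e \<le> 1)"
    by (intro semidecidableI_computable computable_intros assms)
  ultimately have "semidecidable (\<lambda>e. (0 \<le> z e \<and> z e \<le> 1) \<and>
      (\<exists>c. iterate_in (N e) (z e) c \<and> fst (decode c :: rat \<times> rat) + snd (decode c :: rat \<times> rat) \<le> u e))"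
    by (rule semidecidable_conj[rotated])
  then show ?thesis by (rule back_subst[of semidecidable]) (use iterate_less_iff in \<open>intro ext, blast\<close>)
qed

lemma semidecidable_iterate_greater:
  fixes N :: "'a::represented \<Rightarrow> nat"
  assumes "computable N" "computable z" "computable v"
  shows "semidecidable (\<lambda>e. 0 \<le> z e \<and> z e \<le> 1 \<and> of_rat (v e) < (f ^^ N e) (of_rat (z e)))"
proof -
  have proj: "computable (\<lambda>z. h (fst z))" if "computable h" for h :: "'a \<Rightarrow> 'b::represented"
    using computable_comp[OF that computable_fst[OF computable_id]] .
  have "semidecidable (\<lambda>e. \<exists>c. iterate_in (N e) (z e) c \<and> v e \<le> fst (decode c :: rat \<times> rat) - snd (decode c :: rat \<times> rat))"
    by (intro semidecidable_ex semidecidable_conj semidecidable_iterate_in proj assms computable_snd computable_id)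
      (intro semidecidableI_computable computable_intros proj assms)
  moreover have "semidecidable (\<lambda>e. 0 \<le> z e \<and> z e \<le> 1)"
    by (intro semidecidableI_computable computable_intros assms)
  ultimately have "semidecidable (\<lambda>e. (0 \<le> z e \<and> z e \<le> 1) \<and>
      (\<exists>c. iterate_in (N e) (z e) c \<and> v e \<le> fst (decode c :: rat \<times> rat) - snd (decode c :: rat \<times> rat)))"
    by (rule semidecidable_conj[rotated])
  then show ?thesis by (rule back_subst[of semidecidable]) (use iterate_greater_iff in \<open>intro ext, blast\<close>)
qed

lemma semidecidable_horseshoe:
  "semidecidable (\<lambda>e::nat \<times> nat. horseshoe f (fst e) (snd e))"
proof -
  let ?z = "\<lambda>w i. decode (seq_nth w i) :: rat"
  let ?lt = "\<lambda>N z u. 0 \<le> z \<and> z \<le> 1 \<and> (f ^^ N) (of_rat z) < of_rat u"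
  let ?gt = "\<lambda>N z v. 0 \<le> z \<and> z \<le> 1 \<and> of_rat v < (f ^^ N) (of_rat z)"
  let ?H = "\<lambda>N s u v w. (\<forall>i<2 * s. 0 \<le> ?z w i \<and> ?z w i \<le> 1 \<and> u \<le> ?z w i \<and> ?z w i \<le> v) \<and>
     (\<forall>i<2 * s - 1. ?z w i < ?z w (Suc i)) \<and>
     (\<forall>i<s. ?lt N (?z w (2 * i)) u \<and> ?gt N (?z w (2 * i + 1)) v \<or>
            ?gt N (?z w (2 * i)) v \<and> ?lt N (?z w (2 * i + 1)) u)"
  have "horseshoe f N s \<longleftrightarrow> (\<exists>u v w. ?H N s u v w)" for N s
  proof
    assume "horseshoe f N s"
    then obtain u v z where z: "\<forall>i<2 * s. 0 \<le> z i \<and> z i \<le> 1 \<and> u \<le> z i \<and> z i \<le> v"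
     "\<forall>i<2 * s - 1. z i < z (Suc i)"
     "\<forall>i<s. (f ^^ N) (of_rat (z (2 * i))) < of_rat u \<and> of_rat v < (f ^^ N) (of_rat (z (2 * i + 1))) \<or>
            of_rat v < (f ^^ N) (of_rat (z (2 * i))) \<and> (f ^^ N) (of_rat (z (2 * i + 1))) < of_rat u"
      unfolding horseshoe_def by blast
    have "\<forall>i. \<exists>n. decode n = z i" using decode_surj by blast
    then obtain h where h: "\<And>i. decode (h i) = z i" by metis
    obtain w where w: "\<forall>i<2 * s. seq_nth w i = h i" using ex_seq_nth by blast
    then have zw: "?z w i = z i" if "i < 2 * s" for i using h that by simp
    have "?H N s u v w"
      using z by (auto simp: zw)
    then show "\<exists>u v w. ?H N s u v w" by blast
  next
    assume "\<exists>u v w. ?H N s u v w"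
    then obtain u v w where H: "?H N s u v w" by (elim exE)
    show "horseshoe f N s" unfolding horseshoe_def
      by (rule exI[of _ u], rule exI[of _ v], rule exI[of _ "?z w"]) (use H in blast)
  qed
  moreover have "semidecidable (\<lambda>e::nat \<times> nat. \<exists>u v w. ?H (fst e) (snd e) u v w)"
    by (intro semidecidable_ex semidecidable_conj semidecidable_all_less semidecidable_disj
        semidecidable_iterate_less semidecidable_iterate_greater computable_intros)
      (intro semidecidableI_computable computable_intros)+
  ultimately show ?thesis by simp
qed

text \<open>
  A fraction \<open>a / (b + 1)\<close> is at most $(\log_2 s)/N$ if and only if \<open>2 ^ (a * N) \<le> s ^ (b + 1)\<close>, which
  can be decided. The fractions that are bounded in this way by some horseshoe form a semidecidable
  set whose supremum is the entropy; zero is added to make the set nonempty.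
\<close>

lemma lower_computable_entropy:
  assumes cont: "continuous_on {0..1} f"
  shows "lower_computable (topological_entropy {0..1} f)"
proof -
  let ?h = "topological_entropy {0..1} f"
  let ?R = "\<lambda>q a b N s. q = of_nat a * (1 / of_nat (Suc b)) \<and> 1 \<le> N \<and> 1 \<le> s \<and> 2 ^ (a * N) \<le> s ^ Suc b"
  define Q where "Q q \<longleftrightarrow> q = 0 \<or> (\<exists>a b N s :: nat. ?R q a b N s \<and> horseshoe f N s)" for q :: rat
  have "semidecidable Q"
  proof -
    have hs: "semidecidable (\<lambda>e. horseshoe f (N e) (s e))" if "computable N" "computable s"
      for N s :: "(((rat \<times> nat) \<times> nat) \<times> nat) \<times> nat \<Rightarrow> nat"
      using semidecidable_comp[OF semidecidable_horseshoe computable_Pair[OF that]] by simp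
    have "semidecidable (\<lambda>q::rat. \<exists>a b N s :: nat. ?R q a b N s \<and> horseshoe f N s)"
    proof (intro semidecidable_ex semidecidable_conj[OF _ hs])
      show "semidecidable (\<lambda>z::(((rat \<times> nat) \<times> nat) \<times> nat) \<times> nat.
          ?R (fst (fst (fst (fst z)))) (snd (fst (fst (fst z)))) (snd (fst (fst z))) (snd (fst z)) (snd z))"
        by (intro semidecidableI_computable computable_intros)
    qed (intro computable_intros)+
    moreover have "semidecidable (\<lambda>q::rat. q = 0)"
      by (intro semidecidableI_computable computable_intros)
    ultimately show ?thesis unfolding Q_def by (rule semidecidable_disj[rotated])
  qed
  moreover have "Q 0" unfolding Q_def by simp
  ultimately have "lower_computable (SUP q\<in>Collect Q. ereal (of_rat q))"
    by (rule lower_computable_Sup)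
  moreover have "(SUP q\<in>Collect Q. ereal (of_rat q)) = ?h"
  proof (rule antisym)
    show "(SUP q\<in>Collect Q. ereal (of_rat q)) \<le> ?h"
    proof (rule SUP_least)
      fix q assume "q \<in> Collect Q"
      then consider "q = 0" | a b N s where "?R q a b N s" "horseshoe f N s" unfolding Q_def by auto
      then show "ereal (of_rat q) \<le> ?h"
      proof cases
        case 1
        then show ?thesis using topological_entropy_nonneg[OF maps] by (simp add: zero_ereal_def)
      next
        case 2
        then have Ns: "1 \<le> N" "1 \<le> s" and pow: "2 ^ (a * N) \<le> s ^ Suc b" by auto
        have "(2::real) ^ (a * N) \<le> real s ^ Suc b"
          using pow by (metis of_nat_le_iff of_nat_numeral of_nat_power)
        then have "log 2 (2 ^ (a * N)) \<le> log 2 (real s ^ Suc b)"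
          using Ns by (intro log_mono) auto
        then have "real a * real N \<le> real (Suc b) * log 2 (real s)"
          by (simp add: log_nat_power del: power_Suc of_nat_Suc)
        then have "real a * (1 / real (Suc b)) \<le> log 2 (real s) / real N"
          using Ns by (simp add: field_simps del: of_nat_Suc)
        moreover have "of_rat q = real a * (1 / real (Suc b))"
          using 2 by (simp add: of_rat_mult of_rat_divide of_rat_add)
        ultimately have "ereal (of_rat q) \<le> ereal (log 2 (real s) / real N)" by simp
        also have "\<dots> \<le> ?h" by (rule horseshoe_entropy[OF cont maps Ns 2(2)])
        finally show ?thesis .
      qed
    qed
    show "?h \<le> (SUP q\<in>Collect Q. ereal (of_rat q))"
    proof (rule dense_le)
      fix x assume x: "x < ?h"
      show "x \<le> (SUP q\<in>Collect Q. ereal (of_rat q))"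
      proof (cases "x < 0")
        case True
        have "ereal (of_rat 0) \<le> (SUP q\<in>Collect Q. ereal (of_rat q))"
          using \<open>Q 0\<close> by (intro SUP_upper) auto
        then show ?thesis using True by (auto simp: zero_ereal_def[symmetric] intro: less_imp_le order_trans)
      next
        case False
        then obtain c where c: "x = ereal c" "0 \<le> c" using x by (cases x) auto
        obtain \<U> where \<U>: "finite_open_cover {0..1} \<U>" "ereal c < cover_entropy {0..1} f \<U>"
          using x unfolding topological_entropy_def c(1) less_SUP_iff by blast
        obtain c' where c': "c < c'" "ereal c' < cover_entropy {0..1} f \<U>"
          using ereal_dense2[OF \<U>(2)] by auto
        obtain N s where Ns: "N \<ge> 1" "s \<ge> 1" "horseshoe f N s" "2 powr (c' * real N) \<le> real s"
          using horseshoe_exists[OF cont maps \<U>(1) _ c'(2)] c c'(1) by auto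
        obtain q where q: "c < of_rat q" "of_rat q < c'" using of_rat_dense[OF c'(1)] by blast
        have "(0::real) < of_rat q" using q c by linarith
        then have "0 < q" by simp
        obtain a' b' where ab: "q = Fract a' b'" "b' > 0" by (cases q) auto
        then have "a' > 0" using \<open>0 < q\<close> by (simp add: zero_less_Fract_iff)
        define a where "a = nat a'"
        define b where "b = nat b' - 1"
        have qab: "q = of_nat a * (1 / of_nat (Suc b))"
          using ab \<open>a' > 0\<close> unfolding a_def b_def by (simp add: Fract_of_int_quotient)
        have rq: "(of_rat q :: real) * real (Suc b) = real a"
          unfolding qab by (simp add: of_rat_mult of_rat_divide of_rat_add)
        have "2 ^ (a * N) = 2 powr (of_rat q * real (Suc b) * real N)"
          unfolding rq by (simp add: powr_realpow[symmetric])
        also have "\<dots> = (2 powr (of_rat q * real N)) powr real (Suc b)"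
          by (simp add: powr_powr mult_ac)
        also have "\<dots> \<le> real s powr real (Suc b)"
        proof (intro powr_mono2)
          have "2 powr (of_rat q * real N) \<le> 2 powr (c' * real N)"
            using q(2) by (intro powr_mono mult_right_mono) auto
          then show "2 powr (of_rat q * real N) \<le> real s" using Ns(4) by linarith
        qed auto
        also have "\<dots> = real s ^ Suc b" using Ns(2) by (intro powr_realpow) auto
        finally have "real (2 ^ (a * N)) \<le> real (s ^ Suc b)" by simp
        then have "2 ^ (a * N) \<le> s ^ Suc b" by (simp only: of_nat_le_iff)
        then have "Q q" unfolding Q_def using qab Ns(1-3) by blast
        then have "ereal (of_rat q) \<le> (SUP q\<in>Collect Q. ereal (of_rat q))" by (intro SUP_upper) auto
        moreover have "x \<le> ereal (of_rat q)" using q c by simp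
        ultimately show ?thesis by (rule order_trans[rotated])
      qed
    qed
  qed
  ultimately show ?thesis by simp
qed

end

theorem computable_map_entropy_lower_computable:
  assumes "computable_unit_map f"
  shows "lower_computable (topological_entropy {0..1} f)"
proof -
  obtain p where p: "\<forall>i j q r. rat_of_code i = q \<and> rat_of_code j = r \<and> 0 \<le> q \<and> q \<le> 1 \<and> 0 < r \<longrightarrow>
        (\<forall>(q', r') \<in> enumerated p [i, j]. 0 \<le> q' \<and> q' \<le> 1 \<and> 0 < r') \<and>
        {x \<in> {0..1}. f x \<in> unit_ball q r} = (\<Union>(q', r') \<in> enumerated p [i, j]. unit_ball q' r')"
    using assms unfolding computable_unit_map_def by blast
  interpret computable_interval_map f p
  proof
    show "f \<in> {0..1} \<rightarrow> {0..1}" using computable_unit_map_continuous(1)[OF assms] .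
  qed (use p in blast)+
  show ?thesis using computable_unit_map_continuous(2)[OF assms] by (rule lower_computable_entropy)
qed

section \<open>Maps of constant slope\<close>

text \<open>
  On each side of \<open>x\<close>, and relative to \<open>I\<close>, the function is affine near \<open>x\<close> with slope
  \<open>\<kappa>\<close> or \<open>- \<kappa>\<close>. Unlike the number of affine pieces, this local form does not deteriorate under
  composition: an affine branch maps one side of \<open>x\<close> into one side of its image.
\<close>

definition bends :: "real \<Rightarrow> (real \<Rightarrow> real) \<Rightarrow> real set \<Rightarrow> real \<Rightarrow> bool" where
  "bends \<kappa> f I x \<longleftrightarrow> (\<exists>\<epsilon>>0. \<exists>\<sigma> \<tau>. \<bar>\<sigma>\<bar> = \<kappa> \<and> \<bar>\<tau>\<bar> = \<kappa> \<and>
     (\<forall>y\<in>I. x \<le> y \<longrightarrow> y < x + \<epsilon> \<longrightarrow> f y = f x + \<sigma> * (y - x)) \<and>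
     (\<forall>y\<in>I. y \<le> x \<longrightarrow> x - \<epsilon> < y \<longrightarrow> f y = f x + \<tau> * (y - x)))"

lemma bends_affine: "bends \<bar>\<alpha>\<bar> (\<lambda>y. \<alpha> * y + \<beta>) I x"
  unfolding bends_def by (intro exI[of _ 1] exI[of _ \<alpha>] conjI) (auto simp: algebra_simps)

lemma bends_cong:
  assumes "bends \<kappa> f I x" "x \<in> I" "\<And>y. y \<in> I \<Longrightarrow> f y = g y"
  shows "bends \<kappa> g I x"
  using assms unfolding bends_def by auto

lemma bends_comp:
  assumes f: "bends \<kappa> f I x" and g: "bends \<mu> g J (f x)" and "f \<in> I \<rightarrow> J" "\<kappa> > 0"
  shows "bends (\<kappa> * \<mu>) (\<lambda>y. g (f y)) I x"
proof -
  obtain \<epsilon> \<sigma> \<tau> where \<epsilon>: "\<epsilon> > 0" "\<bar>\<sigma>\<bar> = \<kappa>" "\<bar>\<tau>\<bar> = \<kappa>"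
    and right: "\<And>y. y \<in> I \<Longrightarrow> x \<le> y \<Longrightarrow> y < x + \<epsilon> \<Longrightarrow> f y = f x + \<sigma> * (y - x)"
    and left: "\<And>y. y \<in> I \<Longrightarrow> y \<le> x \<Longrightarrow> x - \<epsilon> < y \<Longrightarrow> f y = f x + \<tau> * (y - x)"
    using f unfolding bends_def by blast
  obtain \<delta> \<phi> \<psi> where \<delta>: "\<delta> > 0" "\<bar>\<phi>\<bar> = \<mu>" "\<bar>\<psi>\<bar> = \<mu>"
    and right': "\<And>z. z \<in> J \<Longrightarrow> f x \<le> z \<Longrightarrow> z < f x + \<delta> \<Longrightarrow> g z = g (f x) + \<phi> * (z - f x)"
    and left': "\<And>z. z \<in> J \<Longrightarrow> z \<le> f x \<Longrightarrow> f x - \<delta> < z \<Longrightarrow> g z = g (f x) + \<psi> * (z - f x)"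
    using g unfolding bends_def by blast
  define \<eta> where "\<eta> = min \<epsilon> (\<delta> / \<kappa>)"
  have \<eta>: "\<eta> > 0" "\<eta> \<le> \<epsilon>" "\<eta> * \<kappa> \<le> \<delta>" unfolding \<eta>_def using \<epsilon> \<delta> assms(4) by (auto simp: min_def field_simps)
  have small: "\<bar>\<rho> * (y - x)\<bar> < \<delta>" if "\<bar>y - x\<bar> < \<eta>" "\<bar>\<rho>\<bar> = \<kappa>" for \<rho> y
  proof -
    have "\<bar>\<rho> * (y - x)\<bar> = \<kappa> * \<bar>y - x\<bar>" using that by (simp add: abs_mult)
    also have "\<dots> < \<kappa> * \<eta>" using that assms(4) by simp
    finally show ?thesis using \<eta>(3) by (simp add: mult.commute)
  qed
  have both: "g z = g (f x) + (if f x \<le> z then \<phi> else \<psi>) * (z - f x)" if "z \<in> J" "\<bar>z - f x\<bar> < \<delta>" for z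
    using right'[of z] left'[of z] that by auto
  define \<sigma>' where "\<sigma>' = (if \<sigma> \<ge> 0 then \<phi> else \<psi>)"
  define \<tau>' where "\<tau>' = (if \<tau> \<le> 0 then \<phi> else \<psi>)"
  have R: "g (f y) = g (f x) + \<sigma> * \<sigma>' * (y - x)" if y: "y \<in> I" "x \<le> y" "y < x + \<eta>" for y
  proof -
    have fy: "f y - f x = \<sigma> * (y - x)" using right[OF y(1,2)] y \<eta> by simp
    have "\<bar>f y - f x\<bar> < \<delta>" unfolding fy using y \<epsilon> by (intro small) auto
    then have "g (f y) = g (f x) + (if f x \<le> f y then \<phi> else \<psi>) * (\<sigma> * (y - x))"
      using both[of "f y"] funcset_mem[OF assms(3) y(1)] unfolding fy by blast
    moreover have "(if f x \<le> f y then \<phi> else \<psi>) * (\<sigma> * (y - x)) = \<sigma>' * (\<sigma> * (y - x))"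
    proof (cases "y = x")
      case False
      then have "y - x > 0" using y by simp
      then have "f x \<le> f y \<longleftrightarrow> \<sigma> \<ge> 0" using fy
        by (smt (verit) mult_nonneg_nonneg mult_neg_pos)
      then show ?thesis unfolding \<sigma>'_def by simp
    qed simp
    ultimately show ?thesis by (simp add: mult_ac)
  qed
  have L: "g (f y) = g (f x) + \<tau> * \<tau>' * (y - x)" if y: "y \<in> I" "y \<le> x" "x - \<eta> < y" for y
  proof -
    have fy: "f y - f x = \<tau> * (y - x)" using left[OF y(1,2)] y \<eta> by simp
    have "\<bar>f y - f x\<bar> < \<delta>" unfolding fy using y \<epsilon> by (intro small) auto
    then have "g (f y) = g (f x) + (if f x \<le> f y then \<phi> else \<psi>) * (\<tau> * (y - x))"
      using both[of "f y"] funcset_mem[OF assms(3) y(1)] unfolding fy by blast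
    moreover have "(if f x \<le> f y then \<phi> else \<psi>) * (\<tau> * (y - x)) = \<tau>' * (\<tau> * (y - x))"
    proof (cases "y = x")
      case False
      then have "y - x < 0" using y by simp
      then have "f x \<le> f y \<longleftrightarrow> \<tau> \<le> 0" using fy
        by (smt (verit) mult_nonpos_nonpos mult_pos_neg)
      then show ?thesis unfolding \<tau>'_def by simp
    qed simp
    ultimately show ?thesis by (simp add: mult_ac)
  qed
  have "\<bar>\<sigma> * \<sigma>'\<bar> = \<kappa> * \<mu>" "\<bar>\<tau> * \<tau>'\<bar> = \<kappa> * \<mu>"
    unfolding \<sigma>'_def \<tau>'_def using \<epsilon> \<delta> by (auto simp: abs_mult)
  then show ?thesis unfolding bends_def using \<eta>(1) R L
    by (intro exI[of _ \<eta>] conjI exI[of _ "\<sigma> * \<sigma>'"] exI[of _ "\<tau> * \<tau>'"]) auto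
qed

lemma bends_funpow:
  assumes "\<And>x. x \<in> I \<Longrightarrow> bends \<kappa> f I x" "f \<in> I \<rightarrow> I" "\<kappa> > 0" "x \<in> I"
  shows "bends (\<kappa> ^ m) (f ^^ m) I x"
  using assms(4)
proof (induction m arbitrary: x)
  case 0
  then show ?case using bends_affine[of 1 0] by (simp add: id_def)
next
  case (Suc m)
  have "bends (\<kappa> ^ m * \<kappa>) (\<lambda>y. f ((f ^^ m) y)) I x"
    using Suc assms funpow_in[OF assms(2)] by (intro bends_comp[where J = I]) auto
  then show ?case by (simp add: mult.commute comp_def)
qed

lemma bends_abs: "bends 1 abs I x"
proof -
  consider "x < 0" | "x = 0" | "x > 0" by linarith
  then show ?thesis
  proof cases
    case 1
    then show ?thesis unfolding bends_def by (intro exI[of _ "- x"] conjI exI[of _ "- 1"]) auto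
  next
    case 2
    then show ?thesis unfolding bends_def by (intro exI[of _ 1] conjI exI[of _ 1] exI[of _ "- 1"]) auto
  next
    case 3
    then show ?thesis unfolding bends_def by (intro exI[of _ x] conjI exI[of _ 1]) auto
  qed
qed

text \<open>
  The distance to the nearest even integer. It folds the real line onto the unit interval without
  changing the absolute value of slopes.
\<close>

definition triangle_wave :: "real \<Rightarrow> real" where
  "triangle_wave y = \<bar>y - 2 * of_int (round (y / 2))\<bar>"

lemma triangle_wave_le: "triangle_wave y \<le> \<bar>y - 2 * of_int k\<bar>"
  using round_diff_minimal[of "y / 2" k] unfolding triangle_wave_def by (simp add: abs_if split: if_splits)

lemma triangle_wave_range: "0 \<le> triangle_wave y" "triangle_wave y \<le> 1"
  using of_int_round_abs_le[of "y / 2"] unfolding triangle_wave_def by (auto simp: abs_if split: if_splits)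

lemma triangle_wave_lipschitz: "\<bar>triangle_wave x - triangle_wave y\<bar> \<le> \<bar>x - y\<bar>"
proof -
  have "triangle_wave x \<le> \<bar>x - y\<bar> + triangle_wave y" for x y
  proof -
    have "triangle_wave x \<le> \<bar>x - 2 * of_int (round (y / 2))\<bar>" by (rule triangle_wave_le)
    also have "\<dots> \<le> \<bar>x - y\<bar> + triangle_wave y" unfolding triangle_wave_def by linarith
    finally show ?thesis .
  qed
  from this[of x y] this[of y x] show ?thesis by linarith
qed

lemma triangle_wave_near:
  assumes "\<bar>y - 2 * of_int k\<bar> \<le> 1"
  shows "triangle_wave y = \<bar>y - 2 * of_int k\<bar>"
proof (rule antisym)
  define m where "m = round (y / 2)"
  show "\<bar>y - 2 * of_int k\<bar> \<le> triangle_wave y"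
  proof (cases "m = k")
    case False
    then have "\<bar>m - k\<bar> \<ge> 1" by linarith
    then have "\<bar>real_of_int m - real_of_int k\<bar> \<ge> 1" by (metis of_int_1_le_iff of_int_abs of_int_diff)
    then have "\<bar>y - 2 * of_int m\<bar> \<ge> 1" using assms by linarith
    then show ?thesis using assms unfolding triangle_wave_def m_def by linarith
  qed (simp add: triangle_wave_def m_def)
qed (rule triangle_wave_le)

lemma triangle_wave_eqI:
  assumes "0 \<le> v" "v \<le> 1" "y = 2 * of_int k + v \<or> y = 2 * of_int k - v"
  shows "triangle_wave y = v"
  using triangle_wave_near[of y k] assms by auto

lemma triangle_wave_cases: "\<exists>k. y = 2 * of_int k + triangle_wave y \<or> y = 2 * of_int k - triangle_wave y"
  unfolding triangle_wave_def by (intro exI[of _ "round (y / 2)"]) linarith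

lemma bends_triangle_wave: "bends 1 triangle_wave I x"
proof -
  define k where "k = round (x / 2)"
  have k: "\<bar>x - 2 * of_int k\<bar> \<le> 1" using triangle_wave_range(2)[of x] unfolding triangle_wave_def k_def .
  have near: "triangle_wave y = \<bar>y - 2 * of_int k\<bar>" if "\<bar>y - 2 * of_int k\<bar> \<le> 1" for y k
    using that by (rule triangle_wave_near)
  consider "\<bar>x - 2 * of_int k\<bar> < 1" "x > 2 * of_int k" | "\<bar>x - 2 * of_int k\<bar> < 1" "x < 2 * of_int k"
    | "x = 2 * of_int k" | "x = 2 * of_int k + 1" | "x = 2 * of_int k - 1" using k by linarith
  then obtain \<epsilon> \<sigma> \<tau> where "\<epsilon> > 0" "\<bar>\<sigma>\<bar> = 1" "\<bar>\<tau>\<bar> = 1"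
     "\<And>y. x \<le> y \<Longrightarrow> y < x + \<epsilon> \<Longrightarrow> triangle_wave y = triangle_wave x + \<sigma> * (y - x)"
     "\<And>y. y \<le> x \<Longrightarrow> x - \<epsilon> < y \<Longrightarrow> triangle_wave y = triangle_wave x + \<tau> * (y - x)"
  proof cases
    case 1
    show ?thesis
    proof (rule that[of "min (x - 2 * of_int k) (1 - (x - 2 * of_int k))" 1 1])
      fix y assume "x \<le> y" "y < x + min (x - 2 * of_int k) (1 - (x - 2 * of_int k))"
      then show "triangle_wave y = triangle_wave x + 1 * (y - x)" using near[of y k] near[of x k] 1 by simp
    next
      fix y assume "y \<le> x" "x - min (x - 2 * of_int k) (1 - (x - 2 * of_int k)) < y"
      then show "triangle_wave y = triangle_wave x + 1 * (y - x)" using near[of y k] near[of x k] 1 by simp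
    qed (use 1 in auto)
  next
    case 2
    show ?thesis
    proof (rule that[of "min (2 * of_int k - x) (1 - (2 * of_int k - x))" "-1" "-1"])
      fix y assume "x \<le> y" "y < x + min (2 * of_int k - x) (1 - (2 * of_int k - x))"
      then show "triangle_wave y = triangle_wave x + - 1 * (y - x)" using near[of y k] near[of x k] 2 by simp
    next
      fix y assume "y \<le> x" "x - min (2 * of_int k - x) (1 - (2 * of_int k - x)) < y"
      then show "triangle_wave y = triangle_wave x + - 1 * (y - x)" using near[of y k] near[of x k] 2 by simp
    qed (use 2 in auto)
  next
    case 3
    show ?thesis
    proof (rule that[of 1 1 "-1"])
      fix y assume "x \<le> y" "y < x + 1"
      then show "triangle_wave y = triangle_wave x + 1 * (y - x)" using near[of y k] near[of x k] 3 by simp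
    next
      fix y assume "y \<le> x" "x - 1 < y"
      then show "triangle_wave y = triangle_wave x + - 1 * (y - x)" using near[of y k] near[of x k] 3 by simp
    qed auto
  next
    case 4
    show ?thesis
    proof (rule that[of 1 "-1" "1"])
      fix y assume "x \<le> y" "y < x + 1"
      then show "triangle_wave y = triangle_wave x + - 1 * (y - x)" using near[of y "k + 1"] near[of x "k + 1"] 4 by simp
    next
      fix y assume "y \<le> x" "x - 1 < y"
      then show "triangle_wave y = triangle_wave x + 1 * (y - x)" using near[of y k] near[of x k] 4 by simp
    qed auto
  next
    case 5
    show ?thesis
    proof (rule that[of 1 "-1" "1"])
      fix y assume "x \<le> y" "y < x + 1"
      then show "triangle_wave y = triangle_wave x + - 1 * (y - x)" using near[of y k] near[of x k] 5 by simp
    next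
      fix y assume "y \<le> x" "x - 1 < y"
      then show "triangle_wave y = triangle_wave x + 1 * (y - x)" using near[of y "k - 1"] near[of x "k - 1"] 5 by simp
    qed auto
  qed
  then show ?thesis unfolding bends_def by blast
qed

text \<open>
  The estimate is stated with a real bound \<open>t\<close>, so that iterating it involves only real
  arithmetic.
\<close>

lemma emeasure_affine_preimage:
  assumes "S \<in> sets borel" "\<sigma> \<noteq> 0" "emeasure lborel S \<le> ennreal t" "t \<ge> 0"
  shows "(\<lambda>y::real. c + \<sigma> * y) -` S \<in> sets borel"
    "emeasure lborel ((\<lambda>y. c + \<sigma> * y) -` S) \<le> ennreal (t / \<bar>\<sigma>\<bar>)"
proof -
  have m: "(\<lambda>y::real. c + \<sigma> * y) \<in> borel_measurable borel" by measurable
  show pre: "(\<lambda>y::real. c + \<sigma> * y) -` S \<in> sets borel" using measurable_sets[OF m assms(1)] by simp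
  have "emeasure lborel S = emeasure (density (distr lborel borel (\<lambda>x. c + \<sigma> * x)) (\<lambda>_. \<bar>\<sigma>\<bar>)) S"
    using lborel_real_affine[OF assms(2), of c] by simp
  also have "\<dots> = ennreal \<bar>\<sigma>\<bar> * emeasure (distr lborel borel (\<lambda>x. c + \<sigma> * x)) S"
    using assms(1) by (intro emeasure_density_const) auto
  also have "emeasure (distr lborel borel (\<lambda>x. c + \<sigma> * x)) S = emeasure lborel ((\<lambda>y. c + \<sigma> * y) -` S)"
    using assms(1) by (subst emeasure_distr) auto
  finally have eq: "ennreal \<bar>\<sigma>\<bar> * emeasure lborel ((\<lambda>y. c + \<sigma> * y) -` S) = emeasure lborel S" ..
  have "emeasure lborel ((\<lambda>y. c + \<sigma> * y) -` S) = ennreal (1 / \<bar>\<sigma>\<bar>) * emeasure lborel S"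
    unfolding eq[symmetric] mult.assoc[symmetric] using assms(2) by (simp add: ennreal_mult''[symmetric])
  also have "\<dots> \<le> ennreal (1 / \<bar>\<sigma>\<bar>) * ennreal t" using assms(3) by (intro mult_left_mono) auto
  also have "\<dots> = ennreal (t / \<bar>\<sigma>\<bar>)" using assms(4) by (simp add: ennreal_mult''[symmetric])
  finally show "emeasure lborel ((\<lambda>y. c + \<sigma> * y) -` S) \<le> ennreal (t / \<bar>\<sigma>\<bar>)" .
qed

text \<open>
  The preimage is contained in the preimages under two affine maps of slope \<open>\<plusminus> \<kappa>\<close>. A
  measurable superset is enough, so the measurability of the preimage itself need not be
  established.
\<close>

lemma bends_preimage:
  assumes "bends \<kappa> g I x" "\<kappa> > 0"
  shows "\<exists>\<epsilon>>0. \<forall>S t. S \<in> sets borel \<longrightarrow> t \<ge> 0 \<longrightarrow> emeasure lborel S \<le> ennreal t \<longrightarrow>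
    (\<exists>S'\<in>sets borel. {y \<in> I. y \<in> ball x \<epsilon> \<and> g y \<in> S} \<subseteq> S' \<and> emeasure lborel S' \<le> ennreal (2 / \<kappa> * t))"
proof -
  obtain \<epsilon> \<sigma> \<tau> where \<epsilon>: "\<epsilon> > 0" "\<bar>\<sigma>\<bar> = \<kappa>" "\<bar>\<tau>\<bar> = \<kappa>"
    and right: "\<And>y. y \<in> I \<Longrightarrow> x \<le> y \<Longrightarrow> y < x + \<epsilon> \<Longrightarrow> g y = g x + \<sigma> * (y - x)"
    and left: "\<And>y. y \<in> I \<Longrightarrow> y \<le> x \<Longrightarrow> x - \<epsilon> < y \<Longrightarrow> g y = g x + \<tau> * (y - x)"
    using assms(1) unfolding bends_def by blast
  have nz: "\<sigma> \<noteq> 0" "\<tau> \<noteq> 0" using \<epsilon> assms(2) by auto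
  show ?thesis
  proof (intro exI[of _ \<epsilon>] conjI allI impI \<epsilon>(1))
    fix S :: "real set" and t :: real
    assume S: "S \<in> sets borel" "t \<ge> 0" "emeasure lborel S \<le> ennreal t"
    let ?A = "(\<lambda>y. (g x - \<sigma> * x) + \<sigma> * y) -` S" and ?B = "(\<lambda>y. (g x - \<tau> * x) + \<tau> * y) -` S"
    note A = emeasure_affine_preimage[OF S(1) nz(1) S(3,2), of "g x - \<sigma> * x"]
    note B = emeasure_affine_preimage[OF S(1) nz(2) S(3,2), of "g x - \<tau> * x"]
    show "\<exists>S'\<in>sets borel. {y \<in> I. y \<in> ball x \<epsilon> \<and> g y \<in> S} \<subseteq> S' \<and> emeasure lborel S' \<le> ennreal (2 / \<kappa> * t)"
    proof (intro bexI[of _ "?A \<union> ?B"] conjI subsetI)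
      fix y assume "y \<in> {y \<in> I. y \<in> ball x \<epsilon> \<and> g y \<in> S}"
      then have y: "y \<in> I" "\<bar>y - x\<bar> < \<epsilon>" "g y \<in> S" by (auto simp: dist_real_def)
      show "y \<in> ?A \<union> ?B"
      proof (cases "x \<le> y")
        case True
        then have "g y = g x + \<sigma> * (y - x)" using right y by auto
        then have "(g x - \<sigma> * x) + \<sigma> * y = g y" by (simp add: algebra_simps)
        then show ?thesis using y(3) by (simp only: Un_iff vimage_eq) simp
      next
        case False
        then have "g y = g x + \<tau> * (y - x)" using left y by auto
        then have "(g x - \<tau> * x) + \<tau> * y = g y" by (simp add: algebra_simps)
        then show ?thesis using y(3) by (simp only: Un_iff vimage_eq) simp
      qed
    next
      have "emeasure lborel (?A \<union> ?B) \<le> emeasure lborel ?A + emeasure lborel ?B"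
        using A(1) B(1) by (intro emeasure_subadditive) auto
      also have "\<dots> \<le> ennreal (t / \<bar>\<sigma>\<bar>) + ennreal (t / \<bar>\<tau>\<bar>)" by (intro add_mono A(2) B(2))
      also have "\<dots> = ennreal (2 / \<kappa> * t)" using S(2) \<epsilon> assms(2) by (simp flip: ennreal_plus)
      finally show "emeasure lborel (?A \<union> ?B) \<le> ennreal (2 / \<kappa> * t)" .
    qed (use A(1) B(1) in auto)
  qed
qed

text \<open>
  Cover the unit interval by balls in which the \<open>m\<close>-th iterate has at most two branches on
  \<open>[a, b]\<close>. The set of points of \<open>[a, b]\<close> that visit prescribed balls at \<open>k\<close> successive multiples
  of \<open>m\<close> has measure at most \<open>(2 / s ^ m) ^ k * (b - a)\<close>, which bounds the number of elements of
  a subcover from below. The factor 2 costs \<open>1 / m\<close> in the entropy and disappears as \<open>m\<close> grows.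
\<close>

theorem bends_entropy:
  fixes f :: "real \<Rightarrow> real"
  assumes cont: "continuous_on {0..1} f" and maps: "f \<in> {0..1} \<rightarrow> {0..1}"
    and I: "0 \<le> a" "a < b" "b \<le> 1" "f \<in> {a..b} \<rightarrow> {a..b}"
    and bend: "\<And>x. x \<in> {a..b} \<Longrightarrow> bends s f {a..b} x" and s: "s > 1"
  shows "ereal (log 2 s) \<le> topological_entropy {0..1} f"
proof -
  let ?X = "{0..1::real}" and ?I = "{a..b}"
  have main: "ereal (log 2 s - 1 / real m) \<le> topological_entropy ?X f" if m: "m \<ge> 1" "2 \<le> s ^ m" for m
  proof -
    define g where "g = f ^^ m"
    define \<kappa> where "\<kappa> = s ^ m"
    have \<kappa>: "\<kappa> \<ge> 2" unfolding \<kappa>_def using m by simp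
    \<comment> \<open>Visiting \<open>U\<close> reduces the measure by the factor \<open>2 / \<kappa>\<close>.\<close>
    define small where "small U \<longleftrightarrow> (\<forall>S t. S \<in> sets borel \<longrightarrow> t \<ge> 0 \<longrightarrow> emeasure lborel S \<le> ennreal t \<longrightarrow>
      (\<exists>S'\<in>sets borel. {y \<in> ?I. y \<in> U \<and> g y \<in> S} \<subseteq> S' \<and> emeasure lborel S' \<le> ennreal (2 / \<kappa> * t)))" for U
    have "\<exists>\<epsilon>>0. small (ball x \<epsilon>)" if x: "x \<in> ?X" for x
    proof (cases "x \<in> ?I")
      case True
      have "bends \<kappa> g ?I x" unfolding \<kappa>_def g_def using bend I(4) s True by (intro bends_funpow) auto
      from bends_preimage[OF this] show ?thesis using \<kappa> unfolding small_def by auto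
    next
      case False
      then have "x \<in> - ?I" "open (- ?I)" by auto
      then obtain \<epsilon> where "\<epsilon> > 0" "ball x \<epsilon> \<subseteq> - ?I" using open_contains_ball by blast
      then show ?thesis unfolding small_def by (intro exI[of _ \<epsilon>]) (auto intro!: bexI[of _ "{}"])
    qed
    then obtain \<epsilon> where \<epsilon>: "\<And>x. x \<in> ?X \<Longrightarrow> \<epsilon> x > 0 \<and> small (ball x (\<epsilon> x))" by metis
    have "?X \<subseteq> (\<Union>x\<in>?X. ball x (\<epsilon> x))" using \<epsilon> by auto
    then obtain D where D: "D \<subseteq> ?X" "finite D" "?X \<subseteq> (\<Union>x\<in>D. ball x (\<epsilon> x))"
      using compactE_image[of ?X ?X "\<lambda>x. ball x (\<epsilon> x)"] by auto
    define \<U> where "\<U> = (\<lambda>x. ?X \<inter> ball x (\<epsilon> x)) ` D"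
    have cover: "finite_open_cover ?X \<U>"
      unfolding finite_open_cover_def \<U>_def using D by (auto simp: openin_open_Int)
    have small: "small U" if U: "U \<in> \<U>" for U
    proof -
      obtain x where x: "x \<in> D" "U = ?X \<inter> ball x (\<epsilon> x)" using U unfolding \<U>_def by blast
      have "{y \<in> ?I. y \<in> U \<and> g y \<in> S} = {y \<in> ?I. y \<in> ball x (\<epsilon> x) \<and> g y \<in> S}" for S
        using I unfolding x(2) by auto
      then show ?thesis using \<epsilon>[of x] x(1) D(1) unfolding small_def by auto
    qed
    have gI: "g \<in> ?I \<rightarrow> ?I" unfolding g_def using funpow_in[OF I(4)] by auto
    have thin: "\<exists>S\<in>sets borel. {x \<in> ?I. \<forall>i<k. (g ^^ i) x \<in> U i} \<subseteq> S \<and>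
        emeasure lborel S \<le> ennreal ((2 / \<kappa>) ^ k * (b - a))" if "\<forall>i<k. U i \<in> \<U>" for k U
      using that
    proof (induction k arbitrary: U)
      case 0
      show ?case using I by (intro bexI[of _ ?I]) auto
    next
      case (Suc k)
      obtain S where S: "S \<in> sets borel" "{x \<in> ?I. \<forall>i<k. (g ^^ i) x \<in> U (Suc i)} \<subseteq> S"
        "emeasure lborel S \<le> ennreal ((2 / \<kappa>) ^ k * (b - a))"
        using Suc.IH[of "\<lambda>i. U (Suc i)"] Suc.prems by auto
      have "small (U 0)" using Suc.prems by (intro small) auto
      moreover have "(2 / \<kappa>) ^ k * (b - a) \<ge> 0" using \<kappa> I by auto
      ultimately obtain S' where S': "S' \<in> sets borel" "{y \<in> ?I. y \<in> U 0 \<and> g y \<in> S} \<subseteq> S'"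
        "emeasure lborel S' \<le> ennreal (2 / \<kappa> * ((2 / \<kappa>) ^ k * (b - a)))"
        using S(1,3) unfolding small_def by blast
      have "{x \<in> ?I. \<forall>i<Suc k. (g ^^ i) x \<in> U i} \<subseteq> {y \<in> ?I. y \<in> U 0 \<and> g y \<in> S}"
      proof
        fix x assume "x \<in> {x \<in> ?I. \<forall>i<Suc k. (g ^^ i) x \<in> U i}"
        then have x: "x \<in> ?I" "\<forall>i<Suc k. (g ^^ i) x \<in> U i" by blast+
        have "(g ^^ i) (g x) \<in> U (Suc i)" if "i < k" for i
          using x(2)[rule_format, of "Suc i"] that by (simp add: funpow_swap1)
        moreover have "g x \<in> ?I" using gI x(1) by blast
        ultimately have "g x \<in> S" using S(2) by blast
        moreover have "x \<in> U 0" using x(2)[rule_format, of 0] by simp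
        ultimately show "x \<in> {y \<in> ?I. y \<in> U 0 \<and> g y \<in> S}" using x(1) by blast
      qed
      then have "{x \<in> ?I. \<forall>i<Suc k. (g ^^ i) x \<in> U i} \<subseteq> S'" using S'(2) by (rule order_trans)
      moreover have "emeasure lborel S' \<le> ennreal ((2 / \<kappa>) ^ Suc k * (b - a))"
        using S'(3) by (simp only: power_Suc mult.assoc)
      ultimately show ?case using S'(1) by (intro bexI[of _ S'] conjI)
    qed
    have "2 powr ((log 2 s - 1 / real m) * real n) \<le> real (min_subcover_card ?X f \<U> n)" if n: "n \<ge> 1" for n
    proof -
      obtain k where k: "\<And>j. j < k \<Longrightarrow> j * m < n" "real n / real m \<le> real k"
        using sampling_times[OF m(1) n] by blast
      obtain \<V> where \<V>: "finite \<V>" "\<V> \<subseteq> iterated_join ?X f \<U> n" "\<Union>\<V> = ?X"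
        "card \<V> = min_subcover_card ?X f \<U> n"
        using min_subcover_attained[OF maps cover] by metis
      have "\<forall>V\<in>\<V>. \<exists>S. S \<in> sets borel \<and> V \<inter> ?I \<subseteq> S \<and> emeasure lborel S \<le> ennreal ((2 / \<kappa>) ^ k * (b - a))"
      proof
        fix V assume "V \<in> \<V>"
        then obtain U where U: "V = {x \<in> ?X. \<forall>i<n. (f ^^ i) x \<in> U i}" "\<forall>i<n. U i \<in> \<U>"
          using \<V>(2) unfolding iterated_join_def by blast
        have "\<forall>i<k. U (i * m) \<in> \<U>" using U(2) k(1) by auto
        from thin[OF this] obtain S where S: "S \<in> sets borel" "{x \<in> ?I. \<forall>i<k. (g ^^ i) x \<in> U (i * m)} \<subseteq> S"
          "emeasure lborel S \<le> ennreal ((2 / \<kappa>) ^ k * (b - a))" by auto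
        have "g ^^ i = f ^^ (i * m)" for i unfolding g_def by (simp add: funpow_mult mult.commute)
        then have "V \<inter> ?I \<subseteq> {x \<in> ?I. \<forall>i<k. (g ^^ i) x \<in> U (i * m)}" unfolding U(1) using k(1) by auto
        then show "\<exists>S. S \<in> sets borel \<and> V \<inter> ?I \<subseteq> S \<and> emeasure lborel S \<le> ennreal ((2 / \<kappa>) ^ k * (b - a))"
          by (intro exI[of _ S] conjI S(1,3) order_trans[OF _ S(2)])
      qed
      then obtain S where S: "\<And>V. V \<in> \<V> \<Longrightarrow> S V \<in> sets borel \<and> V \<inter> ?I \<subseteq> S V \<and>
          emeasure lborel (S V) \<le> ennreal ((2 / \<kappa>) ^ k * (b - a))" by metis
      have "?I \<subseteq> (\<Union>V\<in>\<V>. S V)"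
      proof
        fix x assume x: "x \<in> ?I"
        then have "x \<in> \<Union>\<V>" unfolding \<V>(3) using I by auto
        then obtain V where V: "V \<in> \<V>" "x \<in> V" by blast
        then have "x \<in> S V" using S[OF V(1)] x by blast
        then show "x \<in> (\<Union>V\<in>\<V>. S V)" using V(1) by blast
      qed
      then have "emeasure lborel ?I \<le> emeasure lborel (\<Union>V\<in>\<V>. S V)"
        using S \<V>(1) by (intro emeasure_mono) auto
      also have "\<dots> \<le> (\<Sum>V\<in>\<V>. emeasure lborel (S V))"
        using S \<V>(1) by (intro emeasure_subadditive_finite) auto
      also have "\<dots> \<le> (\<Sum>V\<in>\<V>. ennreal ((2 / \<kappa>) ^ k * (b - a)))" using S by (intro sum_mono) auto
      also have "\<dots> = ennreal (real (card \<V>) * ((2 / \<kappa>) ^ k * (b - a)))"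
        using \<kappa> I by (simp add: ennreal_mult ennreal_of_nat_eq_real_of_nat)
      finally have "ennreal (b - a) \<le> ennreal (real (card \<V>) * ((2 / \<kappa>) ^ k * (b - a)))"
        using I by simp
      then have "b - a \<le> real (card \<V>) * ((2 / \<kappa>) ^ k * (b - a))"
        using \<kappa> I by (subst (asm) ennreal_le_iff) auto
      then have "1 * (b - a) \<le> real (card \<V>) * (2 / \<kappa>) ^ k * (b - a)" by simp
      then have "1 \<le> real (card \<V>) * (2 / \<kappa>) ^ k" using I by (subst (asm) mult_le_cancel_right_pos) auto
      then have ge: "(\<kappa> / 2) ^ k \<le> real (card \<V>)"
        using \<kappa> by (simp add: power_divide field_simps)
      have "(log 2 s - 1 / real m) * real n = log 2 (\<kappa> / 2) * (real n / real m)"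
        unfolding \<kappa>_def using s m by (simp add: log_divide log_nat_power field_simps)
      also have "\<dots> \<le> log 2 (\<kappa> / 2) * real k" using \<kappa> k(2) by (intro mult_left_mono) auto
      finally have "2 powr ((log 2 s - 1 / real m) * real n) \<le> 2 powr (log 2 (\<kappa> / 2) * real k)" by simp
      also have "\<dots> = (2 powr log 2 (\<kappa> / 2)) powr real k" by (simp add: powr_powr)
      also have "\<dots> = (\<kappa> / 2) ^ k" using \<kappa> by (simp add: powr_realpow)
      finally show ?thesis using ge \<V>(4) by simp
    qed
    then have "ereal (log 2 s - 1 / real m) \<le> cover_entropy ?X f \<U>" by (rule cover_entropy_ge)
    also have "\<dots> \<le> topological_entropy ?X f" using cover by (rule cover_entropy_le_topological)
    finally show ?thesis .
  qed
  show ?thesis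
  proof (rule ereal_le_epsilon2)
    fix e :: real assume e: "0 < e"
    obtain m1 where m1: "2 < s ^ m1" using real_arch_pow[OF s] by blast
    obtain m2 :: nat where m2: "1 / e < real m2" using reals_Archimedean2 by blast
    define m where "m = Suc (max m1 m2)"
    have "s ^ m1 \<le> s ^ m" unfolding m_def using s by (intro power_increasing) auto
    then have "m \<ge> 1" "2 \<le> s ^ m" using m1 unfolding m_def by auto
    from main[OF this] have "ereal (log 2 s - 1 / real m) + ereal e \<le> topological_entropy ?X f + ereal e"
      by (intro add_right_mono)
    moreover have "1 / real m \<le> e"
    proof -
      have "1 / e \<le> real m" using m2 unfolding m_def by simp
      then show ?thesis using e \<open>m \<ge> 1\<close> by (simp add: field_simps)
    qed
    then have "ereal (log 2 s) \<le> ereal (log 2 s - 1 / real m) + ereal e" by simp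
    ultimately show "ereal (log 2 s) \<le> topological_entropy ?X f + ereal e" by (rule order_trans[rotated])
  qed
qed

section \<open>Gluing maps of prescribed slopes\<close>

text \<open>
  The path that rises from 0 with slope \<open>s\<close> and then falls to 1 with slope \<open>- s\<close>, folded into
  the unit interval. Letting it end at 1 makes both end points of the unit interval fixed points,
  for every \<open>s \<ge> 1\<close>.
\<close>

definition zigzag :: "real \<Rightarrow> real \<Rightarrow> real" where
  "zigzag s y = triangle_wave (min (s * y) (s * (1 - y) + 1))"

lemma zigzag_range: "zigzag s y \<in> {0..1}"
  unfolding zigzag_def using triangle_wave_range by auto

lemma zigzag_endpoints:
  assumes "s \<ge> 1"
  shows "zigzag s 0 = 0" "zigzag s 1 = 1"
  unfolding zigzag_def using assms triangle_wave_eqI[of 0 0 0] triangle_wave_eqI[of 1 1 0] by (auto simp: min_def)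

lemma zigzag_lipschitz:
  assumes "s \<ge> 1"
  shows "\<bar>zigzag s x - zigzag s y\<bar> \<le> s * \<bar>x - y\<bar>"
proof -
  have "\<bar>zigzag s x - zigzag s y\<bar> \<le> \<bar>min (s * x) (s * (1 - x) + 1) - min (s * y) (s * (1 - y) + 1)\<bar>"
    unfolding zigzag_def by (rule triangle_wave_lipschitz)
  also have "\<dots> \<le> max \<bar>s * x - s * y\<bar> \<bar>(s * (1 - x) + 1) - (s * (1 - y) + 1)\<bar>" by linarith
  also have "\<dots> = s * \<bar>x - y\<bar>"
  proof -
    have "s * x - s * y = s * (x - y)" "(s * (1 - x) + 1) - (s * (1 - y) + 1) = - (s * (x - y))"
      by (simp_all add: right_diff_distrib)
    moreover have "\<bar>s * (x - y)\<bar> = s * \<bar>x - y\<bar>" using assms by (simp add: abs_mult)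
    ultimately have "\<bar>s * x - s * y\<bar> = s * \<bar>x - y\<bar>" "\<bar>(s * (1 - x) + 1) - (s * (1 - y) + 1)\<bar> = s * \<bar>x - y\<bar>"
      by (simp_all only: abs_minus_cancel)
    then show ?thesis by simp
  qed
  finally show ?thesis .
qed

lemma bends_zigzag:
  assumes "s \<ge> 1"
  shows "bends s (zigzag s) I x"
proof -
  define c where "c = (s + 1) / 2"
  let ?w = "\<lambda>y. s * y + (- c)"
  have w: "min (s * y) (s * (1 - y) + 1) = - 1 * \<bar>?w y\<bar> + c" for y
  proof -
    have "s * (1 - y) + 1 = 2 * c - s * y" unfolding c_def by (simp add: right_diff_distrib)
    then show ?thesis by (simp add: min_def abs_if)
  qed
  have "bends \<bar>s\<bar> ?w I x" by (rule bends_affine)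
  then have "bends (\<bar>s\<bar> * 1) (\<lambda>y. \<bar>?w y\<bar>) I x"
    by (rule bends_comp[OF _ bends_abs[of UNIV]]) (use assms in auto)
  then have "bends (\<bar>s\<bar> * 1 * \<bar>- 1\<bar>) (\<lambda>y. - 1 * \<bar>?w y\<bar> + c) I x"
    by (rule bends_comp[where g = "\<lambda>z. - 1 * z + c", OF _ bends_affine[of _ _ UNIV]])
      (use assms in auto)
  then have "bends (\<bar>s\<bar> * 1 * \<bar>- 1\<bar> * 1) (\<lambda>y. triangle_wave (- 1 * \<bar>?w y\<bar> + c)) I x"
    by (rule bends_comp[OF _ bends_triangle_wave[of UNIV]]) (use assms in auto)
  then show ?thesis unfolding zigzag_def[abs_def] w using assms by simp
qed

definition block_scale :: "nat \<Rightarrow> real" where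
  "block_scale j = real ((j + 1) * (j + 2))"

lemma block_scale_pos: "0 < block_scale j"
  unfolding block_scale_def by (simp only: of_nat_0_less_iff) simp

lemma block_scale_ends: "block_scale j * (1 / real (j + 2)) = real (j + 1)" "block_scale j * (1 / real (j + 1)) = real (j + 1) + 1"
  unfolding block_scale_def of_nat_mult by simp_all

lemma block_scale_gap: "1 / real (j + 1) - 1 / real (j + 2) = 1 / block_scale j"
proof -
  have "block_scale j * (1 / real (j + 1) - 1 / real (j + 2)) = 1"
    by (simp only: right_diff_distrib block_scale_ends)
  then show ?thesis using block_scale_pos[of j] by (simp only: eq_divide_eq mult.commute) simp
qed

lemma block_scale_ge_1: "1 \<le> block_scale j"
  unfolding block_scale_def by simp

definition block :: "nat \<Rightarrow> real set" where
  "block j = {1 / real (j + 2)..1 / real (j + 1)}"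

text \<open>
  The conjugate of \<open>zigzag s\<close> by the increasing affine map from the block onto the unit interval.
\<close>

definition block_map :: "nat \<Rightarrow> real \<Rightarrow> real \<Rightarrow> real" where
  "block_map j s x = (zigzag s (block_scale j * x - real (j + 1)) + real (j + 1)) / block_scale j"

text \<open>
  For \<open>0 < x \<le> 1\<close> the index selects the block that contains \<open>x\<close>. A common end point of two
  blocks is fixed by both of their maps, so it does not matter which of them is selected there.
\<close>

definition glued :: "(nat \<Rightarrow> real) \<Rightarrow> real \<Rightarrow> real" where
  "glued lam x = (if x \<le> 0 then 0 else block_map (nat \<lfloor>1 / x\<rfloor> - 1) (lam (nat \<lfloor>1 / x\<rfloor> - 1)) x)"

lemma block_unit: "x \<in> block j \<longleftrightarrow> block_scale j * x - real (j + 1) \<in> {0..1}"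
proof -
  have "1 / real (j + 2) \<le> x \<longleftrightarrow> block_scale j * (1 / real (j + 2)) \<le> block_scale j * x"
    "x \<le> 1 / real (j + 1) \<longleftrightarrow> block_scale j * x \<le> block_scale j * (1 / real (j + 1))"
    using block_scale_pos[of j] by (simp_all only: mult_le_cancel_left_pos)
  then show ?thesis unfolding block_def block_scale_ends by auto
qed

lemma block_map_block: "block_map j s x \<in> block j"
  using zigzag_range[of s "block_scale j * x - real (j + 1)"]
  unfolding block_unit block_map_def using block_scale_pos[of j] by simp

lemma block_subset: "block j \<subseteq> {0<..1}"
proof
  fix x assume "x \<in> block j"
  moreover have "0 < 1 / real (j + 2)" "1 / real (j + 1) \<le> 1" by auto
  ultimately have "0 < x" "x \<le> 1" unfolding block_def atLeastAtMost_iff by linarith+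
  then show "x \<in> {0<..1}" by simp
qed

lemma block_map_ends:
  assumes "s \<ge> 1"
  shows "block_map j s (1 / real (j + 2)) = 1 / real (j + 2)" "block_map j s (1 / real (j + 1)) = 1 / real (j + 1)"
proof -
  have "(0 + real (j + 1)) / block_scale j = 1 / real (j + 2)" "(1 + real (j + 1)) / block_scale j = 1 / real (j + 1)"
    using block_scale_pos[of j] block_scale_ends[of j] by (simp_all only: divide_eq_eq) (simp_all add: mult.commute)
  then show "block_map j s (1 / real (j + 2)) = 1 / real (j + 2)" "block_map j s (1 / real (j + 1)) = 1 / real (j + 1)"
    unfolding block_map_def block_scale_ends using zigzag_endpoints[OF assms] by simp_all
qed

lemma glued_block:
  assumes lam: "\<And>j. lam j \<ge> 1" and x: "x \<in> block j"
  shows "glued lam x = block_map j (lam j) x"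
proof -
  have pos: "0 < x" using x block_subset[of j] by auto
  have x': "1 / real (j + 2) \<le> x" "x \<le> 1 / real (j + 1)" using x unfolding block_def by auto
  show ?thesis
  proof (cases "x = 1 / real (j + 2)")
    case False
    then have "1 / x < real (j + 2)" "real (j + 1) \<le> 1 / x" using x' pos by (auto simp: field_simps)
    then have "\<lfloor>1 / x\<rfloor> = int (j + 1)" by (intro floor_unique) auto
    then have "nat \<lfloor>1 / x\<rfloor> - 1 = j" by simp
    then show ?thesis unfolding glued_def using pos by simp
  next
    case True
    then have "1 / x = real (j + 2)" by simp
    then have "\<lfloor>1 / x\<rfloor> = int (j + 2)" by (metis floor_of_int of_int_of_nat_eq)
    then have "nat \<lfloor>1 / x\<rfloor> - 1 = j + 1" by simp
    then have "glued lam x = block_map (j + 1) (lam (j + 1)) x" unfolding glued_def using pos by simp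
    also have "\<dots> = x" using block_map_ends(2)[OF lam[of "j + 1"], of "j + 1"] True by (simp add: add.commute)
    also have "\<dots> = block_map j (lam j) x" using block_map_ends(1)[OF lam[of j], of j] True by simp
    finally show ?thesis .
  qed
qed

lemma in_block:
  assumes "0 < x" "x \<le> 1"
  shows "\<exists>j. x \<in> block j"
proof -
  have "1 \<le> 1 / x" using assms by simp
  then obtain j where j: "nat \<lfloor>1 / x\<rfloor> = Suc j" "\<lfloor>1 / x\<rfloor> = int (Suc j)"
    by (metis floor_mono floor_one int_nat_eq nat_0_le not_one_le_zero of_nat_0 old.nat.exhaust order.trans zero_le_one)
  have "real (Suc j) \<le> 1 / x" "1 / x < real (Suc j) + 1"
    using j(2) floor_correct[of "1 / x"] by linarith+
  then have "x \<in> block j" unfolding block_def using assms by (auto simp: field_simps)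
  then show ?thesis by blast
qed

locale glued_zigzags =
  fixes lam :: "nat \<Rightarrow> real"
  assumes lam: "\<And>j. lam j \<ge> 1"
begin

abbreviation "F \<equiv> glued lam"

lemma F_zero: "F 0 = 0" by (simp add: glued_def)

lemma F_block: "x \<in> block j \<Longrightarrow> F x \<in> block j"
  using glued_block[of lam, OF lam] block_map_block by metis

lemma F_maps: "F \<in> {0..1} \<rightarrow> {0..1}"
proof
  fix x :: real assume x: "x \<in> {0..1}"
  show "F x \<in> {0..1}"
  proof (cases "x = 0")
    case False
    then obtain j where "x \<in> block j" using in_block[of x] x by auto
    then have "F x \<in> block j" by (rule F_block)
    then show ?thesis using block_subset[of j] by auto
  qed (simp add: F_zero)
qed

lemma F_initial:
  assumes "x \<in> {0..1 / real (J + 1)}"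
  shows "F x \<in> {0..1 / real (J + 1)}"
proof (cases "x = 0")
  case False
  have "1 / real (J + 1) \<le> 1" by simp
  then have x: "0 < x" "x \<le> 1" "x \<le> 1 / real (J + 1)"
    using assms False unfolding atLeastAtMost_iff by linarith+
  obtain j where j: "x \<in> block j" using in_block[OF x(1,2)] by blast
  show ?thesis
  proof (cases "j \<ge> J")
    case True
    then have "1 / real (j + 1) \<le> 1 / real (J + 1)" by (simp add: field_simps)
    moreover have "F x \<in> block j" using j by (rule F_block)
    ultimately show ?thesis using block_subset[of j] unfolding block_def by auto
  next
    case False
    then have "1 / real (J + 1) \<le> 1 / real (j + 2)" by (simp add: field_simps)
    then have "x = 1 / real (j + 2)"
      using j x(3) unfolding block_def atLeastAtMost_iff by linarith
    moreover have "F x = block_map j (lam j) x" by (rule glued_block[OF lam j])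
    ultimately have "F x = x" using block_map_ends(1)[OF lam[of j], of j] by simp
    then show ?thesis using assms by simp
  qed
qed (simp add: F_zero)

lemma F_lipschitz_block:
  assumes "x \<in> block j" "y \<in> block j"
  shows "\<bar>F x - F y\<bar> \<le> lam j * \<bar>x - y\<bar>"
proof -
  let ?m = "block_scale j"
  have m: "?m > 0" by (rule block_scale_pos)
  have "F x - F y = (zigzag (lam j) (?m * x - real (j + 1)) - zigzag (lam j) (?m * y - real (j + 1))) / ?m"
    unfolding glued_block[of lam, OF lam assms(1)] glued_block[of lam, OF lam assms(2)] block_map_def
    by (simp add: diff_divide_distrib[symmetric])
  then have "\<bar>F x - F y\<bar> = \<bar>zigzag (lam j) (?m * x - real (j + 1)) - zigzag (lam j) (?m * y - real (j + 1))\<bar> / ?m"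
    using m by (simp only: abs_divide abs_of_pos)
  also have "\<dots> \<le> lam j * \<bar>(?m * x - real (j + 1)) - (?m * y - real (j + 1))\<bar> / ?m"
    using m by (intro divide_right_mono zigzag_lipschitz lam) auto
  also have "(?m * x - real (j + 1)) - (?m * y - real (j + 1)) = ?m * (x - y)"
    by (simp add: right_diff_distrib)
  also have "lam j * \<bar>?m * (x - y)\<bar> / ?m = lam j * \<bar>x - y\<bar>"
    using m by (simp only: abs_mult abs_of_pos) simp
  finally show ?thesis .
qed

lemma F_lipschitz:
  assumes "\<And>j. j < J \<Longrightarrow> lam j \<le> L" "0 \<le> L"
  shows "L-lipschitz_on {1 / real (J + 1)..1} F"
proof (rule lipschitz_on_closed_Union[where I = "{..<J + 1}" and U = "\<lambda>j. if j = J then {1 / real (J + 1)} else block j"])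
  fix j assume "j \<in> {..<J + 1}"
  show "L-lipschitz_on (if j = J then {1 / real (J + 1)} else block j) F"
  proof (cases "j = J")
    case True
    then show ?thesis using assms(2) by (simp add: lipschitz_on_def)
  next
    case False
    then have j: "j < J" using \<open>j \<in> {..<J + 1}\<close> by auto
    have "\<bar>F x - F y\<bar> \<le> L * \<bar>x - y\<bar>" if "x \<in> block j" "y \<in> block j" for x y
      using F_lipschitz_block[OF that] assms(1)[OF j] by (meson abs_ge_zero mult_right_mono order_trans)
    then show ?thesis using False assms(2) by (simp add: lipschitz_on_def dist_real_def)
  qed
  show "closed (if j = J then {1 / real (J + 1)} else block j)" unfolding block_def by auto
next
  show "{1 / real (J + 1)..1} \<subseteq> (\<Union>j\<in>{..<J + 1}. if j = J then {1 / real (J + 1)} else block j)"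
  proof
    fix x assume x: "x \<in> {1 / real (J + 1)..1}"
    have "0 < 1 / real (J + 1)" by simp
    then have "0 < x" "x \<le> 1" using x unfolding atLeastAtMost_iff by linarith+
    then obtain j where j: "x \<in> block j" using in_block by blast
    show "x \<in> (\<Union>j\<in>{..<J + 1}. if j = J then {1 / real (J + 1)} else block j)"
    proof (cases "j < J")
      case False
      then have "1 / real (j + 1) \<le> 1 / real (J + 1)" by (simp add: field_simps)
      then have "x = 1 / real (J + 1)" using j x unfolding block_def by auto
      then show ?thesis by (intro UN_I[of J]) auto
    qed (use j in \<open>auto intro!: UN_I[of j]\<close>)
  qed
qed (use assms in auto)

lemma F_bends:
  assumes "x \<in> block j"
  shows "bends (lam j) F (block j) x"
proof -
  let ?m = "block_scale j"
  have m: "?m > 0" by (rule block_scale_pos)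
  have "bends \<bar>?m\<bar> (\<lambda>y. ?m * y + (- real (j + 1))) (block j) x" by (rule bends_affine)
  then have "bends (\<bar>?m\<bar> * lam j) (\<lambda>y. zigzag (lam j) (?m * y + (- real (j + 1)))) (block j) x"
    by (rule bends_comp[OF _ bends_zigzag[OF lam[of j], of UNIV]]) (use m in auto)
  then have "bends (\<bar>?m\<bar> * lam j * \<bar>1 / ?m\<bar>)
      (\<lambda>y. 1 / ?m * zigzag (lam j) (?m * y + (- real (j + 1))) + real (j + 1) / ?m) (block j) x"
    by (rule bends_comp[where g = "\<lambda>z. 1 / ?m * z + real (j + 1) / ?m", OF _ bends_affine[of _ _ UNIV]])
      (use m lam[of j] in \<open>auto intro!: mult_pos_pos\<close>)
  moreover have "\<bar>?m\<bar> * lam j * \<bar>1 / ?m\<bar> = lam j" using m by simp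
  ultimately have "bends (lam j)
      (\<lambda>y. 1 / ?m * zigzag (lam j) (?m * y + (- real (j + 1))) + real (j + 1) / ?m) (block j) x" by simp
  then show ?thesis
  proof (rule bends_cong[OF _ assms])
    fix y assume "y \<in> block j"
    then show "1 / ?m * zigzag (lam j) (?m * y + (- real (j + 1))) + real (j + 1) / ?m = F y"
      unfolding glued_block[of lam, OF lam \<open>y \<in> block j\<close>] block_map_def
      by (simp only: add_uminus_conv_diff add_divide_distrib) simp
  qed
qed

lemma F_iterate_lipschitz:
  assumes "x \<in> block j" "y \<in> block j"
  shows "\<bar>(F ^^ k) x - (F ^^ k) y\<bar> \<le> lam j ^ k * \<bar>x - y\<bar>"
proof (induction k)
  case (Suc k)
  have B: "F \<in> block j \<rightarrow> block j" using F_block by auto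
  have "\<bar>(F ^^ Suc k) x - (F ^^ Suc k) y\<bar> \<le> lam j * \<bar>(F ^^ k) x - (F ^^ k) y\<bar>"
    using F_lipschitz_block[OF funpow_in[OF B assms(1)] funpow_in[OF B assms(2)]] by simp
  also have "\<dots> \<le> lam j * (lam j ^ k * \<bar>x - y\<bar>)" using Suc lam[of j] by (intro mult_left_mono) auto
  finally show ?case by (simp add: mult.assoc)
qed simp

text \<open>
  Under \<open>n\<close> steps the block \<open>j\<close> is stretched at most by \<open>lam j ^ n \<le> 2 powr (h * n)\<close>, so it can be
  cut into that many pieces, up to a constant factor, each of which stays within single elements of
  the cover. All but finitely many blocks lie in one short invariant interval, which needs only one
  piece.
\<close>

lemma entropy_le:
  assumes h: "\<And>j. lam j \<le> 2 powr h" and h0: "h \<ge> 0"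
  shows "topological_entropy {0..1} F \<le> ereal h"
  unfolding topological_entropy_def
proof (rule SUP_least)
  fix \<U> :: "real set set" assume "\<U> \<in> {\<U>. finite_open_cover {0..1} \<U>}"
  then have cover: "finite_open_cover {0..1} \<U>" by simp
  obtain \<delta> where \<delta>: "\<delta> > 0" "\<And>T. T \<subseteq> {0..1} \<Longrightarrow> diameter T < \<delta> \<Longrightarrow> \<exists>U\<in>\<U>. T \<subseteq> U"
    using finite_open_cover_Lebesgue[OF compact_Icc _ cover] by auto
  obtain J :: nat where J: "1 / \<delta> < real J" using reals_Archimedean2 by blast
  then have J': "1 / real (J + 1) < \<delta>" using \<delta>(1) by (simp add: field_simps)
  define C where "C = 1 + real J * (1 / \<delta> + 2)"
  have "real (min_subcover_card {0..1} F \<U> n) \<le> C * 2 powr (h * real n)" if "n \<ge> 1" for n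
  proof -
    define H where "H = 2 powr (h * real n)"
    have H: "H \<ge> 1" unfolding H_def using h0 by (intro ge_one_powr_ge_zero) auto
    define K where "K = nat \<lceil>H / \<delta>\<rceil> + 1"
    have "H / \<delta> > 0" using H \<delta>(1) by simp
    then have K: "H / \<delta> < real K" "real K \<le> H / \<delta> + 2" unfolding K_def by linarith+
    define len where "len j = 1 / block_scale j / real K" for j
    \<comment> \<open>The index \<open>(J, 0)\<close> stands for the invariant interval, \<open>(j, i)\<close> with \<open>j < J\<close> for piece \<open>i\<close> of block \<open>j\<close>.\<close>
    define P where "P = (\<lambda>(j, i). if j = J then {0..1 / real (J + 1)}
      else {1 / real (j + 2) + len j * real i..1 / real (j + 2) + len j * real (i + 1)} \<inter> block j)"
    define Ind where "Ind = insert (J, 0) ({..<J} \<times> {..<K})"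
    have "min_subcover_card {0..1} F \<U> n \<le> card Ind"
    proof (rule min_subcover_card_le[where P = P])
      show "finite Ind" unfolding Ind_def by auto
      show "{0..1} \<subseteq> (\<Union>i\<in>Ind. P i)"
      proof
        fix x :: real assume x: "x \<in> {0..1}"
        show "x \<in> (\<Union>i\<in>Ind. P i)"
        proof (cases "x \<le> 1 / real (J + 1)")
          case True
          then have "x \<in> P (J, 0)" unfolding P_def using x by auto
          then show ?thesis unfolding Ind_def by blast
        next
          case False
          have "0 < 1 / real (J + 1)" by simp
          then have "0 < x" using False by linarith
          then obtain j where j: "x \<in> block j" using in_block[of x] x by auto
          have "j < J"
          proof (rule ccontr)
            assume "\<not> j < J"
            then have "1 / real (j + 1) \<le> 1 / real (J + 1)" by (simp add: field_simps)
            then show False using j False unfolding block_def by auto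
          qed
          define t where "t = (x - 1 / real (j + 2)) / len j"
          have "0 < real K" using K(1) \<open>H / \<delta> > 0\<close> by linarith
          then have len: "len j > 0" unfolding len_def using block_scale_pos[of j] by simp
          have "1 / real (j + 1) - 1 / real (j + 2) = len j * real K"
            unfolding len_def block_scale_gap using \<open>0 < real K\<close> by simp
          then have t: "0 \<le> t" "t \<le> real K"
          proof -
            have "0 \<le> x - 1 / real (j + 2)" "x - 1 / real (j + 2) \<le> real K * len j"
              using j \<open>1 / real (j + 1) - 1 / real (j + 2) = len j * real K\<close> unfolding block_def atLeastAtMost_iff mult.commute[of "real K"]
              by linarith+
            then show "0 \<le> t" "t \<le> real K" unfolding t_def using len by (simp_all add: divide_le_eq)
          qed
          define i where "i = min (nat \<lfloor>t\<rfloor>) (K - 1)"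
          have "K \<ge> 1" unfolding K_def by simp
          have i: "i < K" "real i \<le> t" "t \<le> real (i + 1)"
          proof -
            show "i < K" unfolding i_def using \<open>K \<ge> 1\<close> by auto
            show "real i \<le> t" unfolding i_def using t by (simp add: min_def) linarith
            show "t \<le> real (i + 1)"
            proof (cases "nat \<lfloor>t\<rfloor> \<le> K - 1")
              case True
              then show ?thesis unfolding i_def using t by (simp add: min_def) linarith
            next
              case False
              then show ?thesis unfolding i_def using t \<open>K \<ge> 1\<close> by (simp add: min_def of_nat_diff)
            qed
          qed
          have "x = 1 / real (j + 2) + len j * t" unfolding t_def using len by simp
          then have "x \<in> P (j, i)"
            unfolding P_def using i j \<open>j < J\<close> len by (auto intro!: mult_left_mono)
          then show ?thesis using i(1) \<open>j < J\<close> unfolding Ind_def by blast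
        qed
      qed
      fix p assume p: "p \<in> Ind"
      have "\<exists>U\<in>\<U>. (F ^^ k) ` P p \<subseteq> U" if k: "k < n" for k
      proof (cases "p = (J, 0)")
        case True
        have B: "F \<in> {0..1 / real (J + 1)} \<rightarrow> {0..1 / real (J + 1)}" using F_initial by (rule Pi_I)
        have "P p = {0..1 / real (J + 1)}" unfolding P_def True by simp
        then have "(F ^^ k) ` P p \<subseteq> {0..1 / real (J + 1)}"
          using funpow_in[OF B] by (simp only: image_subsetI)
        moreover have "\<exists>U\<in>\<U>. {0..1 / real (J + 1)} \<subseteq> U"
          using J' by (intro \<delta>(2)) (auto simp: diameter_closed_interval)
        ultimately show ?thesis by blast
      next
        case False
        then obtain j i where ji: "p = (j, i)" "j < J" "i < K" using p unfolding Ind_def by auto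
        have sub: "P p \<subseteq> block j" unfolding P_def ji using ji(2) by auto
        have B: "F \<in> block j \<rightarrow> block j" using F_block by auto
        have img: "(F ^^ k) ` P p \<subseteq> {0..1}"
        proof (rule image_subsetI)
          fix x assume "x \<in> P p"
          then have "(F ^^ k) x \<in> block j" using sub by (intro funpow_in[OF B]) (rule subsetD)
          then show "(F ^^ k) x \<in> {0..1}" using block_subset[of j] by auto
        qed
        have len: "len j \<le> 1 / real K" "0 \<le> len j"
        proof -
          have "1 / block_scale j \<le> 1" using block_scale_ge_1[of j] by simp
          then show "len j \<le> 1 / real K" unfolding len_def by (intro divide_right_mono) auto
          show "0 \<le> len j" unfolding len_def using block_scale_pos[of j] by simp
        qed
        have "diameter ((F ^^ k) ` P p) \<le> H / real K"
        proof (rule diameter_le)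
          show "(F ^^ k) ` P p \<noteq> {} \<or> 0 \<le> H / real K" using H by auto
          fix u v assume "u \<in> (F ^^ k) ` P p" "v \<in> (F ^^ k) ` P p"
          then obtain x y where xy: "x \<in> P p" "y \<in> P p" "u = (F ^^ k) x" "v = (F ^^ k) y" by blast
          have "\<bar>x - y\<bar> \<le> len j"
            using xy(1,2) ji(2) unfolding P_def ji by (auto simp: algebra_simps abs_le_iff)
          then have d: "\<bar>x - y\<bar> \<le> 1 / real K" using len by linarith
          have "\<bar>u - v\<bar> \<le> lam j ^ k * \<bar>x - y\<bar>"
            unfolding xy using xy(1,2) sub by (intro F_iterate_lipschitz) auto
          also have "\<dots> \<le> H * (1 / real K)"
          proof (intro mult_mono d)
            have "lam j ^ k \<le> lam j ^ n" using lam[of j] k by (intro power_increasing) auto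
            also have "\<dots> \<le> (2 powr h) ^ n" using h[of j] lam[of j] by (intro power_mono) auto
            also have "\<dots> = H" unfolding H_def by (simp add: powr_powr flip: powr_realpow)
            finally show "lam j ^ k \<le> H" .
          qed (use H in auto)
          finally show "norm (u - v) \<le> H / real K" by simp
        qed
        also have "H / real K < \<delta>" 
        proof -
          have "0 < real K" unfolding K_def by simp
          then show ?thesis using K(1) \<delta>(1) by (simp add: field_simps)
        qed
        finally show ?thesis using \<delta>(2)[OF img] by blast
      qed
      then obtain U where U: "\<And>k. k < n \<Longrightarrow> U k \<in> \<U> \<and> (F ^^ k) ` P p \<subseteq> U k" by metis
      have "P p \<subseteq> {0..1}"
      proof (cases "p = (J, 0)")
        case True
        have "1 / real (J + 1) \<le> 1" by simp
        then show ?thesis unfolding P_def True by auto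
      next
        case False
        then obtain j i where "p = (j, i)" "j < J" using p unfolding Ind_def by auto
        then show ?thesis using block_subset[of j] unfolding P_def by auto
      qed
      then have "P p \<subseteq> {x \<in> {0..1}. \<forall>k<n. (F ^^ k) x \<in> U k}" using U by blast
      moreover have "{x \<in> {0..1}. \<forall>k<n. (F ^^ k) x \<in> U k} \<in> iterated_join {0..1} F \<U> n"
        unfolding iterated_join_def using U by (intro CollectI exI[of _ U] conjI) auto
      ultimately show "\<exists>V\<in>iterated_join {0..1} F \<U> n. P p \<subseteq> V" by blast
    qed
    also have "card Ind \<le> 1 + J * K" unfolding Ind_def
      by (rule order_trans[OF card_insert_le_m1]) (auto simp: card_cartesian_product)
    finally have "real (min_subcover_card {0..1} F \<U> n) \<le> real (1 + J * K)" by (simp only: of_nat_le_iff)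
    also have "\<dots> = 1 + real J * real K" by simp
    also have "\<dots> \<le> H + real J * (H / \<delta> + 2 * H)" using K(2) H by (intro add_mono mult_left_mono) auto
    also have "\<dots> = C * H" unfolding C_def by (simp add: field_simps)
    finally show ?thesis unfolding H_def .
  qed
  then show "cover_entropy {0..1} F \<U> \<le> ereal h"
    using cover by (intro cover_entropy_le[OF F_maps]) auto
qed

lemma entropy_ge:
  assumes "continuous_on {0..1} F"
  shows "ereal (log 2 (lam j)) \<le> topological_entropy {0..1} F"
proof (cases "lam j = 1")
  case True
  then show ?thesis using topological_entropy_nonneg[OF F_maps] by (simp add: zero_ereal_def)
next
  case False
  then have gt: "lam j > 1" using lam[of j] by simp
  have ends: "0 \<le> 1 / real (j + 2)" "1 / real (j + 2) < 1 / real (j + 1)" "1 / real (j + 1) \<le> 1"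
    by (auto simp: field_simps)
  have "F \<in> block j \<rightarrow> block j" using F_block by auto
  then show ?thesis
    using bends_entropy[OF assms F_maps ends _ F_bends[unfolded block_def] gt] unfolding block_def by blast
qed

theorem entropy_eq:
  assumes cont: "continuous_on {0..1} F"
  shows "topological_entropy {0..1} F = (SUP j. ereal (log 2 (lam j)))"
proof (rule antisym)
  show "(SUP j. ereal (log 2 (lam j))) \<le> topological_entropy {0..1} F"
    using entropy_ge[OF cont] by (intro SUP_least)
  show "topological_entropy {0..1} F \<le> (SUP j. ereal (log 2 (lam j)))" (is "_ \<le> ?h")
  proof (cases "?h = \<infinity>")
    case False
    have "ereal (log 2 (lam 0)) \<le> ?h" by (intro SUP_upper) auto
    moreover have "0 \<le> log 2 (lam 0)" using lam[of 0] by simp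
    ultimately have "0 \<le> ?h" by (metis ereal_less_eq(5) order_trans)
    then obtain h where h: "?h = ereal h" using False by (cases ?h) auto
    have "lam j \<le> 2 powr h" for j
    proof -
      have "ereal (log 2 (lam j)) \<le> ?h" by (intro SUP_upper) auto
      then have "log 2 (lam j) \<le> h" unfolding h by simp
      then show ?thesis using lam[of j] by (simp add: log_le_iff)
    qed
    then show ?thesis using entropy_le[of h] h \<open>0 \<le> ?h\<close> by auto
  qed simp
qed

end

section \<open>Computability of the glued map\<close>

lemma of_rat_min: "(of_rat (min a b) :: real) = min (of_rat a) (of_rat b)"
  by (simp add: min_def of_rat_less_eq)

text \<open>
  A certificate that the glued map sends \<open>x\<close> to \<open>v\<close>: the block of \<open>x\<close> is \<open>j\<close>, and the even
  integer nearest to the unfolded value is \<open>2 * k\<close>. Checking it requires neither rounding nor the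
  choice of a branch.
\<close>

definition zigzag_graph :: "(nat \<Rightarrow> rat) \<Rightarrow> nat \<Rightarrow> nat \<Rightarrow> rat \<Rightarrow> rat \<Rightarrow> bool" where
  "zigzag_graph lam j k x v \<longleftrightarrow>
    (let m = of_nat ((j + 1) * (j + 2)); y = m * x - of_nat (j + 1); u = m * v - of_nat (j + 1);
       w = min (lam j * y) (lam j * (1 - y) + 1)
     in 0 \<le> y \<and> y \<le> 1 \<and> 0 \<le> u \<and> u \<le> 1 \<and> (w = 2 * of_nat k + u \<or> w = 2 * of_nat k - u))"

lemma zigzag_graph_sound:
  assumes lam: "\<And>j. 1 \<le> lam j" and graph: "zigzag_graph lam j k x v"
  shows "glued (\<lambda>j. of_rat (lam j)) (of_rat x) = of_rat v"
proof -
  let ?m = "of_nat ((j + 1) * (j + 2)) :: rat"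
  define y where "y = ?m * x - of_nat (j + 1)"
  define u where "u = ?m * v - of_nat (j + 1)"
  define w where "w = min (lam j * y) (lam j * (1 - y) + 1)"
  have g: "0 \<le> y" "y \<le> 1" "0 \<le> u" "u \<le> 1" "w = 2 * of_nat k + u \<or> w = 2 * of_nat k - u"
    using graph unfolding zigzag_graph_def Let_def y_def u_def w_def by auto
  have ry: "of_rat y = block_scale j * of_rat x - real (j + 1)"
    unfolding y_def block_scale_def by (simp only: of_rat_diff of_rat_mult of_rat_of_nat_eq)
  have ru: "of_rat u = block_scale j * of_rat v - real (j + 1)"
    unfolding u_def block_scale_def by (simp only: of_rat_diff of_rat_mult of_rat_of_nat_eq)
  have rw: "of_rat w = min (of_rat (lam j) * of_rat y) (of_rat (lam j) * (1 - of_rat y) + (1::real))"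
    unfolding w_def of_rat_min by (simp add: of_rat_mult of_rat_add of_rat_diff)
  have "(of_rat w :: real) = 2 * of_int (int k) + of_rat u \<or> (of_rat w :: real) = 2 * of_int (int k) - of_rat u"
    using g(5) by (auto simp: of_rat_add of_rat_diff of_rat_mult)
  moreover have "0 \<le> (of_rat u :: real)" "(of_rat u :: real) \<le> 1" using g(3,4) by auto
  ultimately have "triangle_wave (of_rat w) = of_rat u" by (intro triangle_wave_eqI)
  then have zz: "zigzag (of_rat (lam j)) (of_rat y) = of_rat u" unfolding zigzag_def rw .
  have "(of_rat y :: real) \<in> {0..1}" using g(1,2) by auto
  then have "of_rat x \<in> block j" unfolding block_unit ry .
  then have "glued (\<lambda>j. of_rat (lam j)) (of_rat x) = block_map j (of_rat (lam j)) (of_rat x)"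
    using lam by (intro glued_block) auto
  also have "\<dots> = (of_rat u + real (j + 1)) / block_scale j"
    unfolding block_map_def ry[symmetric] zz ..
  also have "\<dots> = of_rat v" unfolding ru using block_scale_pos[of j] by simp
  finally show ?thesis .
qed

lemma zigzag_graph_exists:
  assumes lam: "\<And>j. 1 \<le> lam j" and x: "0 < x" "x \<le> 1"
  shows "\<exists>j k v. zigzag_graph lam j k x v"
proof -
  have "(0::real) < of_rat x" "(of_rat x :: real) \<le> 1" using x by auto
  then obtain j where j: "of_rat x \<in> block j" using in_block by blast
  let ?m = "of_nat ((j + 1) * (j + 2)) :: rat"
  define y where "y = ?m * x - of_nat (j + 1)"
  define w where "w = min (lam j * y) (lam j * (1 - y) + 1)"
  have "of_rat y = block_scale j * of_rat x - real (j + 1)"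
    unfolding y_def block_scale_def by (simp only: of_rat_diff of_rat_mult of_rat_of_nat_eq)
  then have "(of_rat y :: real) \<in> {0..1}" using j unfolding block_unit by simp
  then have y: "0 \<le> y" "y \<le> 1" by auto
  have "0 \<le> lam j" using lam[of j] by simp
  then have "0 \<le> w" unfolding w_def using y by simp
  then have w: "0 \<le> (of_rat w :: real)" by simp
  obtain k where k: "(of_rat w :: real) = 2 * of_int k + triangle_wave (of_rat w) \<or> (of_rat w :: real) = 2 * of_int k - triangle_wave (of_rat w)"
    using triangle_wave_cases by blast
  have t: "0 \<le> triangle_wave (of_rat w)" "triangle_wave (of_rat w) \<le> 1" by (rule triangle_wave_range)+
  have "k \<ge> 0" using k
  proof
    assume "(of_rat w :: real) = 2 * of_int k + triangle_wave (of_rat w)"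
    then have "- 1 \<le> 2 * real_of_int k" using t w by linarith
    then show "k \<ge> 0" by linarith
  next
    assume "(of_rat w :: real) = 2 * of_int k - triangle_wave (of_rat w)"
    then have "0 \<le> 2 * real_of_int k" using t w by linarith
    then show "k \<ge> 0" by linarith
  qed
  then obtain n where n: "k = int n" by (metis nonneg_int_cases)
  obtain u where u: "of_rat u = triangle_wave (of_rat w)" "w = 2 * of_nat n + u \<or> w = 2 * of_nat n - u"
  proof -
    from k show ?thesis
    proof
      assume e: "(of_rat w :: real) = 2 * of_int k + triangle_wave (of_rat w)"
      then have "of_rat (w - 2 * of_nat n) = triangle_wave (of_rat w)" unfolding n by (simp add: of_rat_diff of_rat_mult)
      then show ?thesis by (rule that) simp
    next
      assume e: "(of_rat w :: real) = 2 * of_int k - triangle_wave (of_rat w)"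
      then have "of_rat (2 * of_nat n - w) = triangle_wave (of_rat w)" unfolding n by (simp add: of_rat_diff of_rat_mult)
      then show ?thesis by (rule that) simp
    qed
  qed
  have "0 \<le> (of_rat u :: real)" "(of_rat u :: real) \<le> 1" using t unfolding u(1) by auto
  then have u01: "0 \<le> u" "u \<le> 1" by auto
  define v where "v = (u + of_nat (j + 1)) / ?m"
  have m0: "?m \<noteq> 0" by (simp only: of_nat_eq_0_iff) simp
  have "?m * v - of_nat (j + 1) = u" unfolding v_def using m0 by (simp del: of_nat_mult of_nat_Suc of_nat_add)
  then have "zigzag_graph lam j n x v"
    unfolding zigzag_graph_def Let_def y_def[symmetric] w_def[symmetric] using y u01 u(2) by simp
  then show ?thesis by blast
qed

lemma computable_zigzag_graph:
  assumes "computable lam" "computable j" "computable k" "computable x" "computable v"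
  shows "computable (\<lambda>e. zigzag_graph lam (j e) (k e) (x e) (v e))"
  unfolding zigzag_graph_def Let_def
  by (intro computable_intros assms computable_comp[OF assms(1)])

text \<open>
  Two reasons for a ball to be mapped into the ball with centre \<open>q\<close> and radius \<open>r\<close>. Either it
  stays away from 0, and the Lipschitz constant \<open>J + 1\<close> controls the image; or it lies in
  \<open>[0, 1 / (J + 1)]\<close>, which is invariant and contained in the target.
\<close>

definition ball_into :: "(nat \<Rightarrow> rat) \<Rightarrow> rat \<Rightarrow> rat \<Rightarrow> rat \<Rightarrow> rat \<Rightarrow> bool" where
  "ball_into lam q r q' r' \<longleftrightarrow> (0 \<le> q' \<and> q' \<le> 1 \<and> 0 < r') \<and>
    ((\<exists>J j k v. zigzag_graph lam j k q' v \<and>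
       1 / of_nat (Suc J) \<le> q' - r' \<and> \<bar>v - q\<bar> + of_nat (Suc J) * r' \<le> r) \<or>
     (\<exists>J. q' + r' \<le> 1 / of_nat (Suc J) \<and> \<bar>q\<bar> < r \<and> \<bar>1 / of_nat (Suc J) - q\<bar> < r))"

lemma semidecidable_ball_into:
  assumes lam: "computable lam"
  shows "semidecidable (\<lambda>z::nat \<times> nat \<times> nat. ball_into lam (decode (fst z)) (decode (fst (snd z)))
     (fst (decode (snd (snd z)) :: rat \<times> rat)) (snd (decode (snd (snd z)) :: rat \<times> rat)))"
  unfolding ball_into_def
  by (rule semidecidable_conj[OF semidecidableI_computable semidecidable_disj[OF
        semidecidable_ex[OF semidecidable_ex[OF semidecidable_ex[OF semidecidable_ex[OF semidecidableI_computable]]]]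
        semidecidable_ex[OF semidecidableI_computable]]])
    (intro computable_intros computable_zigzag_graph lam)+

theorem computable_glued:
  assumes computable_lam: "computable lam" and ge: "\<And>j. 1 \<le> lam j" and le: "\<And>j. lam j \<le> of_nat (Suc j)"
  shows "computable_unit_map (glued (\<lambda>j. of_rat (lam j)))"
proof -
  let ?lam = "\<lambda>j. of_rat (lam j) :: real"
  interpret glued_zigzags ?lam using ge by unfold_locales simp
  have lip: "\<bar>F x - F y\<bar> \<le> real (Suc J) * \<bar>x - y\<bar>"
    if "x \<in> {1 / real (Suc J)..1}" "y \<in> {1 / real (Suc J)..1}" for x y J
  proof -
    have "?lam j \<le> real (Suc J)" if "j < J" for j
    proof -
      have "?lam j \<le> of_rat (of_nat (Suc j))" using le[of j] by (simp only: of_rat_less_eq)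
      also have "\<dots> = real (Suc j)" by (simp only: of_rat_of_nat_eq)
      finally show ?thesis using that by simp
    qed
    then have "lipschitz_on (real (Suc J)) {1 / real (J + 1)..1} F" by (intro F_lipschitz) auto
    then show ?thesis using that unfolding lipschitz_on_def dist_real_def by simp
  qed
  obtain p where p: "\<And>i j c. (\<exists>n. recf_eval p [i, j, n] c) \<longleftrightarrow> ball_into lam (decode i) (decode j)
     (fst (decode c :: rat \<times> rat)) (snd (decode c :: rat \<times> rat))"
    using semidecidable_enumeration[OF semidecidable_ball_into[OF computable_lam]] by blast
  have enum: "enumerated p [i, j] = {(q', r'). ball_into lam (rat_of_code i) (rat_of_code j) q' r'}" for i j
  proof -
    have "enumerated p [i, j] = {decode c :: rat \<times> rat | c. \<exists>n. recf_eval p [i, j, n] c}"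
      unfolding enumerated_def by (auto simp: rat_pair_of_code_def decode_prod_def decode_rat_def)
    also have "\<dots> = {decode c | c. ball_into lam (decode i) (decode j)
        (fst (decode c :: rat \<times> rat)) (snd (decode c :: rat \<times> rat))}" unfolding p ..
    also have "\<dots> = {(q', r'). ball_into lam (decode i) (decode j) q' r'}"
    proof (intro set_eqI iffI)
      fix z :: "rat \<times> rat" assume "z \<in> {(q', r'). ball_into lam (decode i) (decode j) q' r'}"
      moreover obtain c where "z = decode c" using decode_surj[of z] by metis
      ultimately show "z \<in> {decode c | c. ball_into lam (decode i) (decode j)
        (fst (decode c :: rat \<times> rat)) (snd (decode c :: rat \<times> rat))}" by (auto simp: split_beta)
    qed (auto simp: split_beta)
    finally show ?thesis by (simp add: decode_rat_def)
  qed
  have key: "{x \<in> {0..1}. F x \<in> unit_ball q r} = (\<Union>(q', r')\<in>{(q', r'). ball_into lam q r q' r'}. unit_ball q' r')"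
    if q: "0 \<le> q" "q \<le> 1" "0 < r" for q r
  proof (intro set_eqI iffI)
    fix x assume "x \<in> {x \<in> {0..1}. F x \<in> unit_ball q r}"
    then have x: "0 \<le> x" "x \<le> 1" and Fx: "\<bar>F x - of_rat q\<bar> < of_rat r" unfolding unit_ball_def by auto
    have "\<exists>q' r'. ball_into lam q r q' r' \<and> x \<in> unit_ball q' r'"
    proof (cases "x = 0")
      case True
      have q0: "\<bar>q\<bar> < r"
      proof -
        have "(of_rat \<bar>q\<bar> :: real) < of_rat r" using Fx unfolding True F_zero by (simp add: abs_of_rat)
        then show ?thesis by (simp only: of_rat_less)
      qed
      have "(0::rat) < r - \<bar>q\<bar>" using q0 by simp
      then obtain J where J: "1 / of_nat (Suc J) < r - \<bar>q\<bar>"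
        using reals_Archimedean[of "r - \<bar>q\<bar>"] by (auto simp: inverse_eq_divide)
      have pos: "(0::rat) < 1 / of_nat (Suc J)" by simp
      then have "\<bar>1 / of_nat (Suc J) - q\<bar> < r" using J q(1) by linarith
      then have "ball_into lam q r 0 (1 / of_nat (Suc J))"
        unfolding ball_into_def using pos q0 by auto
      moreover have "x \<in> unit_ball 0 (1 / of_nat (Suc J))"
        unfolding unit_ball_def True using pos by (simp del: of_nat_Suc)
      ultimately show ?thesis by blast
    next
      case False
      then have x0: "0 < x" using x by simp
      obtain J where J: "1 / real (Suc J) < x"
        using reals_Archimedean[OF x0] by (auto simp: inverse_eq_divide)
      \<comment> \<open>Half of the slack \<open>e\<close> covers the distance from \<open>x\<close> to the rational centre, the other half the radius.\<close>
      define e where "e = of_rat r - \<bar>F x - of_rat q\<bar>"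
      have e: "e > 0" unfolding e_def using Fx by simp
      have "0 < min ((x - 1 / real (Suc J)) / 2) (e / (2 * real (Suc J)))" using J e by simp
      then obtain q' r' where q': "0 \<le> q'" "q' \<le> 1" "0 < r'" "\<bar>x - of_rat q'\<bar> < of_rat r'"
        and r': "of_rat r' < min ((x - 1 / real (Suc J)) / 2) (e / (2 * real (Suc J)))"
        by (rule rational_ball_around[OF x])
      have r0: "0 < (of_rat r' :: real)" using q'(3) by simp
      have r'1: "2 * of_rat r' < x - 1 / real (Suc J)" using r' by simp
      have r'2: "2 * real (Suc J) * of_rat r' < e"
      proof -
        have "of_rat r' < e / (2 * real (Suc J))" using r' by simp
        then show ?thesis by (simp add: field_simps)
      qed
      have away: "1 / real (Suc J) \<le> of_rat q' - of_rat r'" using r'1 q'(4) by linarith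
      moreover have "0 < 1 / real (Suc J)" by simp
      ultimately have "0 < (of_rat q' :: real)" using r0 by linarith
      then have "0 < q'" by simp
      obtain j k v where g: "zigzag_graph lam j k q' v" using zigzag_graph_exists[of lam, OF ge \<open>0 < q'\<close> q'(2)] by blast
      have v: "F (of_rat q') = of_rat v" by (rule zigzag_graph_sound[of lam, OF ge g])
      from away have "of_rat (1 / of_nat (Suc J)) \<le> (of_rat (q' - r') :: real)"
        by (simp add: of_rat_divide of_rat_diff of_rat_add)
      then have c1: "1 / of_nat (Suc J) \<le> q' - r'" by (simp only: of_rat_less_eq)
      have "\<bar>F (of_rat q') - F x\<bar> \<le> real (Suc J) * \<bar>of_rat q' - x\<bar>"
      proof (rule lip)
        have "1 / real (Suc J) \<le> of_rat q'"
          using away r0 by linarith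
        moreover have "(of_rat q' :: real) \<le> 1" using q'(2) by simp
        ultimately show "of_rat q' \<in> {1 / real (Suc J)..1}" by (simp only: atLeastAtMost_iff)
        show "x \<in> {1 / real (Suc J)..1}" using J x by auto
      qed
      also have "\<dots> \<le> real (Suc J) * of_rat r'" using q'(4) by (intro mult_left_mono) auto
      finally have "\<bar>of_rat v - of_rat q\<bar> + real (Suc J) * of_rat r' \<le> (of_rat r :: real)"
        using r'2 unfolding v e_def by linarith
      then have "of_rat (\<bar>v - q\<bar> + of_nat (Suc J) * r') \<le> (of_rat r :: real)"
        by (simp only: of_rat_add of_rat_mult of_rat_of_nat_eq abs_of_rat[symmetric] of_rat_diff)
      then have "\<bar>v - q\<bar> + of_nat (Suc J) * r' \<le> r" by (simp only: of_rat_less_eq)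
      then have "ball_into lam q r q' r'"
        unfolding ball_into_def using c1 g q' by (intro conjI disjI1 exI) auto
      moreover have "x \<in> unit_ball q' r'" unfolding unit_ball_def using x q'(4) by auto
      ultimately show ?thesis by blast
    qed
    then show "x \<in> (\<Union>(q', r')\<in>{(q', r'). ball_into lam q r q' r'}. unit_ball q' r')" by blast
  next
    fix x assume "x \<in> (\<Union>(q', r')\<in>{(q', r'). ball_into lam q r q' r'}. unit_ball q' r')"
    then obtain q' r' where b: "ball_into lam q r q' r'" and "x \<in> unit_ball q' r'" by blast
    then have x: "0 \<le> x" "x \<le> 1" "\<bar>x - of_rat q'\<bar> < of_rat r'" unfolding unit_ball_def by auto
    have "F x \<in> {0..1}" using F_maps x by auto
    have "\<bar>F x - of_rat q\<bar> < of_rat r"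
      using b unfolding ball_into_def
    proof (elim conjE disjE exE)
      fix J j k v
      assume q'01: "0 \<le> q'" "q' \<le> 1" "0 < r'" and g: "zigzag_graph lam j k q' v"
        and "1 / of_nat (Suc J) \<le> q' - r'" "\<bar>v - q\<bar> + of_nat (Suc J) * r' \<le> r"
      then have "of_rat (1 / of_nat (Suc J)) \<le> (of_rat (q' - r') :: real)"
        "of_rat (\<bar>v - q\<bar> + of_nat (Suc J) * r') \<le> (of_rat r :: real)" by (simp_all only: of_rat_less_eq)
      then have c: "1 / real (Suc J) \<le> of_rat q' - of_rat r'"
        "\<bar>of_rat v - of_rat q\<bar> + real (Suc J) * of_rat r' \<le> (of_rat r :: real)"
        by (simp_all only: of_rat_add of_rat_mult of_rat_of_nat_eq abs_of_rat[symmetric] of_rat_diff of_rat_divide of_rat_1)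
      have v: "F (of_rat q') = of_rat v" by (rule zigzag_graph_sound[of lam, OF ge g])
      have r0: "0 < (of_rat r' :: real)" "(of_rat q' :: real) \<le> 1" using q'01 by auto
      have "\<bar>F x - F (of_rat q')\<bar> \<le> real (Suc J) * \<bar>x - of_rat q'\<bar>"
      proof (rule lip)
        have "1 / real (Suc J) \<le> x" "1 / real (Suc J) \<le> of_rat q'" using c(1) x r0 by linarith+
        then show "x \<in> {1 / real (Suc J)..1}" "of_rat q' \<in> {1 / real (Suc J)..1}"
          using x(2) r0(2) by (simp_all only: atLeastAtMost_iff)
      qed
      also have "\<dots> < real (Suc J) * of_rat r'" using x(3) by (intro mult_strict_left_mono) auto
      finally show ?thesis using c(2) unfolding v by linarith
    next
      fix J
      assume "q' + r' \<le> 1 / of_nat (Suc J)" "\<bar>q\<bar> < r" "\<bar>1 / of_nat (Suc J) - q\<bar> < r"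
      then have "of_rat (q' + r') \<le> (of_rat (1 / of_nat (Suc J)) :: real)"
        "of_rat \<bar>q\<bar> < (of_rat r :: real)" "of_rat \<bar>1 / of_nat (Suc J) - q\<bar> < (of_rat r :: real)"
        by (simp_all only: of_rat_less_eq of_rat_less)
      then have c: "of_rat q' + of_rat r' \<le> 1 / real (Suc J)"
        "\<bar>of_rat q\<bar> < (of_rat r :: real)" "\<bar>1 / real (Suc J) - of_rat q\<bar> < (of_rat r :: real)"
        by (simp_all only: of_rat_add of_rat_mult of_rat_of_nat_eq abs_of_rat[symmetric] of_rat_diff of_rat_divide of_rat_1)
      have "F x \<in> {0..1 / real (J + 1)}"
      proof (rule F_initial)
        have "x \<le> 1 / real (Suc J)" using x(3) c(1) by linarith
        then show "x \<in> {0..1 / real (J + 1)}" using x(1) by simp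
      qed
      then have "0 \<le> F x" "F x \<le> 1 / real (Suc J)" by auto
      then show ?thesis using c(2,3) by linarith
    qed
    then show "x \<in> {x \<in> {0..1}. F x \<in> unit_ball q r}"
      using x \<open>F x \<in> {0..1}\<close> unfolding unit_ball_def by auto
  qed
  show ?thesis unfolding computable_unit_map_def
  proof (intro conjI F_maps exI[of _ p] allI impI)
    fix i j q r assume "rat_of_code i = q \<and> rat_of_code j = r \<and> 0 \<le> q \<and> q \<le> 1 \<and> 0 < r"
    then have e: "enumerated p [i, j] = {(q', r'). ball_into lam q r q' r'}"
      and q: "0 \<le> q" "q \<le> 1" "0 < r" unfolding enum by auto
    show "\<forall>(q', r')\<in>enumerated p [i, j]. 0 \<le> q' \<and> q' \<le> 1 \<and> 0 < r'"
      unfolding e ball_into_def by auto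
    show "{x \<in> {0..1}. F x \<in> unit_ball q r} = (\<Union>(q', r')\<in>enumerated p [i, j]. unit_ball q' r')"
      unfolding e by (rule key[OF q])
  qed
qed

section \<open>The entropies of computable interval maps\<close>

text \<open>
  For an exponent $(a-b)/(c+1)$ the inequality becomes one between natural numbers when both sides
  are raised to the power \<open>c + 1\<close>.
\<close>

lemma computable_below_powr:
  "computable (\<lambda>z::rat \<times> nat \<times> nat. real (fst (snd z)) / real (Suc (snd (snd z))) \<le> 2 powr of_rat (fst z))"
proof (rule computable_from_rat[where F = "\<lambda>a b c x. fst x ^ Suc c * 2 ^ b \<le> 2 ^ a * Suc (snd x) ^ Suc c"])
  show "computable (\<lambda>t::nat \<times> nat \<times> nat \<times> nat \<times> nat. fst (snd (snd (snd t))) ^ Suc (fst (snd (snd t))) * 2 ^ fst (snd t)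
     \<le> 2 ^ fst t * Suc (snd (snd (snd (snd t)))) ^ Suc (fst (snd (snd t))))"
    by (intro computable_intros)
  fix a b c :: nat and x :: "nat \<times> nat"
  let ?K = "real (fst x) / real (Suc (snd x))"
  let ?q = "(of_rat (rat_frac a b c) :: real)"
  have q: "?q = (real a - real b) / real (Suc c)"
    unfolding rat_frac_def by (simp only: of_rat_divide of_rat_diff of_rat_of_nat_eq)
  have "?K \<le> 2 powr ?q \<longleftrightarrow> ?K ^ Suc c \<le> (2 powr ?q) ^ Suc c"
    by (rule power_mono_iff[symmetric]) auto
  also have "(2 powr ?q) ^ Suc c = 2 powr (?q * real (Suc c))"
  proof -
    have "(2 powr ?q) ^ Suc c = (2 powr ?q) powr real (Suc c)" by (rule powr_realpow[symmetric]) simp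
    then show ?thesis by (simp only: powr_powr)
  qed
  also have "?q * real (Suc c) = real a - real b" unfolding q by (simp del: of_nat_Suc)
  also have "2 powr (real a - real b) = 2 ^ a / 2 ^ b" by (simp add: powr_diff powr_realpow)
  also have "?K ^ Suc c \<le> 2 ^ a / 2 ^ b \<longleftrightarrow> real (fst x) ^ Suc c * 2 ^ b \<le> 2 ^ a * real (Suc (snd x)) ^ Suc c"
    by (simp add: power_divide divide_le_eq le_divide_eq mult.commute del: of_nat_Suc power_Suc)
  also have "\<dots> \<longleftrightarrow> real (fst x ^ Suc c * 2 ^ b) \<le> real (2 ^ a * Suc (snd x) ^ Suc c)"
    by (simp only: of_nat_mult of_nat_power of_nat_numeral)
  finally show "(real (fst (snd (rat_frac a b c, x))) / real (Suc (snd (snd (rat_frac a b c, x)))) \<le> 2 powr of_rat (fst (rat_frac a b c, x)))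
      = (fst x ^ Suc c * 2 ^ b \<le> 2 ^ a * Suc (snd x) ^ Suc c)"
    by (simp only: fst_conv snd_conv of_nat_le_iff)
qed

text \<open>
  The fractions that lie between 1 and some \<open>2 powr of_rat (s n)\<close>; triples \<open>(n, k, t)\<close> that do not
  give such a fraction contribute the slope 1, whose logarithm is 0.
\<close>

definition slopes :: "(nat \<Rightarrow> rat) \<Rightarrow> nat \<Rightarrow> rat" where
  "slopes s m = (let n = fst (prod_decode m); k = fst (prod_decode (snd (prod_decode m)));
       t = snd (prod_decode (snd (prod_decode m)))
     in if Suc t \<le> k \<and> real k / real (Suc t) \<le> 2 powr of_rat (s n)
        then of_nat k * (1 / of_nat (Suc t)) else 1)"

lemma computable_slopes:
  assumes "computable s"
  shows "computable (slopes s)"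
proof -
  have below: "computable (\<lambda>e. real (k e) / real (Suc (t e)) \<le> 2 powr of_rat (q e))"
    if "computable k" "computable t" "computable q" for k t :: "nat \<Rightarrow> nat" and q
    using computable_comp[OF computable_below_powr, of "\<lambda>e. (q e, k e, t e)"] that
    by (simp add: computable_intros)
  show ?thesis
    unfolding slopes_def[abs_def] Let_def
    by (intro below computable_intros computable_comp[OF assms])
qed

lemma slopes_ge_1: "1 \<le> slopes s m"
proof -
  have "(1::rat) \<le> of_nat k * (1 / of_nat (Suc t))" if "Suc t \<le> k" for k t
  proof -
    have "(of_nat (Suc t) :: rat) \<le> of_nat k" using that by (simp only: of_nat_le_iff)
    then show ?thesis by (simp add: le_divide_eq)
  qed
  then show ?thesis unfolding slopes_def Let_def by auto
qed

text \<open>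
  A component of a pair is at most the code of the pair; this bounds the numerator.
\<close>

lemma slopes_le: "slopes s m \<le> of_nat (Suc m)"
proof -
  obtain n k t where m: "m = prod_encode (n, prod_encode (k, t))"
    by (metis prod_decode_inverse surj_pair)
  have "k \<le> prod_encode (k, t)" "prod_encode (k, t) \<le> m"
    unfolding m by (rule le_prod_encode_1, rule le_prod_encode_2)
  then have k: "k \<le> m" by simp
  have "of_nat k * (1 / of_nat (Suc t)) \<le> (of_nat k :: rat) * 1"
    by (intro mult_left_mono) (auto simp: divide_le_eq)
  also have "\<dots> \<le> of_nat (Suc m)" using k by simp
  finally show ?thesis unfolding slopes_def Let_def m by auto
qed

lemma log_slopes_Sup:
  assumes "0 \<le> h" "h = (SUP n. ereal (of_rat (s n)))"
  shows "(SUP m. ereal (log 2 (of_rat (slopes s m)))) = h"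
proof (rule antisym)
  show "(SUP m. ereal (log 2 (of_rat (slopes s m)))) \<le> h"
  proof (rule SUP_least)
    fix m
    obtain n k t where m: "m = prod_encode (n, prod_encode (k, t))"
      by (metis prod_decode_inverse surj_pair)
    show "ereal (log 2 (of_rat (slopes s m))) \<le> h"
    proof (cases "Suc t \<le> k \<and> real k / real (Suc t) \<le> 2 powr of_rat (s n)")
      case True
      then have "slopes s m = of_nat k * (1 / of_nat (Suc t))" unfolding slopes_def Let_def m by simp
      then have "of_rat (slopes s m) = real k / real (Suc t)"
        by (simp only: of_rat_mult of_rat_divide of_rat_of_nat_eq of_rat_1) simp
      moreover have "0 < real k / real (Suc t)" using True by simp
      ultimately have "log 2 (of_rat (slopes s m)) \<le> of_rat (s n)"
        using True by (simp add: log_le_iff del: of_nat_Suc)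
      then have "ereal (log 2 (of_rat (slopes s m))) \<le> ereal (of_rat (s n))" by simp
      also have "\<dots> \<le> h" unfolding assms(2) by (rule SUP_upper) simp
      finally show ?thesis .
    next
      case False
      then have "slopes s m = 1" unfolding slopes_def Let_def m by auto
      then show ?thesis using assms(1) by (simp add: zero_ereal_def)
    qed
  qed
  have nonneg: "0 \<le> (SUP m. ereal (log 2 (of_rat (slopes s m))))" (is "0 \<le> ?S")
  proof -
    have "ereal (log 2 (of_rat (slopes s 0))) \<le> ?S" by (rule SUP_upper) simp
    moreover have "0 \<le> log 2 (of_rat (slopes s 0))" using slopes_ge_1[of s 0] by simp
    ultimately show ?thesis by (metis ereal_less_eq(5) order_trans)
  qed
  show "h \<le> ?S" unfolding assms(2)
  proof (rule SUP_least, rule dense_le)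
    fix n and x :: ereal assume x: "x < ereal (of_rat (s n))"
    show "x \<le> ?S"
    proof (cases "x < 0")
      case True
      then show ?thesis using nonneg by simp
    next
      case False
      then obtain c where c: "x = ereal c" "0 \<le> c" "c < of_rat (s n)" using x by (cases x) auto
      then have "2 powr c < 2 powr of_rat (s n)" by simp
      from of_rat_dense[OF this]
      obtain K where K: "2 powr c < (of_rat K :: real)" "(of_rat K :: real) < 2 powr of_rat (s n)" by (elim exE conjE)
      have "1 \<le> 2 powr c" using c(2) by (intro ge_one_powr_ge_zero) auto
      then have "1 < (of_rat K :: real)" using K by linarith
      then have K1: "1 < K" by simp
      obtain a b where ab: "K = Fract a b" "b > 0" by (cases K) auto
      then have "b < a" using K1 by (simp add: one_less_Fract_iff)
      define k where "k = nat a"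
      define t where "t = nat b - 1"
      have kt: "K = of_nat k * (1 / of_nat (Suc t))" "Suc t \<le> k"
        unfolding k_def t_def using ab \<open>b < a\<close> by (auto simp: Fract_of_int_quotient)
      have rK: "of_rat K = real k / real (Suc t)"
        unfolding kt(1) by (simp only: of_rat_mult of_rat_divide of_rat_of_nat_eq of_rat_1) simp
      define m where "m = prod_encode (n, prod_encode (k, t))"
      have "real k / real (Suc t) \<le> 2 powr of_rat (s n)" using K(2) unfolding rK by simp
      then have "slopes s m = K" unfolding slopes_def Let_def m_def using kt by simp
      then have "c \<le> log 2 (of_rat (slopes s m))"
        using K(1) \<open>1 < (of_rat K :: real)\<close> by (simp add: le_log_iff)
      then have "x \<le> ereal (log 2 (of_rat (slopes s m)))" unfolding c(1) by simp
      also have "\<dots> \<le> ?S" by (rule SUP_upper) simp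
      finally show ?thesis .
    qed
  qed
qed

theorem theoremC:
  "{topological_entropy {0..1} f | f. computable_unit_map f} =
   {h :: ereal. 0 \<le> h \<and> lower_computable h}"
proof (intro set_eqI iffI)
  fix h assume "h \<in> {topological_entropy {0..1} f | f. computable_unit_map f}"
  then obtain f where f: "computable_unit_map f" "h = topological_entropy {0..1} f" by blast
  have "0 \<le> h" unfolding f(2)
    using computable_unit_map_continuous(1)[OF f(1)] by (intro topological_entropy_nonneg) auto
  moreover have "lower_computable h" unfolding f(2) by (rule computable_map_entropy_lower_computable[OF f(1)])
  ultimately show "h \<in> {h. 0 \<le> h \<and> lower_computable h}" by simp
next
  fix h :: ereal assume "h \<in> {h. 0 \<le> h \<and> lower_computable h}"
  then have h: "0 \<le> h" "lower_computable h" by auto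
  obtain s :: "nat \<Rightarrow> rat" where s: "computable s" "h = (SUP n. ereal (of_rat (s n)))"
  proof (cases "h = \<infinity>")
    case True
    have "computable (\<lambda>n::nat. of_nat n :: rat)" by (intro computable_intros)
    moreover have "h = (SUP n. ereal (of_rat (of_nat n)))" using True SUP_nat_Infty by simp
    ultimately show ?thesis by (rule that[of "\<lambda>n. of_nat n"])
  next
    case False
    then show ?thesis using h(2) that unfolding lower_computable_def computable_rat_seq_iff by blast
  qed
  let ?f = "glued (\<lambda>j. of_rat (slopes s j))"
  have comp: "computable_unit_map ?f"
    using computable_slopes[OF s(1)] slopes_ge_1 slopes_le by (rule computable_glued)
  interpret glued_zigzags "\<lambda>j. of_rat (slopes s j)" using slopes_ge_1 by unfold_locales simp
  have "topological_entropy {0..1} ?f = (SUP j. ereal (log 2 (of_rat (slopes s j))))"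
    using computable_unit_map_continuous(2)[OF comp] by (rule entropy_eq)
  also have "\<dots> = h" using h(1) s(2) by (rule log_slopes_Sup)
  finally show "h \<in> {topological_entropy {0..1} f | f. computable_unit_map f}" using comp by blast
qed

end
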